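(* Let $p$ be an odd prime and $q=p^e$ for some $e>0$. Let $d\geq 3$ be odd such that $q\equiv 1\pmod{d(d-1)}$. For $\lambda\in\mathbb{F}_q$ with $\lambda\neq 0$, the number $N_{\mathbb{F}_q}(Z_\lambda)$ of $\mathbb{F}_q$-points on the $0$-dimensional variety $Z_\lambda: x_1^d+x_2^d=d\lambda x_1x_2^{d-1}$ in $\mathbb{P}^1$ satisfies $$q\cdot N_{\mathbb{F}_q}(Z_\lambda)=q-1+q^{\frac{d-1}{2}}\sum_{t\in\mathbb{F}_q}\phi(1-t)\;{_{d-1}F}_{d-2}\left(\begin{array}{cccccccc}\chi^{\frac{d-1}{2}},&\chi,&\ldots,&\chi^{\frac{d-1}{2}-1},&\chi^{\frac{d-1}{2}+1},&\chi^{\frac{d-1}{2}+2},&\ldots,&\chi^{d-1}\\ &\psi,&\ldots,&\psi^{\frac{d-1}{2}-1},&\varepsilon,&\psi^{\frac{d-1}{2}+1},&\ldots,&\psi^{d-2}\end{array}\Big|\ \frac t\alpha\right),$$ where $\chi$ and $\psi$ are multiplicative characters on $\mathbb{F}_q$ of order $d$ and $d-1$ respectively, and $\alpha=\lambda^d(d-1)^{d-1}$. Here the first upper parameter is $A_0=\chi^{\frac{d-1}2}$, and the remaining columns (upper parameter over lower parameter) are, in order: $\chi^i$ over $\psi^i$ for $1\le i\le\frac{d-1}2-1$; then $\chi^{\frac{d-1}2+1}$ over $\varepsilon$; then $\chi^{i+1}$ over $\psi^{i}$ for $\frac{d-1}2+1\le i\le d-2$.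
   Context: $N_{\mathbb{F}_q}(Z_\lambda)$ is the number of points $[x_1:x_2]\in\mathbb{P}^1(\mathbb{F}_q)$ satisfying $x_1^d+x_2^d=d\lambda x_1x_2^{d-1}$. Multiplicative characters $\chi:\mathbb{F}_q^\times\to\mathbb{C}^\times$ are extended to $\mathbb{F}_q$ by $\chi(0):=0$, including the trivial character $\varepsilon$; $\phi$ is the quadratic character on $\mathbb{F}_q$, and $\overline{B}$ is the inverse of a character $B$. For characters $A,B$ on $\mathbb{F}_q$ define $\binom{A}{B}:=\frac{B(-1)}{q}\sum_{x\in\mathbb{F}_q}A(x)\overline{B}(1-x)$. Greene's (Gaussian) hypergeometric series: for characters $A_0,\ldots,A_n$, $B_1,\ldots,B_n$ on $\mathbb{F}_q$ and $x\in\mathbb{F}_q$, $${_{n+1}F}_n\left(\begin{array}{cccc}A_0,&A_1,&\ldots,&A_n\\ &B_1,&\ldots,&B_n\end{array}\Big|\ x\right):=\frac{q}{q-1}\sum_{\eta}\binom{A_0\eta}{\eta}\binom{A_1\eta}{B_1\eta}\cdots\binom{A_n\eta}{B_n\eta}\eta(x),$$ where the sum is over all multiplicative characters $\eta$ on $\mathbb{F}_q$. *)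

theory Defs
  imports
    Complex_Main
    "HOL-Library.Cardinality"
    "HOL-Computational_Algebra.Primes"
    "HOL-Number_Theory.Cong"
    "HOL-Algebra.Multiplicative_Group"
begin

section \<open>Points on the projective line\<close>

definition proj_rel :: "(('a::field \<times> 'a) \<times> ('a \<times> 'a)) set" where
  "proj_rel = {((x1, x2), (y1, y2)). (x1, x2) \<noteq> (0, 0) \<and> (y1, y2) \<noteq> (0, 0) \<and>
     (\<exists>c. c \<noteq> 0 \<and> y1 = c * x1 \<and> y2 = c * x2)}"

lemma equiv_proj_rel: "equiv (- {(0, 0)}) (proj_rel :: (('a::field \<times> 'a) \<times> ('a \<times> 'a)) set)"
proof (rule equivI)
  show "(proj_rel :: (('a \<times> 'a) \<times> ('a \<times> 'a)) set) \<subseteq> (- {(0, 0)}) \<times> (- {(0, 0)})"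
    by (auto simp: proj_rel_def)
  show "refl_on (- {(0, 0)}) (proj_rel :: (('a \<times> 'a) \<times> ('a \<times> 'a)) set)"
    by (auto simp: refl_on_def proj_rel_def intro!: exI[of _ 1])
  show "sym (proj_rel :: (('a \<times> 'a) \<times> ('a \<times> 'a)) set)"
  proof (rule symI, clarify)
    fix x1 x2 y1 y2 :: 'a
    assume "((x1, x2), (y1, y2)) \<in> proj_rel"
    then obtain c where "(x1, x2) \<noteq> (0, 0)" "(y1, y2) \<noteq> (0, 0)" "c \<noteq> 0" "y1 = c * x1" "y2 = c * x2"
      unfolding proj_rel_def by blast
    then show "((y1, y2), (x1, x2)) \<in> proj_rel"
      unfolding proj_rel_def
      by (auto intro!: exI[of _ "inverse c"])
  qed
  show "trans (proj_rel :: (('a \<times> 'a) \<times> ('a \<times> 'a)) set)"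
  proof (rule transI, clarify)
    fix x1 x2 y1 y2 z1 z2 :: 'a
    assume "((x1, x2), (y1, y2)) \<in> proj_rel" "((y1, y2), (z1, z2)) \<in> proj_rel"
    then obtain c c' where "(x1, x2) \<noteq> (0, 0)" "(z1, z2) \<noteq> (0, 0)" "c \<noteq> 0" "y1 = c * x1" "y2 = c * x2"
        "c' \<noteq> 0" "z1 = c' * y1" "z2 = c' * y2"
      unfolding proj_rel_def by blast
    then show "((x1, x2), (z1, z2)) \<in> proj_rel"
      unfolding proj_rel_def
      by (auto intro!: exI[of _ "c' * c"])
  qed
qed

definition proj_line :: "('a::field \<times> 'a) set set" where
  "proj_line = (- {(0, 0)}) // proj_rel"

text \<open>The equation is homogeneous of degree \<open>d\<close>, so that it holds for all representatives of
  a point as soon as it holds for one of them.\<close>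

definition Z_points :: "nat \<Rightarrow> 'a::field \<Rightarrow> ('a \<times> 'a) set set" where
  "Z_points d l = {P \<in> proj_line. \<forall>(x1, x2) \<in> P.
     x1 ^ d + x2 ^ d = of_nat d * l * x1 * x2 ^ (d - 1)}"

section \<open>Multiplicative characters\<close>

text \<open>Characters are represented by their extension by \<open>0\<close> to the whole field, including the
  trivial character.\<close>

definition mult_chars :: "('a::field \<Rightarrow> complex) set" where
  "mult_chars = {A. A 0 = 0 \<and> (\<forall>x. x \<noteq> 0 \<longrightarrow> A x \<noteq> 0) \<and>
     (\<forall>x y. x \<noteq> 0 \<longrightarrow> y \<noteq> 0 \<longrightarrow> A (x * y) = A x * A y)}"

definition triv_char :: "'a::field \<Rightarrow> complex" where
  "triv_char x = (if x = 0 then 0 else 1)"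

definition char_group :: "('a::field \<Rightarrow> complex) monoid" where
  "char_group = \<lparr>carrier = mult_chars, mult = (\<lambda>A B x. A x * B x), one = triv_char\<rparr>"

text \<open>Inverse characters, powers and orders are those of this group.\<close>

lemma inverse_mult_chars: "A \<in> mult_chars \<Longrightarrow> (\<lambda>x. inverse (A x)) \<in> mult_chars"
  by (auto simp: mult_chars_def)

lemma char_group_l_inv:
  "A \<in> mult_chars \<Longrightarrow> (\<lambda>x. inverse (A x)) \<otimes>\<^bsub>char_group\<^esub> A = \<one>\<^bsub>char_group\<^esub>"
  by (auto simp: mult_chars_def char_group_def triv_char_def fun_eq_iff)

lemma group_char_group: "group (char_group :: ('a::field \<Rightarrow> complex) monoid)"
proof (rule groupI)
  fix A :: "'a \<Rightarrow> complex"
  assume "A \<in> carrier char_group"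
  then have A: "A \<in> mult_chars"
    by (simp add: char_group_def)
  show "\<exists>B\<in>carrier char_group. B \<otimes>\<^bsub>char_group\<^esub> A = \<one>\<^bsub>char_group\<^esub>"
    using char_group_l_inv[OF A] inverse_mult_chars[OF A] by (auto simp: char_group_def)
qed (auto simp: char_group_def mult_chars_def triv_char_def fun_eq_iff mult.assoc)

lemma char_group_inv:
  fixes A :: "'a::field \<Rightarrow> complex"
  assumes "A \<in> mult_chars"
  shows "inv\<^bsub>char_group\<^esub> A = (\<lambda>x. inverse (A x))"
  using group.inv_equality[OF group_char_group, of "\<lambda>x. inverse (A x)" A] assms
    char_group_l_inv[OF assms] inverse_mult_chars[OF assms]
  by (simp add: char_group_def)

lemma char_group_pow:
  fixes A :: "'a::field \<Rightarrow> complex"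
  assumes "A \<in> mult_chars"
  shows "(A [^]\<^bsub>char_group\<^esub> (n::nat)) x = (if x = 0 then 0 else A x ^ n)"
proof (induction n)
  case 0
  then show ?case
    by (simp add: char_group_def triv_char_def)
next
  case (Suc n)
  have "A [^]\<^bsub>char_group\<^esub> Suc n = (\<lambda>x. (A [^]\<^bsub>char_group\<^esub> n) x * A x)"
    by (simp add: char_group_def)
  with Suc show ?case
    by (simp add: mult.commute)
qed

lemma finite_mult_chars: "finite (mult_chars :: ('a::finite_field \<Rightarrow> complex) set)"
proof -
  let ?n = "CARD('a) - 1"
  have n: "?n > 0"
    using card_mono[of UNIV "{0, 1 :: 'a}"] by auto
  have one: "A 1 = 1" if "A \<in> mult_chars" for A :: "'a \<Rightarrow> complex"
  proof -
    have "A (1 * 1) = A 1 * A 1"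
      using that unfolding mult_chars_def by (metis (mono_tags, lifting) mem_Collect_eq one_neq_zero)
    moreover have "A 1 \<noteq> 0"
      using that by (simp add: mult_chars_def)
    ultimately show ?thesis by simp
  qed
  have pow: "A (x ^ k) = A x ^ k" if "A \<in> mult_chars" "x \<noteq> 0" for A :: "'a \<Rightarrow> complex" and x k
  proof (induction k)
    case (Suc k)
    have "A (x * x ^ k) = A x * A (x ^ k)"
      using that by (simp add: mult_chars_def)
    with Suc show ?case by simp
  qed (use one that in simp)
  have fin: "finite (insert 0 {z :: complex. z ^ ?n = 1})"
    using finite_roots_unity[of ?n, where ?'a = complex] n by simp
  have val: "A x \<in> insert 0 {z. z ^ ?n = 1}" if A: "A \<in> mult_chars" for A :: "'a \<Rightarrow> complex" and x
  proof (cases "x = 0")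
    case True
    then show ?thesis using A by (simp add: mult_chars_def)
  next
    case False
    moreover have "x ^ CARD('a) = x"
      by (rule finite_field_power_card_eq_same)
    moreover have "x ^ CARD('a) = x * x ^ ?n"
      using n by (cases "CARD('a)") auto
    ultimately have "x ^ ?n = 1" by simp
    then show ?thesis
      using pow[OF A False, of ?n] one[OF A] by simp
  qed
  have "mult_chars \<subseteq> {A. \<forall>x :: 'a. (x \<in> UNIV \<longrightarrow> A x \<in> insert 0 {z. z ^ ?n = 1}) \<and>
      (x \<notin> UNIV \<longrightarrow> A x = 0)}"
    using val by blast
  then show ?thesis
    using finite_set_of_finite_funs[of "UNIV :: 'a set", OF _ fin, of 0] by (auto intro: finite_subset)
qed

definition quad_char :: "'a::field \<Rightarrow> complex" where
  "quad_char x = (if x = 0 then 0 else if \<exists>y. x = y ^ 2 then 1 else -1)"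

section \<open>Greene's hypergeometric series\<close>

definition char_binom :: "('a::finite_field \<Rightarrow> complex) \<Rightarrow> ('a \<Rightarrow> complex) \<Rightarrow> complex" where
  "char_binom A B = B (-1) / of_nat CARD('a) * (\<Sum>x\<in>UNIV. A x * (inv\<^bsub>char_group\<^esub> B) (1 - x))"

text \<open>The columns after \<open>A0\<close> are given by the lists \<open>As = [A\<^sub>1, \<dots>, A\<^sub>n]\<close> and \<open>Bs = [B\<^sub>1, \<dots>, B\<^sub>n]\<close>,
  which are meant to have the same length.\<close>

definition greene_F ::
  "('a::finite_field \<Rightarrow> complex) \<Rightarrow> ('a \<Rightarrow> complex) list \<Rightarrow> ('a \<Rightarrow> complex) list \<Rightarrow> 'a \<Rightarrow> complex" where
  "greene_F A0 As Bs x = of_nat CARD('a) / (of_nat CARD('a) - 1) *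
     (\<Sum>\<eta>\<in>mult_chars. char_binom (A0 \<otimes>\<^bsub>char_group\<^esub> \<eta>) \<eta> *
        prod_list (map2 (\<lambda>A B. char_binom (A \<otimes>\<^bsub>char_group\<^esub> \<eta>) (B \<otimes>\<^bsub>char_group\<^esub> \<eta>)) As Bs) * \<eta> x)"

end

theory Submission
  imports
    Defs
    "HOL-Algebra.Algebraic_Closure_Type"
    "HOL-Computational_Algebra.Formal_Power_Series"
begin

text \<open>
  Fix a nontrivial additive character \<open>\<theta>\<close>, put \<open>g(A) = \<Sum>x. A x * \<theta> x\<close> for a multiplicative
  character \<open>A\<close>, write \<open>q\<close> for the number of elements of the field and \<open>d = 2 * m + 1\<close>. Both sides
  of the theorem turn out to be the same sum of products of three Gauss sums.

  \<^item> The point count. The points are the solutions of \<open>x^d + 1 = d * l * x\<close>. Detecting this equation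
  with \<open>\<theta>\<close> involves three monomials whose values are subject to a single multiplicative relation,
  and orthogonality of the multiplicative characters gives (\<open>gauss_sum_point_count\<close>) for the
  number \<open>N\<close> of points
  \<open>(q - 1) * (q * N - (q - 1)) =
    \<Sum>\<eta>. \<eta>(-1) * \<eta>((d * l)^d)\<inverse> * g(\<eta>^d) * g(\<eta>\<inverse>) * g(\<eta>^(-2 * m))\<close>.

  \<^item> The hypergeometric side. Every binomial coefficient is a Jacobi sum, that is a quotient of
  Gauss sums (\<open>char_binom_gauss\<close>), and so is \<open>\<Sum>t. \<phi>(1 - t) * \<eta>(t)\<close>. For fixed \<open>\<eta>\<close>, the upper
  parameters supply \<open>g(\<chi>^i * \<eta>)\<close> for \<open>0 < i < d\<close>; the lower ones supply \<open>g(\<psi>^j * \<eta>\<inverse>)\<close> for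
  \<open>0 \<le> j < d - 1\<close>, \<open>j \<noteq> m\<close>, with \<open>j = 0\<close> occurring twice; and the sum over \<open>t\<close> contributes just
  the missing factors \<open>g(\<eta>)\<close> and \<open>g(\<psi>^m * \<eta>\<inverse>)\<close>, because \<open>\<psi>^m\<close> is the quadratic character \<open>\<phi>\<close>. The
  denominators are Gauss sums of quotients of powers of \<open>\<chi>\<close> and \<open>\<psi>\<close>, which the symmetric arrangement
  of the columns groups into pairs of conjugates, so that they multiply to a power of \<open>q\<close> up to a sign.
  The Hasse-Davenport product formula (\<open>hasse_davenport_product\<close>), applied to \<open>\<chi>\<close> and to \<open>\<psi>\<close>,
  then collapses the complete products to \<open>g(\<eta>^d)\<close> and \<open>g(\<eta>^(-2 * m))\<close>, and the remaining
  \<open>g(\<eta>\<inverse>)\<close> comes from the repeated \<open>j = 0\<close> (\<open>hypergeometric_term\<close>).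

  Most of the work is the product formula
  \<open>(\<Prod>i<d. g(\<chi>^i * A)) = (\<Prod>0<i<d. g(\<chi>^i)) * A(d)^(-d) * g(A^d)\<close>. It is obtained from two
  expressions for an L-function. Let \<open>\<sigma>\<close> be the Frobenius map of an algebraic closure. A
  \<open>\<sigma>\<close>-invariant finite multiset \<open>R\<close> is the multiset of roots of a monic polynomial over the field;
  give it the weight \<open>\<theta>(\<Sum>x\<in>R. x^k) * A(\<Prod>x\<in>R. x)\<close>, and let \<open>L\<close> be the generating function of
  these weights with respect to the size of \<open>R\<close>. Counting orbits shows that the logarithmic derivative
  of \<open>L\<close> is the series of the character sums over the extension fields (\<open>orbit_recurrence\<close>).
  For \<open>k = 1\<close>, \<open>L\<close> is the linear polynomial \<open>1 + g(A) * T\<close>. For \<open>k = d\<close> and the character \<open>A^d\<close>,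
  substituting \<open>x = y^d\<close> in each extension field shows that the logarithmic derivative is
  the sum of those for \<open>k = 1\<close> and the characters \<open>\<chi>^i * A\<close> (\<open>extension_sum_power\<close>). Hence this
  \<open>L\<close> is the product of the polynomials \<open>1 + g(\<chi>^i * A) * T\<close>, and its coefficient at \<open>T^d\<close> is
  the left side of the product formula. On the other hand, that coefficient is a sum over the
  monic polynomials of degree \<open>d\<close>; by Newton's identities the \<open>d\<close>-th power sum of the roots
  depends on the constant coefficient \<open>c\<close> only through the summand \<open>- d * c\<close>, so the sum over \<open>c\<close>
  splits off as \<open>A(d)^(-d) * g(A^d)\<close>, with a cofactor that does not involve \<open>A\<close> (\<open>L_coeff_top\<close>).
\<close>

hide_const (open) Divisibility.prime

section \<open>Invariant multisets of a dynamical system\<close>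

text \<open>
  The segment \<open>x, \<sigma> x, \<dots>, \<sigma>^(s - 1) x\<close> of an orbit, counted with multiplicity: if \<open>s\<close> is \<open>k\<close>
  times the period of \<open>x\<close>, then every point of the orbit occurs \<open>k\<close> times.
\<close>
definition orbit_mset :: "('b \<Rightarrow> 'b) \<Rightarrow> nat \<Rightarrow> 'b \<Rightarrow> 'b multiset" where
  "orbit_mset \<sigma> s x = image_mset (\<lambda>j. (\<sigma> ^^ j) x) (mset_set {..<s})"

definition invariant_msets :: "('b \<Rightarrow> 'b) \<Rightarrow> nat \<Rightarrow> 'b multiset set" where
  "invariant_msets \<sigma> n = {R. size R = n \<and> image_mset \<sigma> R = R}"

lemma size_orbit_mset [simp]: "size (orbit_mset \<sigma> s x) = s"
  by (simp add: orbit_mset_def)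

lemma orbit_mset_0 [simp]: "orbit_mset \<sigma> 0 x = {#}"
  by (simp add: orbit_mset_def)

lemma orbit_mset_Suc: "orbit_mset \<sigma> (Suc s) x = add_mset ((\<sigma> ^^ s) x) (orbit_mset \<sigma> s x)"
  by (simp add: orbit_mset_def lessThan_Suc)

lemma orbit_mset_add:
  "orbit_mset \<sigma> (s + t) x = orbit_mset \<sigma> s x + orbit_mset \<sigma> t ((\<sigma> ^^ s) x)"
proof (induction t)
  case (Suc t)
  have "(\<sigma> ^^ (s + t)) x = (\<sigma> ^^ t) ((\<sigma> ^^ s) x)"
    by (subst add.commute) (simp add: funpow_add)
  then show ?case
    by (simp add: orbit_mset_Suc Suc)
qed auto

lemma image_orbit_mset:
  assumes "(\<sigma> ^^ s) x = x"
  shows "image_mset \<sigma> (orbit_mset \<sigma> s x) = orbit_mset \<sigma> s x"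
proof -
  have "orbit_mset \<sigma> (s + 1) x = orbit_mset \<sigma> (1 + s) x"
    by simp
  then have "orbit_mset \<sigma> s x = orbit_mset \<sigma> s (\<sigma> x)"
    unfolding orbit_mset_add using assms by (simp add: orbit_mset_Suc)
  also have "\<dots> = image_mset \<sigma> (orbit_mset \<sigma> s x)"
    by (simp add: orbit_mset_def multiset.map_comp comp_def funpow_swap1)
  finally show ?thesis by simp
qed

lemma orbit_mset_mult_period:
  assumes "(\<sigma> ^^ r) x = x"
  shows "orbit_mset \<sigma> (k * r) x = repeat_mset k (orbit_mset \<sigma> r x)"
  by (induction k) (simp_all add: orbit_mset_add assms)

lemma funpow_dvd_period:
  assumes "(\<sigma> ^^ r) x = x" "r dvd s"
  shows "(\<sigma> ^^ s) x = x"
  using assms by (auto elim!: dvdE) (metis funpow_mod_eq funpow_0 mod_mult_self1_is_0)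

text \<open>
  Let \<open>x\<close> have multiplicity \<open>\<mu>\<close> in the invariant multiset \<open>R\<close>, and let \<open>r\<close> be its period. The
  multiplicity is constant along the orbit. An orbit segment that closes up has length \<open>k * r\<close> and
  runs \<open>k\<close> times through the orbit, so it fits into \<open>R\<close> exactly if \<open>k \<le> \<mu>\<close>.
\<close>
lemma card_closed_orbits_at:
  assumes inv: "image_mset \<sigma> R = R" and inj: "inj \<sigma>" and x: "x \<in># R"
  shows "card {s. 0 < s \<and> (\<sigma> ^^ s) x = x \<and> orbit_mset \<sigma> s x \<subseteq># R} = count R x"
proof -
  have inj_pow: "inj (\<sigma> ^^ j)" for j
    by (rule inj_fn[OF inj])
  have count_step: "count R (\<sigma> y) = count R y" for y
  proof -
    have "count (image_mset \<sigma> A) (\<sigma> y) = count A y" for A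
      by (induction A) (auto simp: inj_eq[OF inj])
    from this[of R] show ?thesis by (simp add: inv)
  qed
  have count_pow: "count R ((\<sigma> ^^ j) y) = count R y" for j y
    by (induction j) (auto simp: count_step)
  have "finite ((\<lambda>j. (\<sigma> ^^ j) x) ` UNIV)"
  proof (rule finite_subset)
    show "(\<lambda>j. (\<sigma> ^^ j) x) ` UNIV \<subseteq> set_mset R"
      using x count_pow by (auto simp: count_greater_zero_iff[symmetric] simp del: count_greater_zero_iff)
  qed simp
  then obtain i j where ij: "i < j" "(\<sigma> ^^ i) x = (\<sigma> ^^ j) x"
    by (metis (mono_tags, lifting) finite_imageD infinite_UNIV_nat injI linorder_neqE_nat)
  have "(\<sigma> ^^ i) ((\<sigma> ^^ (j - i)) x) = (\<sigma> ^^ i) x"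
    using ij by (metis add_diff_inverse_nat comp_apply funpow_add less_imp_not_less)
  then have ex: "\<exists>s. 0 < s \<and> (\<sigma> ^^ s) x = x"
    using ij(1) injD[OF inj_pow] by (intro exI[of _ "j - i"]) auto
  \<comment> \<open>The powers of \<open>\<sigma>\<close> map \<open>x\<close> into the finite set of elements of \<open>R\<close>, so \<open>x\<close> is periodic.\<close>
  define r where "r = (LEAST s. 0 < s \<and> (\<sigma> ^^ s) x = x)"
  have r: "0 < r" "(\<sigma> ^^ r) x = x"
    using LeastI_ex[OF ex] by (auto simp: r_def)
  have r_min: "r \<le> s" if "0 < s" "(\<sigma> ^^ s) x = x" for s
    unfolding r_def by (rule Least_le) (use that in auto)
  have period: "(\<sigma> ^^ s) x = x \<longleftrightarrow> r dvd s" for s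
  proof
    assume "(\<sigma> ^^ s) x = x"
    then have "(\<sigma> ^^ (s mod r)) x = x"
      by (simp add: funpow_mod_eq[OF r(2)])
    then show "r dvd s"
      using r_min[of "s mod r"] r(1) by (meson dvd_eq_mod_eq_0 gr0I leD mod_less_divisor)
  qed (rule funpow_dvd_period[OF r(2)])
  have "inj_on (\<lambda>j. (\<sigma> ^^ j) x) {..<r}"
  proof (rule linorder_inj_onI')
    fix i j assume ij: "i \<in> {..<r}" "j \<in> {..<r}" "i < j"
    show "(\<sigma> ^^ i) x \<noteq> (\<sigma> ^^ j) x"
    proof
      assume "(\<sigma> ^^ i) x = (\<sigma> ^^ j) x"
      then have "(\<sigma> ^^ i) ((\<sigma> ^^ (j - i)) x) = (\<sigma> ^^ i) x"
        using ij by (metis add_diff_inverse_nat comp_apply funpow_add less_imp_not_less)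
      then have "(\<sigma> ^^ (j - i)) x = x"
        by (rule injD[OF inj_pow])
      with r_min[of "j - i"] ij show False by auto
    qed
  qed
  then have orbit: "orbit_mset \<sigma> r x = mset_set ((\<lambda>j. (\<sigma> ^^ j) x) ` {..<r})"
    by (simp add: orbit_mset_def image_mset_mset_set)
  have fits: "orbit_mset \<sigma> (k * r) x \<subseteq># R \<longleftrightarrow> k \<le> count R x" for k
  proof -
    have x0: "x \<in> (\<lambda>j. (\<sigma> ^^ j) x) ` {..<r}"
      using r(1) by (intro image_eqI[of _ _ 0]) auto
    have "orbit_mset \<sigma> (k * r) x \<subseteq># R \<longleftrightarrow> (\<forall>y\<in>(\<lambda>j. (\<sigma> ^^ j) x) ` {..<r}. k \<le> count R y)"
      unfolding orbit_mset_mult_period[OF r(2)] orbit subseteq_mset_def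
      by (auto simp: count_mset_set')
    also have "\<dots> \<longleftrightarrow> k \<le> count R x"
      using x0 count_pow by auto
    finally show ?thesis .
  qed
  have "{s. 0 < s \<and> (\<sigma> ^^ s) x = x \<and> orbit_mset \<sigma> s x \<subseteq># R} = (\<lambda>k. k * r) ` {1..count R x}"
    using r(1) by (auto simp: period fits elim!: dvdE simp: mult.commute intro!: image_eqI)
  moreover have "inj_on (\<lambda>k. k * r) {1..count R x}"
    using r(1) by (auto simp: inj_on_def)
  ultimately show ?thesis
    by (simp add: card_image)
qed

text \<open>
  Summing the previous count over the points of \<open>R\<close> gives the sum of the multiplicities.
\<close>
lemma card_closed_orbits:
  assumes "R \<in> invariant_msets \<sigma> n" and inj: "inj \<sigma>"
  shows "(\<Sum>s\<in>{1..n}. card {x. (\<sigma> ^^ s) x = x \<and> orbit_mset \<sigma> s x \<subseteq># R}) = n"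
proof -
  from assms have R: "size R = n" "image_mset \<sigma> R = R"
    by (auto simp: invariant_msets_def)
  have mem: "x \<in># R" if "0 < s" "orbit_mset \<sigma> s x \<subseteq># R" for s x
  proof -
    have "x \<in># orbit_mset \<sigma> s x"
      using that(1) by (auto simp: orbit_mset_def intro!: image_eqI[of _ _ 0])
    then show ?thesis using that(2) by (rule mset_subset_eqD[rotated])
  qed
  have len: "s \<le> n" if "orbit_mset \<sigma> s x \<subseteq># R" for s x
    using size_mset_mono[OF that] R(1) by simp
  have "(\<Sum>s\<in>{1..n}. card {x. (\<sigma> ^^ s) x = x \<and> orbit_mset \<sigma> s x \<subseteq># R}) =
      (\<Sum>s\<in>{1..n}. card {x\<in>set_mset R. (\<sigma> ^^ s) x = x \<and> orbit_mset \<sigma> s x \<subseteq># R})"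
    by (intro sum.cong refl arg_cong[of _ _ card]) (auto dest: mem[rotated])
  also have "\<dots> = (\<Sum>x\<in>set_mset R. card {s\<in>{1..n}. (\<sigma> ^^ s) x = x \<and> orbit_mset \<sigma> s x \<subseteq># R})"
    by (rule sum_multicount_gen) auto
  also have "\<dots> = (\<Sum>x\<in>set_mset R. count R x)"
  proof (rule sum.cong[OF refl])
    fix x assume "x \<in># R"
    have "{s\<in>{1..n}. (\<sigma> ^^ s) x = x \<and> orbit_mset \<sigma> s x \<subseteq># R} =
        {s. 0 < s \<and> (\<sigma> ^^ s) x = x \<and> orbit_mset \<sigma> s x \<subseteq># R}"
      using len by auto
    then show "card {s\<in>{1..n}. (\<sigma> ^^ s) x = x \<and> orbit_mset \<sigma> s x \<subseteq># R} = count R x"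
      using card_closed_orbits_at[OF R(2) inj \<open>x \<in># R\<close>] by simp
  qed
  finally show ?thesis
    using R(1) by (simp add: size_multiset_overloaded_eq)
qed

text \<open>
  This is the identity \<open>T * L' = S * L\<close> between the generating function \<open>L\<close> of a multiplicative weight
  on invariant multisets and that of its sums \<open>S\<close> over periodic points. Removing a closed
  orbit segment from an invariant multiset leaves an invariant multiset; by \<open>card_closed_orbits\<close>
  each \<open>R\<close> of size \<open>n\<close> arises from \<open>n\<close> pairs of a segment and a remainder.
\<close>
lemma orbit_recurrence:
  fixes w :: "'b multiset \<Rightarrow> complex"
  assumes inj: "inj \<sigma>"
    and fin: "finite (invariant_msets \<sigma> n)" "\<And>s. 0 < s \<Longrightarrow> finite {x. (\<sigma> ^^ s) x = x}"
    and w: "\<And>P R. image_mset \<sigma> P = P \<Longrightarrow> image_mset \<sigma> R = R \<Longrightarrow> w (P + R) = w P * w R"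
  shows "of_nat n * (\<Sum>R\<in>invariant_msets \<sigma> n. w R) =
    (\<Sum>s\<in>{1..n}. (\<Sum>x | (\<sigma> ^^ s) x = x. w (orbit_mset \<sigma> s x)) *
       (\<Sum>R\<in>invariant_msets \<sigma> (n - s). w R))"
proof -
  let ?I = "invariant_msets \<sigma>"
  have "of_nat n * (\<Sum>R\<in>?I n. w R) = (\<Sum>R\<in>?I n. of_nat n * w R)"
    by (simp add: sum_distrib_left)
  also have "\<dots> = (\<Sum>R\<in>?I n. \<Sum>s\<in>{1..n}. \<Sum>x | (\<sigma> ^^ s) x = x \<and> orbit_mset \<sigma> s x \<subseteq># R. w R)"
    by (rule sum.cong[OF refl], subst card_closed_orbits[OF _ inj, symmetric])
      (simp_all add: sum_distrib_right)
  also have "\<dots> = (\<Sum>s\<in>{1..n}. \<Sum>R\<in>?I n. \<Sum>x | (\<sigma> ^^ s) x = x \<and> orbit_mset \<sigma> s x \<subseteq># R. w R)"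
    by (rule sum.swap)
  also have "\<dots> = (\<Sum>s\<in>{1..n}. (\<Sum>x | (\<sigma> ^^ s) x = x. w (orbit_mset \<sigma> s x)) * (\<Sum>R\<in>?I (n - s). w R))"
  proof (rule sum.cong[OF refl])
    fix s assume s: "s \<in> {1..n}"
    have finE: "finite {x. (\<sigma> ^^ s) x = x}"
      using fin(2) s by auto
    have "(\<Sum>R\<in>?I n. \<Sum>x | (\<sigma> ^^ s) x = x \<and> orbit_mset \<sigma> s x \<subseteq># R. w R) =
        (\<Sum>(R, x)\<in>(SIGMA R:?I n. {x. (\<sigma> ^^ s) x = x \<and> orbit_mset \<sigma> s x \<subseteq># R}). w R)"
      using fin(1) finE by (subst sum.Sigma) (auto intro: finite_subset[OF _ finE])
    also have "\<dots> = (\<Sum>(x, R)\<in>{x. (\<sigma> ^^ s) x = x} \<times> ?I (n - s). w (orbit_mset \<sigma> s x + R))"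
      using s by (intro sum.reindex_bij_witness[of _ "\<lambda>(x, R). (orbit_mset \<sigma> s x + R, x)"
            "\<lambda>(R, x). (x, R - orbit_mset \<sigma> s x)"])
        (auto simp: invariant_msets_def image_orbit_mset size_Diff_submset image_mset_Diff
          dest: size_mset_mono)
    also have "\<dots> = (\<Sum>(x, R)\<in>{x. (\<sigma> ^^ s) x = x} \<times> ?I (n - s). w (orbit_mset \<sigma> s x) * w R)"
      by (rule sum.cong) (auto simp: invariant_msets_def intro!: w image_orbit_mset)
    also have "\<dots> = (\<Sum>x | (\<sigma> ^^ s) x = x. w (orbit_mset \<sigma> s x)) * (\<Sum>R\<in>?I (n - s). w R)"
      by (simp add: sum_product sum.cartesian_product)
    finally show "(\<Sum>R\<in>?I n. \<Sum>x | (\<sigma> ^^ s) x = x \<and> orbit_mset \<sigma> s x \<subseteq># R. w R) =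
      (\<Sum>x | (\<sigma> ^^ s) x = x. w (orbit_mset \<sigma> s x)) * (\<Sum>R\<in>?I (n - s). w R)" .
  qed
  finally show ?thesis .
qed

section \<open>Newton's identities\<close>

definition poly_of_roots :: "'b::idom multiset \<Rightarrow> 'b poly" where
  "poly_of_roots R = (\<Prod>x\<in>#R. [:- x, 1:])"

definition power_sum :: "nat \<Rightarrow> 'b::comm_semiring_1 multiset \<Rightarrow> 'b" where
  "power_sum k R = (\<Sum>x\<in>#R. x ^ k)"

text \<open>
  The reciprocal polynomial of \<open>poly_of_roots\<close>; its logarithmic derivative generates the power sums.
\<close>
definition reversed_poly :: "'b::field multiset \<Rightarrow> 'b fps" where
  "reversed_poly R = (\<Prod>x\<in>#R. 1 - fps_const x * fps_X)"

text \<open>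
  The coefficient at \<open>0\<close> is \<open>0\<close> rather than the number of roots, so that the series is additive and equals
  minus \<open>T\<close> times the logarithmic derivative of \<open>reversed_poly\<close>.
\<close>
definition power_sum_series :: "'b::field multiset \<Rightarrow> 'b fps" where
  "power_sum_series R = Abs_fps (\<lambda>k. if k = 0 then 0 else power_sum k R)"

lemma poly_of_roots_empty [simp]: "poly_of_roots {#} = 1"
  and poly_of_roots_add [simp]: "poly_of_roots (add_mset x R) = [:- x, 1:] * poly_of_roots R"
  by (simp_all add: poly_of_roots_def)

lemma power_sum_empty [simp]: "power_sum k {#} = 0"
  and power_sum_add [simp]: "power_sum k (add_mset x R) = x ^ k + power_sum k R"
  and power_sum_union [simp]: "power_sum k (R + R') = power_sum k R + power_sum k R'"
  by (simp_all add: power_sum_def)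

lemma coeff_linear_mult:
  fixes x :: "'b::idom"
  shows "coeff ([:- x, 1:] * p) i = (if i = 0 then 0 else coeff p (i - 1)) - x * coeff p i"
  by (cases i) (simp_all add: coeff_pCons)

lemma monic_poly_of_roots:
  "degree (poly_of_roots R) = size R \<and> lead_coeff (poly_of_roots R) = 1"
proof (induction R)
  case (add x R)
  then have "poly_of_roots R \<noteq> 0" by auto
  with add have "degree (poly_of_roots (add_mset x R)) = size (add_mset x R)"
    by (simp add: degree_mult_eq del: mult_pCons_left)
  moreover have "lead_coeff (poly_of_roots (add_mset x R)) = 1"
    unfolding poly_of_roots_add lead_coeff_mult using add by auto
  ultimately show ?case by simp
qed simp

lemma degree_poly_of_roots [simp]: "degree (poly_of_roots R) = size R"
  and coeff_size_poly_of_roots [simp]: "coeff (poly_of_roots R) (size R) = 1"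
  using monic_poly_of_roots[of R] by auto

lemma poly_of_roots_nonzero [simp]: "poly_of_roots R \<noteq> 0"
  using coeff_size_poly_of_roots[of R] by (metis coeff_0 zero_neq_one)

lemma proots_poly_of_roots [simp]: "proots (poly_of_roots R) = R"
  by (induction R) (simp_all add: proots_mult del: mult_pCons_left)

lemma coeff_0_poly_of_roots: "coeff (poly_of_roots R) 0 = (- 1) ^ size R * prod_mset R"
  by (induction R) (simp_all add: coeff_linear_mult del: mult_pCons_left)

lemma monic_split:
  fixes f :: "'b::alg_closed_field poly"
  assumes "lead_coeff f = 1"
  shows "poly_of_roots (proots f) = f"
proof -
  from assms have "f \<noteq> 0" by auto
  from alg_closed_imp_factorization[OF this] obtain A where "f = poly_of_roots A"
    using assms by (auto simp: poly_of_roots_def)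
  then show ?thesis by simp
qed

lemma nth_reversed_poly:
  "fps_nth (reversed_poly R) k = (if k \<le> size R then coeff (poly_of_roots R) (size R - k) else 0)"
proof (induction R arbitrary: k)
  case empty
  then show ?case by (simp add: reversed_poly_def)
next
  case (add x R)
  have rec: "reversed_poly (add_mset x R) = reversed_poly R - fps_const x * (fps_X * reversed_poly R)"
    by (simp add: reversed_poly_def algebra_simps)
  have 1: "fps_nth (reversed_poly (add_mset x R)) k =
      fps_nth (reversed_poly R) k - x * (if k = 0 then 0 else fps_nth (reversed_poly R) (k - 1))"
    unfolding rec by simp
  have 2: "coeff (poly_of_roots R) (Suc (size R)) = 0"
    by (rule coeff_eq_0) simp
  show ?case
    unfolding 1 poly_of_roots_add coeff_linear_mult
    by (cases "k = 0"; cases "k = Suc (size R)")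
      (auto simp: add 2 Suc_diff_le not_le le_Suc_eq)
qed

lemma log_derivative_reversed_poly:
  "fps_X * fps_deriv (reversed_poly R) = - (reversed_poly R * power_sum_series R)"
proof (induction R)
  case empty
  have "power_sum_series {#} = 0"
    by (auto simp: power_sum_series_def fps_eq_iff)
  then show ?case by (simp add: reversed_poly_def)
next
  case (add x R)
  define G where "G = Abs_fps (\<lambda>k. if k = 0 then 0 else x ^ k)"
  have nth_G: "fps_nth G k = (if k = 0 then 0 else x ^ k)" for k
    by (simp add: G_def)
  have geo: "(1 - fps_const x * fps_X) * G = fps_const x * fps_X"
  proof (rule fps_ext)
    fix k
    have "(1 - fps_const x * fps_X) * G = G - fps_const x * (fps_X * G)"
      by (simp add: algebra_simps)
    then have "fps_nth ((1 - fps_const x * fps_X) * G) k =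
        fps_nth G k - x * (if k = 0 then 0 else fps_nth G (k - 1))"
      by simp
    also have "\<dots> = fps_nth (fps_const x * fps_X) k"
      by (cases k) (auto simp: nth_G)
    finally show "fps_nth ((1 - fps_const x * fps_X) * G) k = fps_nth (fps_const x * fps_X) k" .
  qed
  have ps: "power_sum_series (add_mset x R) = G + power_sum_series R"
    by (auto simp: power_sum_series_def fps_eq_iff nth_G)
  have rp: "reversed_poly (add_mset x R) = (1 - fps_const x * fps_X) * reversed_poly R"
    by (simp add: reversed_poly_def)
  have "fps_X * fps_deriv (reversed_poly (add_mset x R)) =
      (1 - fps_const x * fps_X) * (fps_X * fps_deriv (reversed_poly R)) -
      (fps_const x * fps_X) * reversed_poly R"
    unfolding rp by (simp add: algebra_simps)
  also have "\<dots> = - (reversed_poly (add_mset x R) * power_sum_series (add_mset x R))"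
  proof -
    have "u * - (E * P) - h * E = - (u * E * (G + P))" if "u * G = h" for u E P h :: "'a fps"
      unfolding that[symmetric] by (simp add: algebra_simps)
    from this[OF geo] show ?thesis
      unfolding add rp ps .
  qed
  finally show ?case .
qed

lemma newton_identity:
  assumes "n > 0"
  shows "power_sum n R = - of_nat n * fps_nth (reversed_poly R) n
    - (\<Sum>i\<in>{1..<n}. fps_nth (reversed_poly R) i * power_sum (n - i) R)"
proof -
  obtain m where m: "n = Suc m" using assms by (cases n) auto
  have e0: "fps_nth (reversed_poly R) 0 = 1"
    by (simp add: nth_reversed_poly)
  have "fps_nth (fps_X * fps_deriv (reversed_poly R)) n =
      - fps_nth (reversed_poly R * power_sum_series R) n"
    by (simp add: log_derivative_reversed_poly)
  then have "of_nat n * fps_nth (reversed_poly R) n =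
      - (\<Sum>i=0..n. fps_nth (reversed_poly R) i * fps_nth (power_sum_series R) (n - i))"
    using assms by (subst (asm) fps_mult_nth[of "reversed_poly R"]) (simp add: m)
  also have "(\<Sum>i=0..n. fps_nth (reversed_poly R) i * fps_nth (power_sum_series R) (n - i)) =
      (\<Sum>i\<in>insert 0 {1..<n}. fps_nth (reversed_poly R) i * fps_nth (power_sum_series R) (n - i))"
    by (rule sum.mono_neutral_right) (auto simp: power_sum_series_def)
  also have "\<dots> = power_sum n R + (\<Sum>i\<in>{1..<n}. fps_nth (reversed_poly R) i * power_sum (n - i) R)"
    using assms by (subst sum.insert) (auto simp: e0 power_sum_series_def intro!: sum.cong)
  finally have eq: "of_nat n * fps_nth (reversed_poly R) n = - (power_sum n R +
      (\<Sum>i\<in>{1..<n}. fps_nth (reversed_poly R) i * power_sum (n - i) R))" .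
  have "b = - a - c" if "a = - (b + c)" for a b c :: 'a
    using that by simp
  from this[OF eq] show ?thesis
    unfolding mult_minus_left .
qed

text \<open>
  By Newton's identities the power sums below \<open>n\<close> are determined by the coefficients below \<open>n\<close>, and
  the \<open>n\<close>-th one involves the \<open>n\<close>-th coefficient only in the summand with factor \<open>- n\<close>.
\<close>
lemma power_sum_top_coeff:
  assumes "n > 0"
    and "\<And>i. i < n \<Longrightarrow> fps_nth (reversed_poly R) i = fps_nth (reversed_poly R') i"
  shows "power_sum n R = power_sum n R' -
    of_nat n * (fps_nth (reversed_poly R) n - fps_nth (reversed_poly R') n)"
proof -
  have below: "power_sum k R = power_sum k R'" if "0 < k" "k < n" for k
    using that
  proof (induction k rule: less_induct)
    case (less k)
    have "(\<Sum>i\<in>{1..<k}. fps_nth (reversed_poly R) i * power_sum (k - i) R) =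
        (\<Sum>i\<in>{1..<k}. fps_nth (reversed_poly R') i * power_sum (k - i) R')"
      using less by (intro sum.cong) (auto simp: assms(2))
    then show ?case
      using less.prems assms(2) by (simp add: newton_identity[of k])
  qed
  have "(\<Sum>i\<in>{1..<n}. fps_nth (reversed_poly R) i * power_sum (n - i) R) =
      (\<Sum>i\<in>{1..<n}. fps_nth (reversed_poly R') i * power_sum (n - i) R')"
    by (intro sum.cong) (auto simp: assms(2) below)
  then show ?thesis
    unfolding newton_identity[OF assms(1), of R] newton_identity[OF assms(1), of R']
    by (simp add: right_diff_distrib)
qed

text \<open>
  The special case in which the \<open>n\<close>-th coefficient is the constant term: this is what splits off
  the Gauss sum in \<open>L_coeff_top\<close>.
\<close>
lemma power_sum_add_const:
  fixes f :: "'b::alg_closed_field poly"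
  assumes "lead_coeff f = 1" "degree f = n" "n > 0"
  shows "power_sum n (proots (f + [:c:])) = power_sum n (proots f) - of_nat n * c"
proof -
  have deg: "degree (f + [:c:]) = n"
    using assms by (subst degree_add_eq_left) auto
  have lead: "lead_coeff (f + [:c:]) = 1"
    unfolding deg using assms by (simp add: coeff_pCons split: nat.split)
  have split: "poly_of_roots (proots f) = f" "poly_of_roots (proots (f + [:c:])) = f + [:c:]"
    by (rule monic_split, fact)+
  have sizes: "size (proots f) = n" "size (proots (f + [:c:])) = n"
    using degree_poly_of_roots[of "proots f"] degree_poly_of_roots[of "proots (f + [:c:])"]
    unfolding split assms(2) deg by simp_all
  have nth: "fps_nth (reversed_poly (proots (f + [:c:]))) i =
      fps_nth (reversed_poly (proots f)) i + (if i = n then c else 0)" for i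
    unfolding nth_reversed_poly split sizes by (auto simp: coeff_pCons split: nat.split)
  show ?thesis
    using power_sum_top_coeff[OF assms(3), of "proots (f + [:c:])" "proots f"] by (simp add: nth)
qed

lemma power_sum_1_proots:
  fixes f :: "'b::alg_closed_field poly"
  assumes "lead_coeff f = 1" "degree f = n" "n > 0"
  shows "power_sum 1 (proots f) = - coeff f (n - 1)"
proof -
  have split: "poly_of_roots (proots f) = f"
    by (simp add: monic_split assms(1))
  have "size (proots f) = n"
    using degree_poly_of_roots[of "proots f"] unfolding split assms(2) by simp
  with assms(3) have "fps_nth (reversed_poly (proots f)) 1 = coeff f (n - 1)"
    by (simp add: nth_reversed_poly split)
  then show ?thesis
    using newton_identity[of 1 "proots f"] by simp
qed

section \<open>Multiplicative characters of a finite field\<close>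

lemma card_field_ge_2: "CARD('a::finite_field) \<ge> 2"
  using card_mono[of UNIV "{0, 1 :: 'a}"] by auto

lemma card_units: "card (UNIV - {0 :: 'a::finite_field}) = CARD('a) - 1"
  by (simp add: card_Diff_singleton)

lemma power_card_minus_1: 
  fixes x :: "'a::finite_field"
  assumes "x \<noteq> 0"
  shows "x ^ (CARD('a) - 1) = 1"
proof -
  have "x * x ^ (CARD('a) - 1) = x"
    using finite_field_power_card_eq_same[of x] card_field_ge_2[where ?'a = 'a]
    by (cases "CARD('a)") auto
  with assms show ?thesis by simp
qed

lemma of_nat_card_field: "of_nat CARD('a::finite_field) = (0 :: 'a)"
proof -
  have "(\<Sum>x\<in>UNIV. x :: 'a) = (\<Sum>x\<in>UNIV. x + 1)"
    by (rule sum.reindex_bij_witness[of _ "\<lambda>x. x + 1" "\<lambda>x. x - 1"]) auto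
  then show ?thesis by (simp add: sum.distrib)
qed

definition generates_units :: "'a::finite_field \<Rightarrow> bool" where
  "generates_units g \<longleftrightarrow> g \<noteq> 0 \<and> (\<forall>x. x \<noteq> 0 \<longrightarrow> (\<exists>k. x = g ^ k)) \<and>
     (\<forall>k. g ^ k = 1 \<longleftrightarrow> (CARD('a) - 1) dvd k)"

lemma ex_generates_units: "\<exists>g :: 'a::finite_field. generates_units g"
proof -
  let ?R = "ring_of_type_algebra :: 'a ring" and ?n = "CARD('a) - 1"
  interpret R: Ring.field ?R by (rule field_from_type_algebra)
  have pow: "x [^]\<^bsub>?R\<^esub> (k :: nat) = x ^ k" for x k
    by (induction k) (simp_all add: ring_of_type_algebra_def nat_pow_def mult.commute)
  obtain g where g: "g \<in> carrier (mult_of ?R)"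
      "carrier (mult_of ?R) = {g [^]\<^bsub>?R\<^esub> i | i::nat. i \<in> UNIV}"
    using R.finite_field_mult_group_has_gen by (auto simp: ring_of_type_algebra_def)
  have g0: "g \<noteq> 0"
    using g(1) by (simp add: ring_of_type_algebra_def)
  have gen: "\<exists>k. x = g ^ k" if "x \<noteq> 0" for x
  proof -
    have "x \<in> carrier (mult_of ?R)"
      using that by (simp add: ring_of_type_algebra_def)
    then show ?thesis using g(2) pow by auto
  qed
  have n: "?n > 0" using card_field_ge_2[where ?'a = 'a] by simp
  have reduce: "g ^ k = g ^ (k mod ?n)" for k
  proof -
    have "g ^ k = g ^ (?n * (k div ?n) + k mod ?n)" by simp
    then show ?thesis
      unfolding power_add power_mult power_card_minus_1[OF g0] by simp
  qed
  have img: "(\<lambda>k. g ^ k) ` {..<?n} = UNIV - {0}"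
  proof (intro equalityI subsetI)
    fix x :: 'a assume "x \<in> UNIV - {0}"
    then obtain k where "x = g ^ k" using gen by auto
    then have "x = g ^ (k mod ?n)" using reduce[of k] by simp
    then show "x \<in> (\<lambda>k. g ^ k) ` {..<?n}" using n by auto
  qed (use g0 in auto)
  then have inj: "inj_on (\<lambda>k. g ^ k) {..<?n}"
    by (intro eq_card_imp_inj_on) (simp_all add: card_units)
  have "g ^ k = 1 \<longleftrightarrow> ?n dvd k" for k
  proof
    assume "g ^ k = 1"
    then have "g ^ (k mod ?n) = g ^ 0" using reduce[of k] by simp
    then have "k mod ?n = 0" using inj_onD[OF inj, of "k mod ?n" 0] n by auto
    then show "?n dvd k" by auto
  next
    assume "?n dvd k"
    then show "g ^ k = 1" using reduce[of k] by auto
  qed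
  with gen g0 have "generates_units g" by (simp add: generates_units_def)
  then show ?thesis by blast
qed

lemma mult_char_0: "A \<in> mult_chars \<Longrightarrow> A 0 = 0"
  by (simp add: mult_chars_def)

lemma mult_char_nonzero: "A \<in> mult_chars \<Longrightarrow> x \<noteq> 0 \<Longrightarrow> A x \<noteq> 0"
  by (simp add: mult_chars_def)

lemma mult_char_mult: "A \<in> mult_chars \<Longrightarrow> A (x * y) = A x * A y"
  by (cases "x = 0"; cases "y = 0") (simp_all add: mult_chars_def)

lemma mult_char_1: "A \<in> mult_chars \<Longrightarrow> A 1 = 1"
  using mult_char_mult[of A 1 1] mult_char_nonzero[of A 1] by auto

lemma mult_char_power: "A \<in> mult_chars \<Longrightarrow> A (x ^ n) = A x ^ n"
  by (induction n) (simp_all add: mult_char_mult mult_char_1)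

lemma mult_char_inverse: "A \<in> mult_chars \<Longrightarrow> A (inverse x) = inverse (A x)"
proof (cases "x = 0")
  case False
  assume "A \<in> mult_chars"
  with False have "A x * A (inverse x) = 1"
    by (simp add: mult_char_1 flip: mult_char_mult)
  then show ?thesis by (simp add: inverse_unique)
qed (simp add: mult_char_0)

lemma triv_char_in_mult_chars: "triv_char \<in> mult_chars"
  by (auto simp: mult_chars_def triv_char_def)

lemma mult_chars_times: "A \<in> mult_chars \<Longrightarrow> B \<in> mult_chars \<Longrightarrow> (\<lambda>x. A x * B x) \<in> mult_chars"
  by (auto simp: mult_chars_def)

lemma mult_chars_power: "A \<in> mult_chars \<Longrightarrow> n > 0 \<Longrightarrow> (\<lambda>x. A x ^ n) \<in> mult_chars"
  by (auto simp: mult_chars_def power_mult_distrib)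

lemma mult_char_eq_triv_iff:
  assumes "A \<in> mult_chars" "generates_units g"
  shows "A = triv_char \<longleftrightarrow> A g = 1"
proof
  assume "A g = 1"
  then have "A x = 1" if "x \<noteq> 0" for x
    using that assms by (auto simp: generates_units_def mult_char_power)
  then show "A = triv_char"
    using assms(1) by (auto simp: triv_char_def mult_char_0)
qed (use assms in \<open>auto simp: triv_char_def generates_units_def\<close>)

lemma power_generator_eq_1_iff:
  assumes "\<chi> \<in> mult_chars" "generates_units g"
  shows "\<chi> g ^ n = 1 \<longleftrightarrow> group.ord char_group \<chi> dvd n"
proof -
  have "\<chi> [^]\<^bsub>char_group\<^esub> n \<in> mult_chars"
    using monoid.nat_pow_closed[OF group.is_monoid[OF group_char_group], of \<chi> n] assms(1)
    by (simp add: char_group_def)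
  then have "\<chi> [^]\<^bsub>char_group\<^esub> n = triv_char \<longleftrightarrow> \<chi> g ^ n = 1"
    using assms by (subst mult_char_eq_triv_iff) (auto simp: char_group_pow generates_units_def)
  moreover have "\<chi> [^]\<^bsub>char_group\<^esub> n = triv_char \<longleftrightarrow> group.ord char_group \<chi> dvd n"
    using group.pow_eq_id[OF group_char_group, of \<chi> n] assms(1) by (simp add: char_group_def)
  ultimately show ?thesis by simp
qed

lemma ord_dvd_card_minus_1:
  fixes \<chi> :: "'a::finite_field \<Rightarrow> complex"
  assumes "\<chi> \<in> mult_chars"
  shows "group.ord char_group \<chi> dvd CARD('a) - 1"
proof -
  obtain g :: 'a where g: "generates_units g" using ex_generates_units by blast
  then have "\<chi> g ^ (CARD('a) - 1) = 1"
    using assms by (simp add: generates_units_def power_card_minus_1 mult_char_1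
        flip: mult_char_power del: One_nat_def)
  then show ?thesis using power_generator_eq_1_iff[OF assms g] by simp
qed

text \<open>
  The order divides \<open>q - 1\<close>, which is \<open>- 1\<close> in the field.
\<close>
lemma of_nat_ord_nonzero:
  fixes \<chi> :: "'b::finite_field \<Rightarrow> complex"
  assumes "\<chi> \<in> mult_chars"
  shows "of_nat (group.ord char_group \<chi>) \<noteq> (0 :: 'b)"
proof
  assume 0: "of_nat (group.ord char_group \<chi>) = (0 :: 'b)"
  obtain k where "CARD('b) - 1 = group.ord char_group \<chi> * k"
    using ord_dvd_card_minus_1[OF assms] by blast
  then have "CARD('b) = group.ord char_group \<chi> * k + 1"
    using card_field_ge_2[where ?'a = 'b] by simp
  then have "of_nat CARD('b) = of_nat (group.ord char_group \<chi>) * of_nat k + (1 :: 'b)"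
    by simp
  then show False using of_nat_card_field[where ?'a = 'b] by (simp add: 0)
qed

lemma mult_char_power_ord:
  fixes \<chi> :: "'a::finite_field \<Rightarrow> complex"
  assumes "\<chi> \<in> mult_chars" "x \<noteq> 0"
  shows "\<chi> x ^ group.ord char_group \<chi> = 1"
proof -
  obtain g :: 'a where g: "generates_units g" using ex_generates_units by blast
  then obtain k where "x = g ^ k" using assms(2) by (auto simp: generates_units_def)
  then have "\<chi> x ^ group.ord char_group \<chi> = (\<chi> g ^ group.ord char_group \<chi>) ^ k"
    using assms(1) by (simp add: mult_char_power mult.commute flip: power_mult)
  moreover have "\<chi> g ^ group.ord char_group \<chi> = 1"
    using power_generator_eq_1_iff[OF assms(1) g] by simp
  ultimately show ?thesis by simp
qed

text \<open>
  The kernel of a character of order \<open>d\<close> consists of the \<open>d\<close>-th powers, as the group of units is cyclic.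
\<close>
lemma power_eq_1_if_char_eq_1:
  fixes x :: "'a::finite_field"
  assumes "\<chi> \<in> mult_chars" "x \<noteq> 0" "\<chi> x = 1" and d: "d = group.ord char_group \<chi>"
  shows "x ^ ((CARD('a) - 1) div d) = 1"
proof -
  obtain g :: 'a where g: "generates_units g" using ex_generates_units by blast
  then obtain k where k: "x = g ^ k" using assms(2) by (auto simp: generates_units_def)
  then have "d dvd k"
    using assms power_generator_eq_1_iff[OF assms(1) g, of k] by (simp add: mult_char_power)
  then obtain j where j: "k = d * j" by blast
  have "k * ((CARD('a) - 1) div d) = (CARD('a) - 1) * j"
    using ord_dvd_card_minus_1[OF assms(1)] by (auto simp: j d elim!: dvdE)
  then show ?thesis
    using g by (simp add: k generates_units_def flip: power_mult)
qed

lemma card_roots_of_unity_ge: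
  assumes "d dvd CARD('a::finite_field) - 1"
  shows "card {x :: 'a. x ^ d = 1} \<ge> d"
proof -
  obtain g :: 'a where g: "generates_units g" using ex_generates_units by blast
  obtain c where c: "CARD('a) - 1 = d * c" using assms by blast
  have pos: "d * c > 0" using card_field_ge_2[where ?'a = 'a] c by linarith
  have iff: "g ^ k = 1 \<longleftrightarrow> d * c dvd k" for k
    using g by (simp add: generates_units_def c del: One_nat_def)
  have "inj_on (\<lambda>k. g ^ (c * k)) {..<d}"
  proof (rule linorder_inj_onI')
    fix i j assume ij: "i \<in> {..<d}" "j \<in> {..<d}" "i < j"
    show "g ^ (c * i) \<noteq> g ^ (c * j)"
    proof
      assume "g ^ (c * i) = g ^ (c * j)"
      moreover have "g ^ (c * j) = g ^ (c * i) * g ^ (c * (j - i))"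
        using ij by (simp flip: power_add distrib_left)
      moreover have "g \<noteq> 0" using g by (simp add: generates_units_def)
      ultimately have "g ^ (c * (j - i)) = 1" by simp
      then have "d dvd (j - i)" using iff pos by (simp add: mult.commute)
      then show False using ij by (auto dest: dvd_imp_le)
    qed
  qed
  then have "d = card ((\<lambda>k. g ^ (c * k)) ` {..<d})"
    by (simp add: card_image)
  also have "\<dots> \<le> card {x :: 'a. x ^ d = 1}"
    by (rule card_mono) (auto simp: iff mult_ac simp flip: power_mult)
  finally show ?thesis .
qed

section \<open>The Frobenius map on the algebraic closure\<close>

definition frob :: "'a::finite_field alg_closure \<Rightarrow> 'a alg_closure" where
  "frob x = x ^ CARD('a)"

lemma frob_mult: "frob (x * y) = frob x * frob y"
  and frob_power: "frob (x ^ n) = frob x ^ n"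
  and frob_1 [simp]: "frob 1 = 1"
  by (simp_all add: frob_def power_mult_distrib mult.commute flip: power_mult)

lemma frob_0 [simp]: "frob (0 :: 'a::finite_field alg_closure) = 0"
  by (simp add: frob_def power_0_left)

lemma frob_to_ac [simp]: "frob (to_ac x) = to_ac x"
  by (simp add: frob_def finite_field_power_card_eq_same flip: to_ac_power)

lemma funpow_frob: "(frob ^^ s) (x :: 'a::finite_field alg_closure) = x ^ (CARD('a) ^ s)"
  by (induction s) (simp_all add: frob_def mult.commute flip: power_mult)

text \<open>
  A polynomial over the algebraic closure of degree less than \<open>q\<close> cannot vanish on all of the \<open>q\<close> elements
  of the base field.
\<close>
lemma poly_eq_0_if_rational_roots:
  fixes f :: "'a::finite_field alg_closure poly"
  assumes "degree f < CARD('a)" "\<And>x. poly f (to_ac x) = 0"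
  shows "f = 0"
proof (rule ccontr)
  assume "f \<noteq> 0"
  have "CARD('a) = card (range (to_ac :: 'a \<Rightarrow> _))"
    by (simp add: card_image inj_to_ac)
  also have "\<dots> \<le> card {x. poly f x = 0}"
    by (rule card_mono[OF poly_roots_finite[OF \<open>f \<noteq> 0\<close>]]) (use assms(2) in auto)
  also have "\<dots> \<le> degree f"
    by (rule card_poly_roots_bound[OF \<open>f \<noteq> 0\<close>])
  finally show False using assms(1) by simp
qed

text \<open>
  As polynomials in \<open>x\<close>, the two sides have the same leading term, so their difference has degree less
  than \<open>q\<close>. It therefore suffices to know the identity for \<open>x\<close> in the base field.
\<close>
lemma power_card_add_if_rational:
  fixes y :: "'a::finite_field alg_closure"
  assumes "\<And>a. (to_ac a + y) ^ CARD('a) = to_ac a + y ^ CARD('a)"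
  shows "(x + y) ^ CARD('a) = x ^ CARD('a) + y ^ CARD('a)"
proof -
  let ?q = "CARD('a)"
  define f where "f = [:y, 1:] ^ ?q - monom 1 ?q - [:y ^ ?q:]"
  have q: "?q > 0" by simp
  have deg: "degree ([:y, 1:] ^ ?q) = ?q"
    by (simp add: degree_power_eq)
  have "degree f \<le> ?q"
    unfolding f_def by (intro degree_diff_le) (simp_all add: deg degree_monom_le)
  moreover have "coeff ([:y, 1:] ^ ?q) ?q = 1"
    using lead_coeff_power[of "[:y, 1:]" ?q] by (simp add: deg)
  then have "coeff f ?q = 0"
    using q by (simp add: f_def coeff_pCons split: nat.split)
  ultimately have "degree f < ?q"
    using q by (metis coeff_0_degree_minus_1 degree_0 eq_zero_or_degree_less le_neq_implies_less)
  moreover have "poly f (to_ac a) = 0" for a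
    using assms[of a] finite_field_power_card_eq_same[of a]
    by (simp add: f_def poly_monom add.commute flip: to_ac_power)
  ultimately have "f = 0"
    by (rule poly_eq_0_if_rational_roots)
  then have "poly f x = 0" by simp
  then show ?thesis
    by (simp add: f_def poly_monom algebra_simps)
qed

text \<open>
  The \<open>q\<close>-th power map is the identity on the base field, hence additive there. The previous lemma
  frees one argument after the other from the base field.
\<close>
lemma frob_add: "frob (x + y) = frob x + frob y"
proof -
  have "(to_ac a + y) ^ CARD('a) = to_ac a + y ^ CARD('a)" for a :: 'a
  proof -
    have "(y + to_ac a) ^ CARD('a) = y ^ CARD('a) + to_ac a ^ CARD('a)"
      by (rule power_card_add_if_rational)
        (simp add: finite_field_power_card_eq_same flip: to_ac_add to_ac_power)
    then show ?thesis
      by (simp add: add.commute finite_field_power_card_eq_same flip: to_ac_power)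
  qed
  then show ?thesis
    unfolding frob_def by (rule power_card_add_if_rational)
qed

lemma frob_diff: "frob (x - y) = frob x - frob y"
  using frob_add[of "x - y" y] by simp

lemma inj_frob: "inj frob"
proof (rule injI)
  fix x y :: "'a alg_closure"
  assume "frob x = frob y"
  then have "frob (x - y) = 0" by (simp add: frob_diff)
  then show "x = y" by (simp add: frob_def)
qed

lemma finite_periodic_points:
  fixes s :: nat
  assumes "s > 0"
  shows "finite {x :: 'a::finite_field alg_closure. (frob ^^ s) x = x}"
proof -
  let ?f = "monom 1 (CARD('a) ^ s) - monom 1 1 :: 'a alg_closure poly"
  have "CARD('a) ^ s > 1"
    using assms card_field_ge_2[where ?'a = 'a] by (intro one_less_power) auto
  then have "coeff ?f 1 = - 1"
    using assms card_field_ge_2[where ?'a = 'a] by auto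
  then have "?f \<noteq> 0" by (metis coeff_0 neg_equal_0_iff_equal zero_neq_one)
  from poly_roots_finite[OF this] show ?thesis
    by (rule rev_finite_subset) (auto simp: funpow_frob poly_monom)
qed

text \<open>
  The polynomial \<open>X^q - X\<close> already has the \<open>q\<close> elements of the base field as roots.
\<close>
lemma frob_fixed_iff: "frob x = x \<longleftrightarrow> x \<in> range to_ac"
proof
  assume x: "frob x = x"
  show "x \<in> range to_ac"
  proof (rule ccontr)
    assume nr: "x \<notin> range to_ac"
    let ?f = "monom 1 CARD('a) - monom 1 1 :: 'a alg_closure poly"
    have q: "CARD('a) > 1" using card_field_ge_2[where ?'a = 'a] by simp
    then have "coeff ?f 1 = - 1" by simp
    then have nz: "?f \<noteq> 0" by (metis coeff_0 neg_equal_0_iff_equal zero_neq_one)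
    have "Suc CARD('a) = card (insert x (range to_ac))"
      using nr by (simp add: card_image inj_to_ac)
    also have "\<dots> \<le> card {x. poly ?f x = 0}"
      by (rule card_mono[OF poly_roots_finite[OF nz]])
        (use x frob_to_ac in \<open>auto simp: poly_monom frob_def\<close>)
    also have "\<dots> \<le> degree ?f"
      by (rule card_poly_roots_bound[OF nz])
    also have "\<dots> \<le> CARD('a)"
      using q by (intro degree_diff_le) (simp_all add: degree_monom_eq)
    finally show False by simp
  qed
qed auto

lemma of_ac_add: "x \<in> range to_ac \<Longrightarrow> y \<in> range to_ac \<Longrightarrow> of_ac (x + y) = of_ac x + of_ac y"
  and of_ac_mult: "x \<in> range to_ac \<Longrightarrow> y \<in> range to_ac \<Longrightarrow> of_ac (x * y) = of_ac x * of_ac y"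
  and of_ac_power: "x \<in> range to_ac \<Longrightarrow> of_ac (x ^ n) = of_ac x ^ n"
  by (auto intro!: of_ac_eqI)

lemma coeff_poly_of_roots_frob:
  "coeff (poly_of_roots (image_mset frob R)) i = frob (coeff (poly_of_roots R) i)"
  by (induction R arbitrary: i)
    (auto simp: coeff_linear_mult frob_diff frob_mult coeff_1 simp del: mult_pCons_left)

text \<open>
  Monic polynomials with coefficients in the base field, kept as polynomials over the closure so that
  they split.
\<close>
definition rational_monic :: "nat \<Rightarrow> 'a::finite_field alg_closure poly set" where
  "rational_monic n = {f. lead_coeff f = 1 \<and> degree f = n \<and> (\<forall>i. coeff f i \<in> range to_ac)}"

lemma poly_of_roots_rational:
  "R \<in> invariant_msets frob n \<Longrightarrow> poly_of_roots R \<in> rational_monic n"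
  using coeff_poly_of_roots_frob[of R]
  by (auto simp: rational_monic_def invariant_msets_def simp flip: frob_fixed_iff)

lemma proots_rational:
  assumes "f \<in> rational_monic n"
  shows "proots f \<in> invariant_msets frob n"
proof -
  have f: "poly_of_roots (proots f) = f"
    using assms by (intro monic_split) (auto simp: rational_monic_def)
  have "size (proots f) = n"
    using degree_poly_of_roots[of "proots f"] assms by (simp add: f rational_monic_def)
  moreover have "poly_of_roots (image_mset frob (proots f)) = poly_of_roots (proots f)"
  proof (rule poly_eqI)
    fix i
    have "frob (coeff f i) = coeff f i"
      using assms by (simp add: rational_monic_def frob_fixed_iff)
    then show "coeff (poly_of_roots (image_mset frob (proots f))) i = coeff (poly_of_roots (proots f)) i"
      by (simp add: coeff_poly_of_roots_frob f)
  qed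
  then have "image_mset frob (proots f) = proots f"
    by (metis proots_poly_of_roots)
  ultimately show ?thesis by (simp add: invariant_msets_def)
qed

text \<open>
  A monic polynomial over the closure has coefficients in the base field iff the Frobenius map permutes
  its roots, so invariant multisets and rational monic polynomials correspond via the roots.
\<close>
lemma sum_invariant_msets:
  fixes h :: "'a::finite_field alg_closure multiset \<Rightarrow> 'c::comm_monoid_add"
  shows "(\<Sum>R\<in>invariant_msets frob n. h R) = (\<Sum>f\<in>rational_monic n. h (proots f))"
proof (rule sum.reindex_bij_witness[of _ proots poly_of_roots])
  show "poly_of_roots (proots f) = f" if "f \<in> rational_monic n" for f :: "'a alg_closure poly"
    using that by (intro monic_split) (auto simp: rational_monic_def)
qed (simp_all add: proots_rational poly_of_roots_rational)

lemma finite_rational_monic: "finite (rational_monic n :: 'a::finite_field alg_closure poly set)"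
proof -
  have "rational_monic n \<subseteq> Poly ` {xs :: 'a alg_closure list. set xs \<subseteq> range to_ac \<and> length xs = Suc n}"
  proof
    fix f :: "'a alg_closure poly"
    assume f: "f \<in> rational_monic n"
    then have "f \<noteq> 0" by (auto simp: rational_monic_def)
    then have "length (coeffs f) = Suc n" "set (coeffs f) \<subseteq> range to_ac"
      using f by (auto simp: rational_monic_def length_coeffs_degree coeffs_def)
    then show "f \<in> Poly ` {xs. set xs \<subseteq> range to_ac \<and> length xs = Suc n}"
      by (intro image_eqI[of _ _ "coeffs f"]) auto
  qed
  then show ?thesis
    by (rule finite_subset) (intro finite_imageI finite_lists_length_eq, simp)
qed

lemma finite_invariant_msets: "finite (invariant_msets frob n)"
proof (rule finite_subset)
  show "invariant_msets frob n \<subseteq> proots ` rational_monic n"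
    using poly_of_roots_rational by (force intro!: image_eqI)
qed (simp add: finite_rational_monic)

lemma power_sum_rational:
  assumes "image_mset frob R = R"
  shows "power_sum k R \<in> range to_ac"
proof -
  have "frob (power_sum k A) = power_sum k (image_mset frob A)" for A
    by (induction A) (auto simp: frob_add frob_power)
  from this[of R] show ?thesis using assms by (simp flip: frob_fixed_iff)
qed

lemma prod_mset_rational:
  assumes "image_mset frob R = R"
  shows "prod_mset R \<in> range to_ac"
proof -
  have "frob (prod_mset A) = prod_mset (image_mset frob A)" for A
    by (induction A) (auto simp: frob_mult)
  from this[of R] show ?thesis using assms by (simp flip: frob_fixed_iff)
qed

lemma orbit_mset_frob_power:
  "orbit_mset frob s (y ^ d) = image_mset (\<lambda>z. z ^ d) (orbit_mset frob s y)"
proof -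
  have "(frob ^^ j) (y ^ d) = ((frob ^^ j) y) ^ d" for j
    by (induction j) (simp_all add: frob_power)
  then show ?thesis by (simp add: orbit_mset_def multiset.map_comp comp_def)
qed

lemma prod_orbit_mset_power:
  fixes y :: "'b::finite_field alg_closure"
  shows "prod_mset (orbit_mset frob s (y ^ d)) = prod_mset (orbit_mset frob s y) ^ d"
  unfolding orbit_mset_frob_power
proof -
  have "prod_mset (image_mset (\<lambda>z. z ^ d) R) = prod_mset R ^ d" for R :: "'b alg_closure multiset"
    by (induction R) (simp_all add: power_mult_distrib)
  then show "prod_mset (image_mset (\<lambda>z. z ^ d) (orbit_mset frob s y)) = prod_mset (orbit_mset frob s y) ^ d" .
qed

lemma power_sum_orbit_mset_power:
  "power_sum k (orbit_mset frob s (y ^ d)) = power_sum (d * k) (orbit_mset frob s y)"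
  by (simp add: orbit_mset_frob_power power_sum_def multiset.map_comp comp_def flip: power_mult)

text \<open>
  The product over the orbit segment is the norm \<open>N y = y^(1 + q + \<dots> + q^(s - 1))\<close>, and the exponent of
  \<open>N y^(q - 1)\<close> is the geometric sum \<open>q^s - 1\<close>.
\<close>
lemma power_frob_eq_norm_power:
  fixes y :: "'b::finite_field alg_closure"
  shows "(frob ^^ s) y = y * prod_mset (orbit_mset frob s y) ^ (CARD('b) - 1)"
proof (induction s)
  case (Suc s)
  have "(frob ^^ Suc s) y = (frob ^^ s) y * (frob ^^ s) y ^ (CARD('b) - 1)"
    using card_field_ge_2[where ?'a = 'b]
    by (simp add: frob_def[of "(frob ^^ s) y"] flip: power_Suc)
  also have "\<dots> = y * prod_mset (orbit_mset frob (Suc s) y) ^ (CARD('b) - 1)"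
    by (subst (1) Suc.IH) (simp add: orbit_mset_Suc power_mult_distrib mult_ac)
  finally show ?case .
qed simp

lemma card_power_eq:
  fixes x :: "'b::finite_field alg_closure"
  assumes "d > 0" "d dvd CARD('b) - 1" "x \<noteq> 0"
  shows "card {y. y ^ d = x} = d"
proof -
  obtain y0 where y0: "y0 ^ d = x" using nth_root_exists[OF assms(1)] by blast
  then have y0_nz: "y0 \<noteq> 0" using assms(1,3) by auto
  let ?f = "monom 1 d - [:1:] :: 'b alg_closure poly"
  have "coeff ?f d = 1" using assms(1) by (simp add: coeff_pCons split: nat.split)
  then have nz: "?f \<noteq> 0" by (metis coeff_0 zero_neq_one)
  have eq: "{z :: 'b alg_closure. z ^ d = 1} = {z. poly ?f z = 0}" by (auto simp: poly_monom)
  have "card {z :: 'b alg_closure. z ^ d = 1} \<le> degree ?f"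
    unfolding eq by (rule card_poly_roots_bound[OF nz])
  also have "\<dots> \<le> d" by (intro degree_diff_le) (simp_all add: degree_monom_le)
  finally have le: "card {z :: 'b alg_closure. z ^ d = 1} \<le> d" .
  have "d \<le> card (to_ac ` {z :: 'b. z ^ d = 1})"
    using card_roots_of_unity_ge[OF assms(2)] by (simp add: card_image inj_on_def)
  also have "\<dots> \<le> card {z :: 'b alg_closure. z ^ d = 1}"
    unfolding eq
    by (rule card_mono[OF poly_roots_finite[OF nz]]) (auto simp: poly_monom simp flip: to_ac_power)
  finally have "card {z :: 'b alg_closure. z ^ d = 1} = d" using le by simp
  moreover have "bij_betw (\<lambda>z. y0 * z) {z. z ^ d = 1} {y. y ^ d = x}"
    using y0 y0_nz assms(3)
    by (intro bij_betw_byWitness[of _ "\<lambda>y. y / y0"]) (auto simp: power_mult_distrib power_divide)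
  ultimately show ?thesis by (simp add: bij_betw_same_card)
qed

text \<open>
  Among the \<open>d\<close> roots \<open>y\<close> of \<open>y^d = x\<close> in the closure, either all or none lie in the extension field with
  \<open>q^s\<close> elements, according to whether \<open>\<chi>\<close> is trivial on the norm of \<open>x\<close>; the sum on the right
  is \<open>d\<close> in the first case and a vanishing geometric sum in the second.
\<close>
lemma card_power_fibre:
  fixes x :: "'b::finite_field alg_closure"
  assumes \<chi>: "\<chi> \<in> mult_chars" and d: "d = group.ord char_group \<chi>" "d > 0"
    and x: "x \<noteq> 0" "(frob ^^ s) x = x"
  shows "of_nat (card {y. (frob ^^ s) y = y \<and> y ^ d = x}) =
    (\<Sum>i<d. \<chi> (of_ac (prod_mset (orbit_mset frob s x))) ^ i)"
proof -
  have "prod_mset (orbit_mset frob s x) \<in> range to_ac"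
    by (intro prod_mset_rational image_orbit_mset x)
  then obtain a where a: "prod_mset (orbit_mset frob s x) = to_ac a" by auto
  have "0 \<notin># orbit_mset frob s x"
    using x(1) by (auto simp: orbit_mset_def funpow_frob)
  then have "to_ac a \<noteq> 0" by (simp flip: a)
  then have a0: "a \<noteq> 0" by simp
  have dvd: "d dvd CARD('b) - 1" unfolding d by (rule ord_dvd_card_minus_1[OF \<chi>])
  show ?thesis
  proof (cases "\<chi> a = 1")
    case True
    have "a ^ ((CARD('b) - 1) div d) = 1"
      by (rule power_eq_1_if_char_eq_1[OF \<chi> a0 True d(1)])
    then have a1: "to_ac a ^ ((CARD('b) - 1) div d) = 1" by (simp flip: to_ac_power)
    have "(frob ^^ s) y = y" if "y ^ d = x" for y
    proof -
      have "prod_mset (orbit_mset frob s y) ^ (d * ((CARD('b) - 1) div d)) = 1"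
        unfolding power_mult prod_orbit_mset_power[symmetric] that a by (rule a1)
      with dvd have "prod_mset (orbit_mset frob s y) ^ (CARD('b) - 1) = 1" by simp
      then show ?thesis using power_frob_eq_norm_power[of s y] by simp
    qed
    then have "{y. (frob ^^ s) y = y \<and> y ^ d = x} = {y. y ^ d = x}" by auto
    then show ?thesis
      using card_power_eq[OF d(2) dvd x(1)] True by (simp add: a)
  next
    case False
    have empty: "{y. (frob ^^ s) y = y \<and> y ^ d = x} = {}"
    proof safe
      fix y assume y: "(frob ^^ s) y = y" "x = y ^ d"
      then have "prod_mset (orbit_mset frob s y) \<in> range to_ac"
        by (intro prod_mset_rational image_orbit_mset)
      then obtain b where b: "prod_mset (orbit_mset frob s y) = to_ac b" by auto
      have "to_ac a = to_ac (b ^ d)"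
        using a prod_orbit_mset_power[of s y d] by (simp add: b y(2))
      then have ab: "a = b ^ d" by (simp only: to_ac_eq_iff)
      with a0 d(2) have "b \<noteq> 0" by auto
      then have "\<chi> a = 1"
        using mult_char_power_ord[OF \<chi>] by (simp add: ab mult_char_power[OF \<chi>] d(1))
      with False show "y \<in> {}" by simp
    qed
    have "(\<Sum>i<d. \<chi> a ^ i) = 0"
      using False mult_char_power_ord[OF \<chi> a0] by (simp add: sum_gp_strict d(1))
    then show ?thesis unfolding empty a by simp
  qed
qed

section \<open>Logarithmic derivatives of power series\<close>

lemma fps_log_derivative_prod:
  fixes P S :: "'i \<Rightarrow> 'b::field fps"
  assumes "finite I" "\<And>i. i \<in> I \<Longrightarrow> fps_X * fps_deriv (P i) = S i * P i"
  shows "fps_X * fps_deriv (\<Prod>i\<in>I. P i) = (\<Sum>i\<in>I. S i) * (\<Prod>i\<in>I. P i)"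
  using assms
proof (induction I)
  case (insert i I)
  have "fps_X * fps_deriv (\<Prod>i\<in>insert i I. P i) =
      (fps_X * fps_deriv (P i)) * (\<Prod>i\<in>I. P i) + P i * (fps_X * fps_deriv (\<Prod>i\<in>I. P i))"
    using insert.hyps by (simp add: algebra_simps)
  also have "\<dots> = (\<Sum>i\<in>insert i I. S i) * (\<Prod>i\<in>insert i I. P i)"
    using insert by (simp add: algebra_simps)
  finally show ?case .
qed simp

text \<open>
  The equation determines the coefficients recursively from the constant one, since \<open>n\<close> is invertible.
\<close>
lemma fps_log_derivative_unique:
  fixes U V S :: "'b::field_char_0 fps"
  assumes "fps_X * fps_deriv U = S * U" "fps_X * fps_deriv V = S * V"
    and "fps_nth S 0 = 0" "fps_nth U 0 = fps_nth V 0"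
  shows "U = V"
proof (rule fps_ext)
  fix n
  show "fps_nth U n = fps_nth V n"
  proof (induction n rule: less_induct)
    case (less n)
    have rec: "of_nat n * fps_nth W n = (\<Sum>i=0..n. fps_nth S i * fps_nth W (n - i))"
      if "fps_X * fps_deriv W = S * W" for W
    proof -
      have "fps_nth (fps_X * fps_deriv W) n = of_nat n * fps_nth W n"
        by (cases n) simp_all
      then show ?thesis by (simp add: that fps_mult_nth)
    qed
    show ?case
    proof (cases "n = 0")
      case False
      have "(\<Sum>i=0..n. fps_nth S i * fps_nth U (n - i)) = (\<Sum>i=0..n. fps_nth S i * fps_nth V (n - i))"
      proof (rule sum.cong[OF refl])
        fix i assume "i \<in> {0..n}"
        then show "fps_nth S i * fps_nth U (n - i) = fps_nth S i * fps_nth V (n - i)"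
          using less[of "n - i"] assms(3) False by (cases "i = 0") auto
      qed
      then have "of_nat n * fps_nth U n = of_nat n * fps_nth V n"
        by (simp add: rec assms(1,2))
      with False show ?thesis by simp
    qed (simp add: assms(4))
  qed
qed

lemma fps_nth_0_prod: "fps_nth (\<Prod>i\<in>I. P i) 0 = (\<Prod>i\<in>I. fps_nth (P i :: 'b::comm_ring_1 fps) 0)"
  by (induction I rule: infinite_finite_induct) simp_all

lemma fps_nth_prod_linear:
  "fps_nth (\<Prod>i<n. 1 + fps_const (g i) * fps_X) n = (\<Prod>i<n. g i :: 'b::field)"
proof -
  let ?R = "image_mset (\<lambda>i. - g i) (mset_set {..<n})"
  have "(\<Prod>i<n. 1 + fps_const (g i) * fps_X) = reversed_poly ?R"
    by (simp add: reversed_poly_def multiset.map_comp comp_def prod_unfold_prod_mset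
        flip: fps_const_neg)
  then have "fps_nth (\<Prod>i<n. 1 + fps_const (g i) * fps_X) n = (- 1) ^ n * (\<Prod>i<n. - g i)"
    by (simp add: nth_reversed_poly coeff_0_poly_of_roots prod_unfold_prod_mset)
  also have "\<dots> = (\<Prod>i<n. (- 1) * - g i)"
    by (simp only: prod.distrib prod_constant card_lessThan)
  finally show ?thesis by simp
qed

section \<open>L-functions of multiplicative characters\<close>

definition gauss_sum :: "('a::finite_field \<Rightarrow> complex) \<Rightarrow> ('a \<Rightarrow> complex) \<Rightarrow> complex" where
  "gauss_sum \<theta> A = (\<Sum>x\<in>UNIV. A x * \<theta> x)"

text \<open>
  For an invariant multiset both arguments lie in the base field, so that the default value of \<open>of_ac\<close>
  is never used.
\<close>
definition char_weight ::
  "('a::finite_field \<Rightarrow> complex) \<Rightarrow> ('a \<Rightarrow> complex) \<Rightarrow> nat \<Rightarrow> 'a alg_closure multiset \<Rightarrow> complex" where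
  "char_weight \<theta> A k R = \<theta> (of_ac (power_sum k R)) * A (of_ac (prod_mset R))"

text \<open>
  The coefficient at \<open>T^n\<close> of the L-function of the character \<open>A\<close> twisted by \<open>\<theta>(x^k)\<close>.
\<close>
definition L_coeff ::
  "('a::finite_field \<Rightarrow> complex) \<Rightarrow> ('a \<Rightarrow> complex) \<Rightarrow> nat \<Rightarrow> nat \<Rightarrow> complex" where
  "L_coeff \<theta> A k n = (\<Sum>R\<in>invariant_msets frob n. char_weight \<theta> A k R)"

text \<open>
  The character sum \<open>\<Sum>x. \<theta>(Tr (x^k)) * A(N x)\<close> over the extension field with \<open>q^s\<close> elements; trace and norm
  appear as sum and product over the orbit segment of length \<open>s\<close>.
\<close>
definition extension_sum ::
  "('a::finite_field \<Rightarrow> complex) \<Rightarrow> ('a \<Rightarrow> complex) \<Rightarrow> nat \<Rightarrow> nat \<Rightarrow> complex" where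
  "extension_sum \<theta> A k s = (\<Sum>x | (frob ^^ s) x = x. char_weight \<theta> A k (orbit_mset frob s x))"

locale add_char =
  fixes \<theta> :: "'a::finite_field \<Rightarrow> complex"
  assumes theta_add: "\<theta> (x + y) = \<theta> x * \<theta> y"
    and theta_0: "\<theta> 0 = 1"
    and theta_nontrivial: "\<exists>x. \<theta> x \<noteq> 1"
begin

lemma sum_theta: "(\<Sum>x\<in>UNIV. \<theta> x) = 0"
proof -
  obtain c where c: "\<theta> c \<noteq> 1" using theta_nontrivial by blast
  have "(\<Sum>x\<in>UNIV. \<theta> x) = (\<Sum>x\<in>UNIV. \<theta> (c + x))"
    by (rule sum.reindex_bij_witness[of _ "\<lambda>x. c + x" "\<lambda>x. x - c"]) auto
  also have "\<dots> = \<theta> c * (\<Sum>x\<in>UNIV. \<theta> x)"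
    by (simp add: theta_add sum_distrib_left)
  finally show ?thesis using c by simp
qed

lemma sum_theta_mult: "(\<Sum>x\<in>UNIV. \<theta> (x * y)) = (if y = 0 then of_nat CARD('a) else 0)"
proof (cases "y = 0")
  case False
  then have "(\<Sum>x\<in>UNIV. \<theta> (x * y)) = (\<Sum>x\<in>UNIV. \<theta> x)"
    by (intro sum.reindex_bij_witness[of _ "\<lambda>x. x / y" "\<lambda>x. x * y"]) auto
  with False show ?thesis by (simp add: sum_theta)
qed (simp add: theta_0)

lemma char_weight_union:
  assumes "A \<in> mult_chars" "image_mset frob P = P" "image_mset frob R = R"
  shows "char_weight \<theta> A k (P + R) = char_weight \<theta> A k P * char_weight \<theta> A k R"
  using assms
  by (simp add: char_weight_def of_ac_add of_ac_mult power_sum_rational prod_mset_rational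
      theta_add mult_char_mult)

lemma L_coeff_recurrence:
  assumes "A \<in> mult_chars"
  shows "of_nat n * L_coeff \<theta> A k n =
    (\<Sum>s\<in>{1..n}. extension_sum \<theta> A k s * L_coeff \<theta> A k (n - s))"
  unfolding L_coeff_def extension_sum_def
  by (rule orbit_recurrence)
    (simp_all add: inj_frob finite_invariant_msets finite_periodic_points char_weight_union assms)

lemma L_coeff_0:
  assumes "A \<in> mult_chars"
  shows "L_coeff \<theta> A k 0 = 1"
proof -
  have "invariant_msets frob 0 = {{#} :: 'a alg_closure multiset}"
    by (auto simp: invariant_msets_def)
  then show ?thesis
    using assms by (simp add: L_coeff_def char_weight_def theta_0 mult_char_1)
qed

lemma L_coeff_1:
  assumes "A \<in> mult_chars"
  shows "L_coeff \<theta> A 1 1 = gauss_sum \<theta> A"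
  unfolding L_coeff_def gauss_sum_def
proof (rule sum.reindex_bij_witness[of _ "\<lambda>x. {#to_ac x#}" "\<lambda>R. of_ac (sum_mset R)"])
  fix R :: "'a alg_closure multiset"
  assume "R \<in> invariant_msets frob 1"
  then obtain x where R: "R = {#x#}" "frob x = x"
    using size_1_singleton_mset[of R] by (auto simp: invariant_msets_def)
  then have "x \<in> range to_ac" by (simp add: frob_fixed_iff)
  with R(1) show "{#to_ac (of_ac (sum_mset R))#} = R"
    and "A (of_ac (sum_mset R)) * \<theta> (of_ac (sum_mset R)) = char_weight \<theta> A 1 R"
    by (auto simp: char_weight_def)
qed (auto simp: invariant_msets_def)

lemma char_weight_1_proots:
  fixes f :: "'a alg_closure poly"
  assumes "f \<in> rational_monic n" "n > 0"
  shows "char_weight \<theta> A 1 (proots f) =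
    \<theta> (of_ac (- coeff f (n - 1))) * A (of_ac ((- 1) ^ n * coeff f 0))"
proof -
  have f: "lead_coeff f = 1" "degree f = n" using assms(1) by (auto simp: rational_monic_def)
  have split: "poly_of_roots (proots f) = f" using f(1) by (rule monic_split)
  then have "size (proots f) = n"
    using degree_poly_of_roots[of "proots f"] f(2) by simp
  then have "coeff f 0 = (- 1) ^ n * prod_mset (proots f)"
    using coeff_0_poly_of_roots[of "proots f"] by (simp add: split)
  then have "prod_mset (proots f) = (- 1) ^ n * coeff f 0"
    by (simp flip: mult.assoc power_add)
  then show ?thesis
    by (simp only: char_weight_def power_sum_1_proots[OF f assms(2)])
qed

text \<open>
  For \<open>n \<ge> 2\<close> the coefficient at \<open>X^(n - 1)\<close>, which is minus the sum of the roots, can be shifted without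
  changing the constant term. The shift multiplies the coefficient by a value of \<open>\<theta>\<close> other than \<open>1\<close>.
\<close>
lemma L_coeff_ge_2:
  assumes "A \<in> mult_chars" "n \<ge> 2"
  shows "L_coeff \<theta> A 1 n = 0"
proof -
  obtain c where c: "\<theta> c \<noteq> 1" using theta_nontrivial by blast
  define T where "T b f = f + monom (to_ac b) (n - 1)" for b :: 'a and f
  have T: "T b f \<in> rational_monic n" if "f \<in> rational_monic n" for b f
  proof -
    have f: "lead_coeff f = 1" "degree f = n" "coeff f i \<in> range to_ac" for i
      using that by (auto simp: rational_monic_def)
    have deg: "degree (T b f) = n"
      unfolding T_def using f(2) assms(2)
      by (subst degree_add_eq_left) (auto intro: le_less_trans[OF degree_monom_le])
    have "coeff (T b f) i \<in> range to_ac" for i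
      using f(3)[of i] by (auto simp: T_def simp flip: to_ac_add)
    moreover have "lead_coeff (T b f) = 1"
      unfolding deg using f(1,2) assms(2) by (simp add: T_def)
    ultimately show ?thesis using deg by (simp add: rational_monic_def)
  qed
  \<comment> \<open>As minus the coefficient is the sum of the roots, \<open>T (- c)\<close> adds \<open>c\<close> to that sum.\<close>
  have w: "char_weight \<theta> A 1 (proots (T (- c) f)) = \<theta> c * char_weight \<theta> A 1 (proots f)"
    if f: "f \<in> rational_monic n" for f
  proof -
    have "coeff f (n - 1) \<in> range to_ac" using f by (simp add: rational_monic_def)
    then obtain a where a: "coeff f (n - 1) = to_ac a" by auto
    have "- coeff (T (- c) f) (n - 1) = to_ac (c + - a)" "- coeff f (n - 1) = to_ac (- a)"
      using a by (simp_all add: T_def)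
    then have shifted: "of_ac (- coeff (T (- c) f) (n - 1)) = c + of_ac (- coeff f (n - 1))"
      by (simp only: of_ac_to_ac)
    have const: "coeff (T (- c) f) 0 = coeff f 0"
      using assms(2) by (simp add: T_def)
    have n: "n > 0" using assms(2) by simp
    show ?thesis
      unfolding char_weight_1_proots[OF f n] char_weight_1_proots[OF T[OF f] n] shifted const
        theta_add mult.assoc ..
  qed
  have "L_coeff \<theta> A 1 n = (\<Sum>f\<in>rational_monic n. char_weight \<theta> A 1 (proots f))"
    unfolding L_coeff_def by (rule sum_invariant_msets)
  also have "\<dots> = (\<Sum>f\<in>rational_monic n. char_weight \<theta> A 1 (proots (T (- c) f)))"
    by (rule sum.reindex_bij_witness[of _ "T (- c)" "T c"])
      (auto simp: T, auto simp: T_def add.assoc simp: add_monom)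
  also have "\<dots> = \<theta> c * L_coeff \<theta> A 1 n"
    unfolding L_coeff_def sum_invariant_msets sum_distrib_left by (intro sum.cong refl w)
  finally show ?thesis using c by simp
qed

text \<open>
  Split a monic polynomial of degree \<open>n\<close> into its constant term \<open>c\<close> and the rest \<open>f\<close>. The \<open>n\<close>-th power sum of
  the roots is that of \<open>f\<close> minus \<open>n * c\<close>, and the product of the roots depends on \<open>c\<close> only, so the sum over \<open>c\<close>
  is a Gauss sum and the sum over \<open>f\<close> is the constant \<open>C\<close>. It is essential that \<open>C\<close> is the same for all \<open>A\<close>.
\<close>
lemma L_coeff_top:
  assumes n_pos: "n > 0" and n: "of_nat n \<noteq> (0 :: 'a)"
  obtains C where "\<And>A. A \<in> mult_chars \<Longrightarrow>
    L_coeff \<theta> (\<lambda>x. A x ^ n) n n = C * A (inverse (of_nat n)) ^ n * gauss_sum \<theta> (\<lambda>x. A x ^ n)"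
proof -
  let ?M = "{f \<in> rational_monic n. coeff f 0 = (0 :: 'a alg_closure)}"
  let ?C = "\<Sum>f\<in>?M. \<theta> (of_ac (power_sum n (proots f)))"
  have "L_coeff \<theta> (\<lambda>x. A x ^ n) n n = ?C * A (inverse (of_nat n)) ^ n * gauss_sum \<theta> (\<lambda>x. A x ^ n)"
    if A: "A \<in> mult_chars" for A
  proof -
    let ?B = "\<lambda>x. A x ^ n"
    have B: "?B \<in> mult_chars" using mult_chars_power[OF A n_pos] .
    have shift: "f + [:to_ac c:] \<in> rational_monic n" if "f \<in> rational_monic n" for f c
    proof -
      have f: "lead_coeff f = 1" "degree f = n" "coeff f i \<in> range to_ac" for i
        using that by (auto simp: rational_monic_def)
      have deg: "degree (f + [:to_ac c:]) = n"
        using f(2) n_pos by (subst degree_add_eq_left) auto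
      have "coeff (f + [:to_ac c:]) i \<in> range to_ac" for i
        using f(3)[of i] by (auto simp: coeff_pCons split: nat.split simp flip: to_ac_add)
      moreover have "lead_coeff (f + [:to_ac c:]) = 1"
        unfolding deg using f(1,2) n_pos by (simp add: coeff_pCons split: nat.split)
      ultimately show ?thesis using deg by (simp add: rational_monic_def)
    qed
    have w: "char_weight \<theta> ?B n (proots (f + [:to_ac c:])) =
        \<theta> (of_ac (power_sum n (proots f))) * (\<theta> (- (of_nat n * c)) * ?B (- c))"
      if f: "f \<in> ?M" for f c
    proof -
      let ?g = "f + [:to_ac c:]"
      have g: "?g \<in> rational_monic n" using f shift by blast
      then have gg: "lead_coeff ?g = 1" "degree ?g = n" by (auto simp: rational_monic_def)
      have split: "poly_of_roots (proots ?g) = ?g" using gg(1) by (rule monic_split)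
      then have "size (proots ?g) = n"
        using degree_poly_of_roots[of "proots ?g"] gg(2) by simp
      then have "coeff ?g 0 = (- 1) ^ n * prod_mset (proots ?g)"
        using coeff_0_poly_of_roots[of "proots ?g"] by (simp add: split)
      then have "prod_mset (proots ?g) = (- 1) ^ n * coeff ?g 0"
        by (simp add: mult.assoc[symmetric] flip: power_add del: coeff_add)
      then have "prod_mset (proots ?g) = (- 1) ^ n * to_ac c"
        using f by simp
      then have e: "of_ac (prod_mset (proots ?g)) = (- 1) ^ n * c"
        by (intro of_ac_eqI) simp
      have "A ((- 1) ^ n * c) ^ n = A (((- 1) ^ n) ^ n * c ^ n)"
        by (simp add: mult_char_power[OF A, symmetric] power_mult_distrib)
      \<comment> \<open>The sign from the product of the roots is absorbed, since \<open>n\<^sup>2\<close> has the parity of \<open>n\<close>.\<close>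
      also have "((- 1) ^ n) ^ n = ((- 1) ^ n :: 'a)"
        by (cases "even n") simp_all
      also have "A ((- 1) ^ n * c ^ n) = A (- c) ^ n"
        by (simp add: mult_char_power[OF A, symmetric] flip: power_mult_distrib)
      finally have e': "?B (of_ac (prod_mset (proots ?g))) = ?B (- c)"
        by (simp add: e)
      have "lead_coeff f = 1" "degree f = n" using f by (auto simp: rational_monic_def)
      then have "power_sum n (proots ?g) = power_sum n (proots f) + to_ac (- (of_nat n * c))"
        using n_pos by (simp add: power_sum_add_const)
      moreover have "power_sum n (proots f) \<in> range to_ac"
        using f proots_rational[of f n] by (intro power_sum_rational) (simp add: invariant_msets_def)
      ultimately have "of_ac (power_sum n (proots ?g)) =
          of_ac (power_sum n (proots f)) + - (of_nat n * c)"
        by (simp add: of_ac_add del: to_ac_minus)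
      then show ?thesis
        by (simp only: char_weight_def e' theta_add mult.assoc)
    qed
    have "L_coeff \<theta> ?B n n = (\<Sum>f\<in>rational_monic n. char_weight \<theta> ?B n (proots f))"
      unfolding L_coeff_def by (rule sum_invariant_msets)
    also have "\<dots> = (\<Sum>(f, c)\<in>?M \<times> UNIV. char_weight \<theta> ?B n (proots (f + [:to_ac c:])))"
    proof (rule sum.reindex_bij_witness[of _ "\<lambda>(f, c). f + [:to_ac c:]"
          "\<lambda>f. (f + [:to_ac (- of_ac (coeff f 0)):], of_ac (coeff f 0))"])
      fix f :: "'a alg_closure poly"
      assume f: "f \<in> rational_monic n"
      then have "coeff f 0 \<in> range to_ac" by (simp add: rational_monic_def)
      then obtain a where a: "coeff f 0 = to_ac a" by auto
      show "(case (f + [:to_ac (- of_ac (coeff f 0)):], of_ac (coeff f 0)) of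
          (f, c) \<Rightarrow> f + [:to_ac c:]) = f"
        by (simp add: a)
      then show "(case (f + [:to_ac (- of_ac (coeff f 0)):], of_ac (coeff f 0)) of
          (f, c) \<Rightarrow> char_weight \<theta> ?B n (proots (f + [:to_ac c:]))) = char_weight \<theta> ?B n (proots f)"
        by (simp add: a add.assoc)
      show "(f + [:to_ac (- of_ac (coeff f 0)):], of_ac (coeff f 0)) \<in> ?M \<times> UNIV"
        using shift[OF f, of "- of_ac (coeff f 0)"] by (simp add: a)
    next
      fix fc :: "'a alg_closure poly \<times> 'a"
      assume "fc \<in> ?M \<times> UNIV"
      then obtain f c where fc: "fc = (f, c)" "f \<in> ?M" by auto
      show "(case fc of (f, c) \<Rightarrow> f + [:to_ac c:]) \<in> rational_monic n"
        using fc shift by auto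
      show "((case fc of (f, c) \<Rightarrow> f + [:to_ac c:]) +
            [:to_ac (- of_ac (coeff (case fc of (f, c) \<Rightarrow> f + [:to_ac c:]) 0)):],
            of_ac (coeff (case fc of (f, c) \<Rightarrow> f + [:to_ac c:]) 0)) = fc"
        using fc by simp
    qed
    also have "\<dots> = (\<Sum>(f, c)\<in>?M \<times> UNIV. \<theta> (of_ac (power_sum n (proots f))) *
        (\<theta> (- (of_nat n * c)) * ?B (- c)))"
      using w by (intro sum.cong) auto
    also have "\<dots> = ?C * (\<Sum>c\<in>UNIV. \<theta> (- (of_nat n * c)) * ?B (- c))"
      by (simp add: sum_product sum.cartesian_product)
    also have "(\<Sum>c\<in>UNIV. \<theta> (- (of_nat n * c)) * ?B (- c)) =
        (\<Sum>x\<in>UNIV. \<theta> x * ?B (inverse (of_nat n) * x))"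
      using n by (intro sum.reindex_bij_witness[of _ "\<lambda>x. - (inverse (of_nat n) * x)"
            "\<lambda>c. - (of_nat n * c)"]) (simp_all add: mult.assoc[symmetric])
    also have "\<dots> = ?B (inverse (of_nat n)) * gauss_sum \<theta> ?B"
      by (simp add: gauss_sum_def mult_char_mult[OF A] power_mult_distrib sum_distrib_left mult_ac)
    finally show ?thesis by (simp add: mult.assoc)
  qed
  then show ?thesis by (rule that)
qed

text \<open>
  Substitute \<open>x = y^d\<close>. The number of \<open>y\<close> over a given \<open>x\<close> is the sum of the values \<open>\<chi>(N x)^i\<close>.
\<close>
lemma extension_sum_power:
  assumes A: "A \<in> mult_chars" and \<chi>: "\<chi> \<in> mult_chars"
    and d: "d = group.ord char_group \<chi>" "d > 0" and s: "s > 0"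
  shows "extension_sum \<theta> (\<lambda>x. A x ^ d) d s = (\<Sum>i<d. extension_sum \<theta> (\<lambda>x. \<chi> x ^ i * A x) 1 s)"
proof -
  let ?E = "{x. (frob ^^ s) x = x} :: 'a alg_closure set"
  let ?N = "\<lambda>x. of_ac (prod_mset (orbit_mset frob s x))"
  let ?W = "\<lambda>x. char_weight \<theta> A 1 (orbit_mset frob s x)"
  have fin: "finite ?E" using s by (rule finite_periodic_points)
  have w: "char_weight \<theta> (\<lambda>x. A x ^ d) d (orbit_mset frob s y) = ?W (y ^ d)" if "y \<in> ?E" for y
  proof -
    have "prod_mset (orbit_mset frob s y) \<in> range to_ac"
      using that by (intro prod_mset_rational image_orbit_mset) simp
    then show ?thesis
      by (simp add: char_weight_def power_sum_orbit_mset_power prod_orbit_mset_power of_ac_power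
          mult_char_power[OF A])
  qed
  have "extension_sum \<theta> (\<lambda>x. A x ^ d) d s = (\<Sum>y\<in>?E. ?W (y ^ d))"
    unfolding extension_sum_def by (rule sum.cong[OF refl w])
  also have "\<dots> = (\<Sum>x\<in>?E. of_nat (card {y \<in> ?E. y ^ d = x}) * ?W x)"
  proof (rule sum_fun_comp[OF fin fin])
    have "(frob ^^ j) (y ^ d) = ((frob ^^ j) y) ^ d" for j and y :: "'a alg_closure"
      by (induction j) (simp_all add: frob_power)
    then show "(\<lambda>y. y ^ d) ` ?E \<subseteq> ?E" by auto
  qed
  also have "\<dots> = (\<Sum>x\<in>?E. (\<Sum>i<d. \<chi> (?N x) ^ i) * ?W x)"
  proof (rule sum.cong[OF refl])
    fix x assume x: "x \<in> ?E"
    show "of_nat (card {y \<in> ?E. y ^ d = x}) * ?W x = (\<Sum>i<d. \<chi> (?N x) ^ i) * ?W x"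
    \<comment> \<open>The fibre count concerns \<open>x \<noteq> 0\<close>; at \<open>0\<close> the weight vanishes.\<close>
    proof (cases "x = 0")
      case True
      have "x \<in># orbit_mset frob s x"
        using s by (auto simp: orbit_mset_def intro!: image_eqI[of _ _ 0])
      then have zero: "prod_mset (orbit_mset frob s x) = 0"
        using True by (simp add: prod_mset_zero_iff)
      have "?W x = 0" unfolding char_weight_def zero using A by (simp add: mult_char_0)
      then show ?thesis by simp
    next
      case False
      then show ?thesis using card_power_fibre[OF \<chi> d False, of s] x by simp
    qed
  qed
  also have "\<dots> = (\<Sum>x\<in>?E. \<Sum>i<d. char_weight \<theta> (\<lambda>x. \<chi> x ^ i * A x) 1 (orbit_mset frob s x))"
    unfolding char_weight_def sum_distrib_right by (intro sum.cong refl) (simp add: mult_ac)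
  also have "\<dots> = (\<Sum>i<d. extension_sum \<theta> (\<lambda>x. \<chi> x ^ i * A x) 1 s)"
    unfolding extension_sum_def by (rule sum.swap)
  finally show ?thesis .
qed

lemma L_series_log_derivative:
  assumes "A \<in> mult_chars"
  shows "fps_X * fps_deriv (Abs_fps (L_coeff \<theta> A k)) =
    Abs_fps (\<lambda>s. if s = 0 then 0 else extension_sum \<theta> A k s) * Abs_fps (L_coeff \<theta> A k)"
proof (rule fps_ext)
  fix n
  let ?S = "\<lambda>s. if s = 0 then 0 else extension_sum \<theta> A k s"
  have "fps_nth (fps_X * fps_deriv (Abs_fps (L_coeff \<theta> A k))) n = of_nat n * L_coeff \<theta> A k n"
    by (cases n) simp_all
  also have "\<dots> = (\<Sum>s\<in>{1..n}. ?S s * L_coeff \<theta> A k (n - s))"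
    unfolding L_coeff_recurrence[OF assms] by (intro sum.cong) auto
  also have "\<dots> = (\<Sum>s=0..n. ?S s * L_coeff \<theta> A k (n - s))"
    by (rule sum.mono_neutral_left) auto
  finally show "fps_nth (fps_X * fps_deriv (Abs_fps (L_coeff \<theta> A k))) n =
      fps_nth (Abs_fps ?S * Abs_fps (L_coeff \<theta> A k)) n"
    by (simp add: fps_mult_nth)
qed

lemma L_series_linear:
  assumes "A \<in> mult_chars"
  shows "Abs_fps (L_coeff \<theta> A 1) = 1 + fps_const (gauss_sum \<theta> A) * fps_X"
proof (rule fps_ext)
  fix n :: nat
  consider "n = 0" | "n = 1" | "n \<ge> 2" by linarith
  then show "fps_nth (Abs_fps (L_coeff \<theta> A 1)) n =
      fps_nth (1 + fps_const (gauss_sum \<theta> A) * fps_X) n"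
    by cases (use L_coeff_0[OF assms, of 1] L_coeff_1[OF assms] L_coeff_ge_2[OF assms] in simp_all)
qed

text \<open>
  Both sides are the coefficient at \<open>T^d\<close> of the same L-function: it is the product of the linear
  L-functions of the characters \<open>\<chi>^i * A\<close>, since the logarithmic derivatives agree.
\<close>
lemma hasse_davenport_up_to_constant:
  assumes \<chi>: "\<chi> \<in> mult_chars" and d: "d = group.ord char_group \<chi>" "d > 0"
  obtains C where "\<And>A. A \<in> mult_chars \<Longrightarrow>
    (\<Prod>i<d. gauss_sum \<theta> (\<lambda>x. \<chi> x ^ i * A x)) =
    C * A (inverse (of_nat d)) ^ d * gauss_sum \<theta> (\<lambda>x. A x ^ d)"
proof -
  have d0: "of_nat d \<noteq> (0 :: 'a)"
    unfolding d(1) by (rule of_nat_ord_nonzero[OF \<chi>])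
  obtain C where C: "\<And>A. A \<in> mult_chars \<Longrightarrow>
      L_coeff \<theta> (\<lambda>x. A x ^ d) d d = C * A (inverse (of_nat d)) ^ d * gauss_sum \<theta> (\<lambda>x. A x ^ d)"
    using L_coeff_top[OF d(2) d0] by blast
  have "(\<Prod>i<d. gauss_sum \<theta> (\<lambda>x. \<chi> x ^ i * A x)) = L_coeff \<theta> (\<lambda>x. A x ^ d) d d"
    if A: "A \<in> mult_chars" for A
  proof -
    let ?B = "\<lambda>i x. \<chi> x ^ i * A x"
    let ?P = "\<lambda>i. Abs_fps (L_coeff \<theta> (?B i) 1)"
    let ?S = "\<lambda>i. Abs_fps (\<lambda>s. if s = 0 then 0 else extension_sum \<theta> (?B i) 1 s)"
    let ?L = "Abs_fps (L_coeff \<theta> (\<lambda>x. A x ^ d) d)"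
    let ?T = "Abs_fps (\<lambda>s. if s = 0 then 0 else extension_sum \<theta> (\<lambda>x. A x ^ d) d s)"
    have B: "?B i \<in> mult_chars" for i
      using \<chi> A by (auto simp: mult_chars_def power_mult_distrib)
    have Ad: "(\<lambda>x. A x ^ d) \<in> mult_chars" using A d(2) by (rule mult_chars_power)
    have T: "(\<Sum>i<d. ?S i) = ?T"
      by (rule fps_ext) (simp add: fps_sum_nth extension_sum_power[OF A \<chi> d])
    have "(\<Prod>i<d. ?P i) = ?L"
    proof (rule fps_log_derivative_unique[of _ ?T])
      show "fps_X * fps_deriv (\<Prod>i<d. ?P i) = ?T * (\<Prod>i<d. ?P i)"
        unfolding T[symmetric] by (rule fps_log_derivative_prod) (simp_all only: L_series_log_derivative[OF B] finite_lessThan)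
      show "fps_X * fps_deriv ?L = ?T * ?L"
        by (rule L_series_log_derivative[OF Ad])
      show "fps_nth (\<Prod>i<d. ?P i) 0 = fps_nth ?L 0"
        by (simp add: fps_nth_0_prod L_coeff_0[OF B] L_coeff_0[OF Ad])
    qed simp
    then have "fps_nth (\<Prod>i<d. ?P i) d = L_coeff \<theta> (\<lambda>x. A x ^ d) d d" by simp
    then show ?thesis
      unfolding L_series_linear[OF B] fps_nth_prod_linear .
  qed
  with C show ?thesis by (intro that[of C]) simp
qed

end

section \<open>Orthogonality of multiplicative characters\<close>

lemma ex_primitive_root_of_unity:
  assumes "n > 0"
  shows "\<exists>u :: complex. \<forall>k. u ^ k = 1 \<longleftrightarrow> n dvd k"
proof (intro exI allI)
  let ?u = "cis (2 * pi / real n)"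
  fix k
  have u_pow: "?u ^ j = cis (2 * pi * real j / real n)" for j
    by (simp add: DeMoivre mult_ac)
  have u1: "?u ^ n = 1" using assms by (simp add: u_pow)
  have "?u ^ k = ?u ^ (n * (k div n) + k mod n)" by simp
  then have reduce: "?u ^ k = ?u ^ (k mod n)" unfolding power_add power_mult u1 by simp
  have "inj_on (\<lambda>j. ?u ^ j) {..<n}"
    unfolding u_pow using bij_betw_roots_unity[OF assms] by (simp add: bij_betw_def)
  then have "?u ^ (k mod n) = ?u ^ 0 \<longleftrightarrow> k mod n = 0"
    using assms by (intro inj_on_eq_iff) auto
  then show "?u ^ k = 1 \<longleftrightarrow> n dvd k"
    unfolding reduce by (simp add: dvd_eq_mod_eq_0)
qed

text \<open>
  The character is \<open>g^k \<mapsto> z^k\<close>; the assumption on \<open>z\<close> makes this independent of the choice of \<open>k\<close>.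
\<close>
lemma ex_mult_char_at_generator:
  fixes g :: "'a::finite_field"
  assumes g: "generates_units g" and z: "z ^ (CARD('a) - 1) = 1"
  shows "\<exists>A \<in> mult_chars. A g = z"
proof -
  let ?n = "CARD('a) - 1"
  have n: "?n > 0" using card_field_ge_2[where ?'a = 'a] by simp
  have z0: "z \<noteq> 0" using z n by (auto simp: power_0_left)
  have g0: "g \<noteq> 0" using g by (simp add: generates_units_def)
  have le: "z ^ i = z ^ j" if "i \<le> j" "g ^ i = g ^ j" for i j
  proof -
    have "g ^ j = g ^ i * g ^ (j - i)"
      using that(1) by (metis le_add_diff_inverse power_add)
    with that g0 have "g ^ (j - i) = 1" by simp
    then have "?n dvd j - i" using g by (simp add: generates_units_def del: One_nat_def)
    then obtain c where "j - i = ?n * c" by blast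
    then have "z ^ (j - i) = 1" using z by (simp add: power_mult)
    moreover have "z ^ j = z ^ i * z ^ (j - i)"
      using that(1) by (metis le_add_diff_inverse power_add)
    ultimately show ?thesis by simp
  qed
  have eq: "z ^ i = z ^ j" if "g ^ i = g ^ j" for i j
  proof (cases "i \<le> j")
    case True
    then show ?thesis using that by (rule le)
  next
    case False
    then have "z ^ j = z ^ i" using that by (intro le) simp_all
    then show ?thesis by (rule sym)
  qed
  define A where "A x = (if x = 0 then 0 else z ^ (SOME k. x = g ^ k))" for x
  have A: "A (g ^ k) = z ^ k" for k
  proof -
    have "g ^ k = g ^ (SOME j. g ^ k = g ^ j)"
      by (rule someI[of _ k]) simp
    then have "z ^ k = z ^ (SOME j. g ^ k = g ^ j)" by (rule eq)
    then show ?thesis by (simp add: A_def g0)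
  qed
  have gen: "\<exists>k. x = g ^ k" if "x \<noteq> 0" for x
    using g that by (simp add: generates_units_def)
  have "A \<in> mult_chars"
    unfolding mult_chars_def
  proof (intro CollectI conjI allI impI)
    fix x y :: 'a
    assume "x \<noteq> 0" "y \<noteq> 0"
    then obtain i j where "x = g ^ i" "y = g ^ j" using gen by meson
    then show "A (x * y) = A x * A y" by (simp add: A power_add flip: power_add)
  next
    fix x :: 'a assume "x \<noteq> 0"
    then obtain i where "x = g ^ i" using gen by meson
    then show "A x \<noteq> 0" using z0 by (simp add: A)
  qed (simp add: A_def)
  moreover have "A g = z" using A[of 1] by simp
  ultimately show ?thesis by blast
qed

lemma mult_char_eqI:
  assumes "A \<in> mult_chars" "B \<in> mult_chars" "generates_units g" "A g = B g"
  shows "A = B"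
proof
  fix x
  show "A x = B x"
  proof (cases "x = 0")
    case False
    then obtain k where "x = g ^ k" using assms(3) by (auto simp: generates_units_def)
    then show ?thesis using assms by (simp add: mult_char_power)
  qed (simp add: assms mult_char_0)
qed

lemma card_mult_chars: "card (mult_chars :: ('a::finite_field \<Rightarrow> complex) set) = CARD('a) - 1"
proof -
  obtain g :: 'a where g: "generates_units g" using ex_generates_units by blast
  let ?n = "CARD('a) - 1"
  have n: "?n > 0" using card_field_ge_2[where ?'a = 'a] by simp
  have g0: "g \<noteq> 0" using g by (simp add: generates_units_def)
  have "A g ^ ?n = 1" if "A \<in> mult_chars" for A
    unfolding mult_char_power[OF that, symmetric] power_card_minus_1[OF g0]
    by (rule mult_char_1[OF that])
  then have "bij_betw (\<lambda>A. A g) mult_chars {z :: complex. z ^ ?n = 1}"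
    using ex_mult_char_at_generator[OF g] mult_char_eqI[OF _ _ g]
    by (fastforce simp: bij_betw_def inj_on_def)
  then show ?thesis
    using card_roots_unity_eq[OF n] by (simp add: bij_betw_same_card)
qed

lemma sum_mult_chars:
  fixes x :: "'a::finite_field"
  shows "(\<Sum>A\<in>mult_chars. A x) = (if x = 1 then of_nat (CARD('a) - 1) else 0)"
proof -
  consider "x = 0" | "x = 1" | "x \<noteq> 0" "x \<noteq> 1" by blast
  then show ?thesis
  proof cases
    case 3
    obtain g :: 'a where g: "generates_units g" using ex_generates_units by blast
    let ?n = "CARD('a) - 1"
    have n: "?n > 0" using card_field_ge_2[where ?'a = 'a] by simp
    obtain k where k: "x = g ^ k" using g 3 by (auto simp: generates_units_def)
    have ndvd: "\<not> ?n dvd k" using g 3 k by (simp add: generates_units_def del: One_nat_def)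
    obtain u :: complex where u: "\<And>j. u ^ j = 1 \<longleftrightarrow> ?n dvd j"
      using ex_primitive_root_of_unity[OF n] by blast
    have u1: "u ^ ?n = 1" and uk: "u ^ k \<noteq> 1" using ndvd unfolding u by simp_all
    obtain W where W: "W \<in> mult_chars" "W g = u"
      using ex_mult_char_at_generator[OF g u1] by blast
    have Wx: "W x \<noteq> 1" using uk by (simp add: k mult_char_power[OF W(1)] W(2))
    have "(\<Sum>A\<in>mult_chars. A x) = (\<Sum>A\<in>mult_chars. W x * A x)"
    proof (rule sum.reindex_bij_witness[of _ "\<lambda>A x. W x * A x" "\<lambda>A x. inverse (W x) * A x"])
      fix A :: "'a \<Rightarrow> complex" assume A: "A \<in> mult_chars"
      show "(\<lambda>x. W x * (inverse (W x) * A x)) = A" "(\<lambda>x. inverse (W x) * (W x * A x)) = A"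
        by (rule ext; case_tac "x = 0"; simp add: mult_char_nonzero[OF W(1)] mult_char_0[OF A])+
      then show "W x * (inverse (W x) * A x) = A x" by (simp add: fun_eq_iff)
      show "(\<lambda>x. inverse (W x) * A x) \<in> mult_chars"
        by (intro mult_chars_times inverse_mult_chars W A)
      show "(\<lambda>x. W x * A x) \<in> mult_chars" by (intro mult_chars_times W A)
    qed
    also have "\<dots> = W x * (\<Sum>A\<in>mult_chars. A x)" by (simp add: sum_distrib_left)
    finally show ?thesis using Wx 3 by simp
  qed (simp_all add: mult_char_0 mult_char_1 card_mult_chars)
qed

section \<open>Existence of a nontrivial additive character\<close>

text \<open>
  Compose the absolute trace \<open>\<Sum>i<e. x^(p^i)\<close>, whose values are fixed by the \<open>p\<close>-th power map and hence lie in the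
  prime field, with a primitive \<open>p\<close>-th root of unity. The trace is not identically zero, being
  given by a polynomial of degree less than \<open>q\<close>.
\<close>
lemma ex_additive_character:
  assumes "prime p" "CARD('a::finite_field) = p ^ e"
  shows "\<exists>\<theta> :: 'a \<Rightarrow> complex. (\<forall>x y. \<theta> (x + y) = \<theta> x * \<theta> y) \<and> \<theta> 0 = 1 \<and> (\<exists>x. \<theta> x \<noteq> 1)"
proof -
  have e: "e > 0" using assms(2) card_field_ge_2[where ?'a = 'a] by (cases e) auto
  have p1: "p > 1" using assms(1) by (rule prime_gt_1_nat)
  have "CHAR('a) dvd p ^ e"
    using of_nat_card_field[where ?'a = 'a] by (simp only: assms(2) of_nat_eq_0_iff_char_dvd)
  then have char: "CHAR('a) = p"
    using assms(1) by (metis CHAR_prime prime_dvd_power primes_dvd_imp_eq)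
  have dream: "(x + y :: 'a) ^ (p ^ i) = x ^ (p ^ i) + y ^ (p ^ i)" for x y i
    by (rule freshmans_dream') (use assms(1) char in auto)
  define tr :: "'a \<Rightarrow> 'a" where "tr x = (\<Sum>i<e. x ^ (p ^ i))" for x
  have tr_add: "tr (x + y) = tr x + tr y" for x y
    by (simp add: tr_def dream sum.distrib)
  have tr_p: "tr x ^ p = tr x" for x
  proof -
    have "tr x ^ p = (\<Sum>i<e. x ^ (p ^ Suc i))"
      unfolding tr_def using assms(1) char
      by (subst freshmans_dream_sum) (simp_all add: mult.commute flip: power_mult)
    moreover have "(\<Sum>i<Suc e. x ^ (p ^ i)) = x + (\<Sum>i<e. x ^ (p ^ Suc i))"
      by (subst sum.lessThan_Suc_shift) simp
    moreover have "(\<Sum>i<Suc e. x ^ (p ^ i)) = tr x + x"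
      using finite_field_power_card_eq_same[of x] by (simp add: tr_def assms(2))
    ultimately show ?thesis by simp
  qed
  \<comment> \<open>The multiples of \<open>1\<close> already account for the \<open>p\<close> roots of \<open>X^p - X\<close>.\<close>
  have prime_field: "\<exists>k. y = of_nat k" if y: "y ^ p = y" for y :: 'a
  proof (rule ccontr)
    assume ny: "\<nexists>k. y = of_nat k"
    let ?f = "monom 1 p - monom 1 1 :: 'a poly"
    have "coeff ?f 1 = - 1" using p1 by auto
    then have nz: "?f \<noteq> 0" by (metis coeff_0 neg_equal_0_iff_equal zero_neq_one)
    have "inj_on (of_nat :: nat \<Rightarrow> 'a) {..<p}"
      by (auto simp: inj_on_def of_nat_eq_iff_cong_CHAR char cong_def)
    then have "Suc p = card (insert y (of_nat ` {..<p}))"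
      using ny by (subst card_insert_disjoint) (auto simp: card_image)
    also have "\<dots> \<le> card {x. poly ?f x = 0}"
    proof (rule card_mono[OF poly_roots_finite[OF nz]])
      have "of_nat k ^ p = (of_nat k :: 'a)" for k
      proof (induction k)
        case (Suc k)
        then show ?case using dream[of 1 "of_nat k" 1] by simp
      qed (use p1 in simp)
      then show "insert y (of_nat ` {..<p}) \<subseteq> {x. poly ?f x = 0}"
        using y by (auto simp: poly_monom)
    qed
    also have "\<dots> \<le> degree ?f" by (rule card_poly_roots_bound[OF nz])
    also have "\<dots> \<le> p" using p1 by (intro degree_diff_le) (simp_all add: degree_monom_eq)
    finally show False by simp
  qed
  obtain u :: complex where u: "\<And>j. u ^ j = 1 \<longleftrightarrow> p dvd j"
    using ex_primitive_root_of_unity[of p] p1 by auto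
  have u_p: "u ^ p = 1" unfolding u by simp
  have u_mod: "u ^ k = u ^ (k mod p)" for k
  proof -
    have "u ^ k = u ^ (p * (k div p) + k mod p)" by simp
    then show ?thesis unfolding power_add power_mult u_p by simp
  qed
  define \<theta> where "\<theta> x = u ^ (SOME k. tr x = of_nat k)" for x
  have \<theta>: "\<theta> x = u ^ k" if "tr x = of_nat k" for x k
  proof -
    have "tr x = of_nat (SOME k. tr x = of_nat k)" by (rule someI[of _ k]) (rule that)
    then have "[(SOME k. tr x = of_nat k) = k] (mod p)"
      using that by (metis of_nat_eq_iff_cong_CHAR char)
    then show ?thesis unfolding \<theta>_def by (metis u_mod cong_def)
  qed
  have ex: "\<exists>k. tr x = of_nat k" for x using prime_field tr_p by blast
  have "\<theta> (x + y) = \<theta> x * \<theta> y" for x y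
  proof -
    obtain i j where ij: "tr x = of_nat i" "tr y = of_nat j" using ex by meson
    then have "tr (x + y) = of_nat (i + j)" by (simp add: tr_add)
    then have "\<theta> (x + y) = u ^ (i + j)" by (rule \<theta>)
    then show ?thesis unfolding \<theta>[OF ij(1)] \<theta>[OF ij(2)] by (simp add: power_add)
  qed
  moreover have "tr 0 = of_nat 0" using p1 by (simp add: tr_def power_0_left)
  from \<theta>[OF this] have "\<theta> 0 = 1" by simp
  moreover have "\<exists>x. \<theta> x \<noteq> 1"
  proof -
    \<comment> \<open>The trace as a polynomial; its coefficient at \<open>X\<close> shows that it is not zero.\<close>
    define f where "f = (\<Sum>i<e. monom (1 :: 'a) (p ^ i))"
    have "coeff f 1 = (\<Sum>i<e. if i = 0 then 1 else 0)"
      unfolding f_def coeff_sum using p1 by (intro sum.cong) auto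
    then have "coeff f 1 = 1" using e by simp
    then have nz: "f \<noteq> 0" by auto
    have deg: "degree f \<le> p ^ (e - 1)"
      unfolding f_def
      by (rule degree_sum_le) (use p1 e in \<open>auto intro!: order_trans[OF degree_monom_le] power_increasing\<close>)
    have "\<exists>x. tr x \<noteq> 0"
    proof (rule ccontr)
      assume "\<nexists>x. tr x \<noteq> 0"
      then have "poly f x = 0" for x by (simp add: f_def tr_def poly_sum poly_monom)
      then have "CARD('a) \<le> degree f" using card_poly_roots_bound[OF nz] by simp
      also have "\<dots> \<le> p ^ (e - 1)" by (rule deg)
      also have "\<dots> < p ^ e" using p1 e by (intro power_strict_increasing) auto
      finally show False by (simp add: assms(2))
    qed
    then obtain x where x: "tr x \<noteq> 0" by blast
    obtain k where k: "tr x = of_nat k" using ex by blast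
    with x have "\<not> p dvd k" by (simp add: of_nat_eq_0_iff_char_dvd char)
    then have "\<theta> x \<noteq> 1" using \<theta>[OF k] u by simp
    then show ?thesis by blast
  qed
  ultimately show ?thesis by blast
qed

section \<open>Gauss and Jacobi sums\<close>

definition jacobi_sum :: "('a::finite_field \<Rightarrow> complex) \<Rightarrow> ('a \<Rightarrow> complex) \<Rightarrow> complex" where
  "jacobi_sum A B = (\<Sum>x\<in>UNIV. A x * B (1 - x))"

text \<open>
  The inverse character, written pointwise so that it stays \<open>0\<close> at \<open>0\<close>.
\<close>
definition conj_char :: "('a::finite_field \<Rightarrow> complex) \<Rightarrow> 'a \<Rightarrow> complex" where
  "conj_char A x = inverse (A x)"

lemma conj_char_in_mult_chars: "A \<in> mult_chars \<Longrightarrow> conj_char A \<in> mult_chars"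
  using inverse_mult_chars[of A] by (simp add: conj_char_def[abs_def])

lemma mult_char_minus_1_squared:
  assumes "A \<in> mult_chars"
  shows "A (- 1) * A (- 1) = 1"
  using mult_char_mult[OF assms, of "- 1" "- 1"] mult_char_1[OF assms] by simp

lemma mult_char_minus: "A \<in> mult_chars \<Longrightarrow> A (- x) = A (- 1) * A x"
  using mult_char_mult[of A "- 1" x] by simp

lemma mult_char_eq_triv_iff_all:
  assumes "A \<in> mult_chars"
  shows "A = triv_char \<longleftrightarrow> (\<forall>x. x \<noteq> 0 \<longrightarrow> A x = 1)"
  using assms by (auto simp: triv_char_def fun_eq_iff mult_char_0)

lemma sum_mult_char:
  fixes A :: "'a::finite_field \<Rightarrow> complex"
  assumes "A \<in> mult_chars" "A \<noteq> triv_char"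
  shows "(\<Sum>x\<in>UNIV. A x) = 0"
proof -
  obtain c where c: "c \<noteq> 0" "A c \<noteq> 1" using assms mult_char_eq_triv_iff_all by blast
  have "(\<Sum>x\<in>UNIV. A x) = (\<Sum>x\<in>UNIV. A (c * x))"
    using c(1) by (intro sum.reindex_bij_witness[of _ "\<lambda>x. c * x" "\<lambda>x. x / c"]) auto
  also have "\<dots> = A c * (\<Sum>x\<in>UNIV. A x)" by (simp add: mult_char_mult[OF assms(1)] sum_distrib_left)
  finally show ?thesis using c(2) by simp
qed

lemma sum_conv_nonzero:
  assumes "f 0 = 0"
  shows "(\<Sum>x\<in>UNIV. f x) = (\<Sum>x\<in>- {0 :: 'a::finite_field}. f x :: complex)"
  by (rule sum.mono_neutral_right) (use assms in auto)

lemma char_binom_conv_jacobi: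
  assumes "B \<in> mult_chars"
  shows "char_binom A (B :: 'a::finite_field \<Rightarrow> complex) =
    B (- 1) / of_nat CARD('a) * jacobi_sum A (conj_char B)"
  by (simp add: char_binom_def jacobi_sum_def char_group_inv[OF assms] conj_char_def)

text \<open>
  The involution \<open>x \<mapsto> x / (x - 1)\<close> of the line without \<open>0\<close> and \<open>1\<close>. The point of this form is that in
  \<open>jacobi_sum_gauss_reflected\<close> the product of the two characters is the inverse of \<open>B\<close>, hence
  nontrivial whatever \<open>A\<close> is.
\<close>
lemma jacobi_sum_reflect:
  fixes A B :: "'a::finite_field \<Rightarrow> complex"
  assumes A: "A \<in> mult_chars" and B: "B \<in> mult_chars"
  shows "jacobi_sum A B = A (- 1) * jacobi_sum A (\<lambda>x. conj_char A x * conj_char B x)"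
proof -
  let ?C = "\<lambda>x. conj_char A x * conj_char B x"
  have C: "?C \<in> mult_chars" by (intro mult_chars_times conj_char_in_mult_chars A B)
  have restrict: "jacobi_sum A D = (\<Sum>x\<in>- {0, 1}. A x * D (1 - x))" if "D \<in> mult_chars" for D
    unfolding jacobi_sum_def
    by (rule sum.mono_neutral_right) (auto simp: mult_char_0[OF A] mult_char_0[OF that])
  have "jacobi_sum A B = (\<Sum>u\<in>- {0, 1}. A (- 1) * (A u * ?C (1 - u)))"
    unfolding restrict[OF B]
  proof (rule sum.reindex_bij_witness[of _ "\<lambda>u. u / (u - 1)" "\<lambda>u. u / (u - 1)"])
    fix x :: 'a assume x: "x \<in> - {0, 1}"
    then have x1: "x \<noteq> 0" "x - 1 \<noteq> 0" "1 - x \<noteq> 0" by auto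
    have diff: "x / (x - 1) - 1 = inverse (x - 1)" "1 - x / (x - 1) = inverse (1 - x)"
      using x1 by (auto simp: field_simps)
    show "x / (x - 1) / (x / (x - 1) - 1) = x"
      unfolding diff using x1 by simp
    then show "x / (x - 1) / (x / (x - 1) - 1) = x" .
    show "x / (x - 1) \<in> - {0, 1}"
      using x1 by (auto simp: field_simps)
    then show "x / (x - 1) \<in> - {0, 1}" .
    have "x / (x - 1) = - 1 * x * inverse (1 - x)"
      using x1 by (auto simp: field_simps)
    then have "A (x / (x - 1)) = A (- 1) * A x * inverse (A (1 - x))"
      by (simp only: mult_char_mult[OF A] mult_char_inverse[OF A])
    moreover have "A (1 - x) \<noteq> 0" "B (1 - x) \<noteq> 0"
      using x1 mult_char_nonzero A B by blast+
    ultimately show "A (- 1) * (A (x / (x - 1)) * ?C (1 - x / (x - 1))) = A x * B (1 - x)"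
      using mult_char_minus_1_squared[OF A]
      by (simp add: conj_char_def diff mult_char_inverse[OF A] mult_char_inverse[OF B])
  qed
  then show ?thesis unfolding restrict[OF C] by (simp add: sum_distrib_left)
qed

context add_char
begin

lemma gauss_sum_triv: "gauss_sum \<theta> triv_char = - 1"
proof -
  have "gauss_sum \<theta> triv_char = (\<Sum>x\<in>UNIV. \<theta> x - (if x = 0 then 1 else 0))"
    unfolding gauss_sum_def by (rule sum.cong) (auto simp: triv_char_def theta_0)
  then show ?thesis by (simp add: sum_subtractf sum_theta)
qed

lemma sum_theta_mult_nonzero:
  "(\<Sum>x\<in>- {0}. \<theta> (x * y)) = (if y = 0 then of_nat CARD('a) else 0) - 1"
proof -
  have "(\<Sum>x\<in>UNIV. \<theta> (x * y)) = \<theta> (0 * y) + (\<Sum>x\<in>- {0}. \<theta> (x * y))"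
    unfolding Compl_eq_Diff_UNIV by (rule sum.remove) auto
  then show ?thesis by (simp add: sum_theta_mult theta_0 split: if_splits)
qed

text \<open>
  Collect the terms of the double sum with \<open>x + y = s\<close>. By scaling, \<open>s \<noteq> 0\<close> contributes the Jacobi sum, and
  \<open>s = 0\<close> contributes nothing, as \<open>A * B\<close> is nontrivial.
\<close>
lemma gauss_sum_mult:
  assumes A: "A \<in> mult_chars" and B: "B \<in> mult_chars" and AB: "(\<lambda>x. A x * B x) \<noteq> triv_char"
  shows "gauss_sum \<theta> A * gauss_sum \<theta> B = jacobi_sum A B * gauss_sum \<theta> (\<lambda>x. A x * B x)"
proof -
  let ?C = "\<lambda>x. A x * B x"
  have C: "?C \<in> mult_chars" using A B by (rule mult_chars_times)
  have inner: "(\<Sum>x\<in>UNIV. A x * B (s - x)) = ?C s * jacobi_sum A B" for s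
  proof (cases "s = 0")
    case True
    have "(\<Sum>x\<in>UNIV. A x * B (s - x)) = (\<Sum>x\<in>UNIV. B (- 1) * ?C x)"
    proof (rule sum.cong[OF refl])
      fix x
      show "A x * B (s - x) = B (- 1) * ?C x"
        using True mult_char_minus[OF B, of x] by simp
    qed
    also have "\<dots> = 0"
      by (simp only: sum_distrib_left[symmetric] sum_mult_char[OF C AB] mult_zero_right)
    finally show ?thesis using True A by (simp add: mult_char_0)
  next
    case False
    then have "(\<Sum>x\<in>UNIV. A x * B (s - x)) = (\<Sum>u\<in>UNIV. A (s * u) * B (s * (1 - u)))"
      by (intro sum.reindex_bij_witness[of _ "\<lambda>u. s * u" "\<lambda>x. x / s"]) (auto simp: algebra_simps)
    then show ?thesis
      by (simp only: mult_char_mult[OF A] mult_char_mult[OF B] jacobi_sum_def sum_distrib_left mult_ac)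
  qed
  have "gauss_sum \<theta> A * gauss_sum \<theta> B = (\<Sum>x\<in>UNIV. \<Sum>y\<in>UNIV. A x * B y * \<theta> (x + y))"
    by (simp add: gauss_sum_def sum_product theta_add mult_ac)
  also have "\<dots> = (\<Sum>x\<in>UNIV. \<Sum>s\<in>UNIV. A x * B (s - x) * \<theta> s)"
  proof (rule sum.cong[OF refl])
    fix x
    show "(\<Sum>y\<in>UNIV. A x * B y * \<theta> (x + y)) = (\<Sum>s\<in>UNIV. A x * B (s - x) * \<theta> s)"
      by (rule sum.reindex_bij_witness[of _ "\<lambda>s. s - x" "\<lambda>y. x + y"]) auto
  qed
  also have "\<dots> = (\<Sum>s\<in>UNIV. \<Sum>x\<in>UNIV. A x * B (s - x) * \<theta> s)"
    by (rule sum.swap)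
  also have "\<dots> = (\<Sum>s\<in>UNIV. ?C s * jacobi_sum A B * \<theta> s)"
    by (simp only: sum_distrib_right[symmetric] inner)
  also have "\<dots> = jacobi_sum A B * gauss_sum \<theta> ?C"
    by (simp add: gauss_sum_def sum_distrib_left mult_ac)
  finally show ?thesis .
qed

lemma gauss_sum_conj:
  assumes A: "A \<in> mult_chars" and nt: "A \<noteq> triv_char"
  shows "gauss_sum \<theta> A * gauss_sum \<theta> (conj_char A) = A (- 1) * of_nat CARD('a)"
proof -
  let ?U = "- {0} :: 'a set"
  have A': "conj_char A \<in> mult_chars" using A by (rule conj_char_in_mult_chars)
  have "gauss_sum \<theta> A * gauss_sum \<theta> (conj_char A) =
      (\<Sum>x\<in>UNIV. A x * \<theta> x) * (\<Sum>y\<in>?U. conj_char A y * \<theta> y)"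
    unfolding gauss_sum_def
    by (subst (2) sum_conv_nonzero) (simp_all add: mult_char_0[OF A'])
  also have "\<dots> = (\<Sum>x\<in>UNIV. \<Sum>y\<in>?U. A x * conj_char A y * \<theta> (x + y))"
    by (simp add: sum_product theta_add mult_ac)
  also have "\<dots> = (\<Sum>y\<in>?U. \<Sum>x\<in>UNIV. A x * conj_char A y * \<theta> (x + y))"
    by (rule sum.swap)
  also have "\<dots> = (\<Sum>y\<in>?U. \<Sum>u\<in>UNIV. A u * \<theta> (y * (u + 1)))"
  proof (rule sum.cong[OF refl])
    fix y :: 'a assume "y \<in> ?U"
    then have y: "y \<noteq> 0" by simp
    have "(\<Sum>x\<in>UNIV. A x * conj_char A y * \<theta> (x + y)) =
        (\<Sum>u\<in>UNIV. A (y * u) * conj_char A y * \<theta> (y * u + y))"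
      using y by (intro sum.reindex_bij_witness[of _ "\<lambda>u. y * u" "\<lambda>x. x / y"]) auto
    also have "\<dots> = (\<Sum>u\<in>UNIV. A u * \<theta> (y * (u + 1)))"
      using mult_char_nonzero[OF A y]
      by (intro sum.cong refl) (simp add: mult_char_mult[OF A] conj_char_def algebra_simps)
    finally show "(\<Sum>x\<in>UNIV. A x * conj_char A y * \<theta> (x + y)) = (\<Sum>u\<in>UNIV. A u * \<theta> (y * (u + 1)))" .
  qed
  also have "\<dots> = (\<Sum>u\<in>UNIV. A u * (\<Sum>y\<in>?U. \<theta> (y * (u + 1))))"
    by (subst sum.swap) (simp add: sum_distrib_left)
  also have "\<dots> = (\<Sum>u\<in>UNIV. A u * ((if u = - 1 then of_nat CARD('a) else 0) - 1))"
  proof (rule sum.cong[OF refl])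
    fix u :: 'a
    have "(\<Sum>y\<in>?U. \<theta> (y * (u + 1))) = (if u = - 1 then of_nat CARD('a) else 0) - 1"
      by (simp add: sum_theta_mult_nonzero eq_neg_iff_add_eq_0)
    then show "A u * (\<Sum>y\<in>?U. \<theta> (y * (u + 1))) =
        A u * ((if u = - 1 then of_nat CARD('a) else 0) - 1)" by simp
  qed
  also have "\<dots> = (\<Sum>u\<in>UNIV. if u = - 1 then A u * of_nat CARD('a) else 0) - (\<Sum>u\<in>UNIV. A u)"
    unfolding sum_subtractf[symmetric] by (intro sum.cong) (auto simp: algebra_simps)
  also have "\<dots> = A (- 1) * of_nat CARD('a)"
    by (simp add: sum_mult_char[OF A nt])
  finally show ?thesis .
qed

lemma gauss_sum_nonzero:
  assumes "A \<in> mult_chars"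
  shows "gauss_sum \<theta> A \<noteq> 0"
proof (cases "A = triv_char")
  case True
  then show ?thesis by (simp add: gauss_sum_triv)
next
  case False
  have "A (- 1) * of_nat CARD('a) \<noteq> 0"
    using mult_char_nonzero[OF assms, of "- 1"] by simp
  then show ?thesis using gauss_sum_conj[OF assms False] by auto
qed

lemma char_binom_gauss:
  assumes A: "A \<in> mult_chars" and B: "B \<in> mult_chars" and "A \<noteq> B"
  shows "char_binom A B = B (- 1) * gauss_sum \<theta> A * gauss_sum \<theta> (conj_char B) /
    (of_nat CARD('a) * gauss_sum \<theta> (\<lambda>x. A x * conj_char B x))"
proof -
  have B': "conj_char B \<in> mult_chars" using B by (rule conj_char_in_mult_chars)
  have AB: "(\<lambda>x. A x * conj_char B x) \<in> mult_chars" using A B' by (rule mult_chars_times)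
  have "(\<lambda>x. A x * conj_char B x) \<noteq> triv_char"
  proof
    assume triv: "(\<lambda>x. A x * conj_char B x) = triv_char"
    have "A x = B x" for x
    proof (cases "x = 0")
      case False
      have "A x * conj_char B x = 1" using fun_cong[OF triv, of x] False by (simp add: triv_char_def)
      then show ?thesis using mult_char_nonzero[OF B False] by (simp add: conj_char_def field_simps)
    qed (simp add: mult_char_0 A B)
    with \<open>A \<noteq> B\<close> show False by blast
  qed
  from gauss_sum_mult[OF A B' this]
  have "jacobi_sum A (conj_char B) =
      gauss_sum \<theta> A * gauss_sum \<theta> (conj_char B) / gauss_sum \<theta> (\<lambda>x. A x * conj_char B x)"
    by (simp only: nonzero_eq_divide_eq[OF gauss_sum_nonzero[OF AB]])
  then show ?thesis by (simp add: char_binom_conv_jacobi[OF B])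
qed

lemma jacobi_sum_gauss_reflected:
  assumes A: "A \<in> mult_chars" and B: "B \<in> mult_chars" "B \<noteq> triv_char"
  shows "jacobi_sum A B = A (- 1) * gauss_sum \<theta> A *
    gauss_sum \<theta> (\<lambda>x. conj_char A x * conj_char B x) / gauss_sum \<theta> (conj_char B)"
proof -
  let ?C = "\<lambda>x. conj_char A x * conj_char B x"
  have C: "?C \<in> mult_chars" by (intro mult_chars_times conj_char_in_mult_chars A B)
  have AC: "(\<lambda>x. A x * ?C x) = conj_char B"
  proof
    fix x
    show "A x * ?C x = conj_char B x"
      using mult_char_nonzero[OF A, of x]
      by (cases "x = 0") (simp_all add: conj_char_def mult_char_0[OF B(1)])
  qed
  have "conj_char B \<noteq> triv_char"
  proof
    assume triv: "conj_char B = triv_char"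
    have "B x = triv_char x" for x
    proof -
      have "B x = inverse (triv_char x)"
        using fun_cong[OF triv, of x] by (simp add: conj_char_def flip: triv)
      then show ?thesis by (simp add: triv_char_def)
    qed
    with B(2) show False by blast
  qed
  then have "gauss_sum \<theta> A * gauss_sum \<theta> ?C = jacobi_sum A ?C * gauss_sum \<theta> (conj_char B)"
    using gauss_sum_mult[OF A C] unfolding AC by blast
  then have "jacobi_sum A ?C =
      gauss_sum \<theta> A * gauss_sum \<theta> ?C / gauss_sum \<theta> (conj_char B)"
    by (simp only: nonzero_eq_divide_eq[OF gauss_sum_nonzero[OF conj_char_in_mult_chars[OF B(1)]]])
  then show ?thesis unfolding jacobi_sum_reflect[OF A B(1)] by simp
qed

end

section \<open>The Hasse-Davenport product formula\<close>

lemma power_conj_char: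
  assumes "\<chi> \<in> mult_chars" "n = group.ord char_group \<chi>" "0 < j" "j < n"
  shows "conj_char (\<lambda>x. \<chi> x ^ j) = (\<lambda>x. \<chi> x ^ (n - j))"
proof
  fix x
  show "conj_char (\<lambda>x. \<chi> x ^ j) x = \<chi> x ^ (n - j)"
  proof (cases "x = 0")
    case True
    then show ?thesis using assms by (simp add: conj_char_def mult_char_0 power_0_left)
  next
    case False
    have "\<chi> x ^ j * \<chi> x ^ (n - j) = 1"
      using mult_char_power_ord[OF assms(1) False] assms(2,4) by (simp flip: power_add)
    then show ?thesis unfolding conj_char_def by (rule inverse_unique)
  qed
qed

lemma power_char_nontrivial:
  fixes \<chi> :: "'a::finite_field \<Rightarrow> complex"
  assumes "\<chi> \<in> mult_chars" "0 < j" "j < group.ord char_group \<chi>"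
  shows "(\<lambda>x. \<chi> x ^ j) \<noteq> triv_char"
proof
  assume triv: "(\<lambda>x. \<chi> x ^ j) = triv_char"
  obtain g :: 'a where g: "generates_units g" using ex_generates_units by blast
  then have "\<chi> g ^ j = 1"
    using fun_cong[OF triv, of g] by (simp add: triv_char_def generates_units_def)
  then have "group.ord char_group \<chi> dvd j"
    using power_generator_eq_1_iff[OF assms(1) g] by simp
  with assms(2,3) show False by (auto dest: dvd_imp_le)
qed

lemma mult_char_minus_1_odd_order:
  fixes \<chi> :: "'a::finite_field \<Rightarrow> complex"
  assumes "\<chi> \<in> mult_chars" "odd (group.ord char_group \<chi>)"
  shows "\<chi> (- 1) = 1"
proof -
  obtain k where k: "group.ord char_group \<chi> = 2 * k + 1" using assms(2) by (auto elim: oddE)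
  have "(\<chi> (- 1) * \<chi> (- 1)) ^ k * \<chi> (- 1) = 1"
    using mult_char_power_ord[OF assms(1), of "- 1"]
    by (simp add: k power_mult power2_eq_square power_mult_distrib mult.commute)
  then show ?thesis by (simp add: mult_char_minus_1_squared[OF assms(1)])
qed

context add_char
begin

lemma gauss_sum_power_conj:
  assumes "\<chi> \<in> mult_chars" "n = group.ord char_group \<chi>" "0 < j" "j < n"
  shows "gauss_sum \<theta> (\<lambda>x. \<chi> x ^ j) * gauss_sum \<theta> (\<lambda>x. \<chi> x ^ (n - j)) =
    \<chi> (- 1) ^ j * of_nat CARD('a)"
proof -
  have "(\<lambda>x. \<chi> x ^ j) \<noteq> triv_char"
    using assms by (intro power_char_nontrivial) simp_all
  then show ?thesis
    using gauss_sum_conj[OF mult_chars_power[OF assms(1,3)]] unfolding power_conj_char[OF assms] by blast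
qed

text \<open>
  The constant is found by taking for \<open>A\<close> the trivial character, whose Gauss sum is \<open>- 1\<close>.
\<close>
theorem hasse_davenport_product:
  assumes \<chi>: "\<chi> \<in> mult_chars" and d: "d = group.ord char_group \<chi>" "d > 0" and A: "A \<in> mult_chars"
  shows "(\<Prod>i<d. gauss_sum \<theta> (\<lambda>x. \<chi> x ^ i * A x)) =
    (\<Prod>i\<in>{1..<d}. gauss_sum \<theta> (\<lambda>x. \<chi> x ^ i)) * A (inverse (of_nat d)) ^ d * gauss_sum \<theta> (\<lambda>x. A x ^ d)"
proof -
  obtain C where C: "\<And>A. A \<in> mult_chars \<Longrightarrow> (\<Prod>i<d. gauss_sum \<theta> (\<lambda>x. \<chi> x ^ i * A x)) =
      C * A (inverse (of_nat d)) ^ d * gauss_sum \<theta> (\<lambda>x. A x ^ d)"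
    using hasse_davenport_up_to_constant[OF \<chi> d] by blast
  have split: "{..<d} = insert 0 {1..<d}" using d(2) by auto
  have triv: "(\<lambda>x. \<chi> x ^ i * triv_char x) = (\<lambda>x. \<chi> x ^ i)" if "i > 0" for i
    using that by (auto simp: triv_char_def fun_eq_iff mult_char_0[OF \<chi>])
  have triv_d: "(\<lambda>x :: 'a. triv_char x ^ d) = triv_char"
    using d(2) by (auto simp: triv_char_def fun_eq_iff)
  have "of_nat d \<noteq> (0 :: 'a)" unfolding d(1) by (rule of_nat_ord_nonzero[OF \<chi>])
  then have "(\<Prod>i<d. gauss_sum \<theta> (\<lambda>x. \<chi> x ^ i * triv_char x)) = - C"
    using C[OF triv_char_in_mult_chars]
    by (simp add: triv_d gauss_sum_triv) (simp add: triv_char_def)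
  moreover have "(\<Prod>i<d. gauss_sum \<theta> (\<lambda>x. \<chi> x ^ i * triv_char x)) =
      gauss_sum \<theta> triv_char * (\<Prod>i\<in>{1..<d}. gauss_sum \<theta> (\<lambda>x. \<chi> x ^ i))"
    unfolding split by (subst prod.insert) (auto simp: triv intro!: prod.cong)
  ultimately have "C = (\<Prod>i\<in>{1..<d}. gauss_sum \<theta> (\<lambda>x. \<chi> x ^ i))"
    by (simp add: gauss_sum_triv)
  then show ?thesis using C[OF A] by simp
qed

end

section \<open>Counting points\<close>

text \<open>
  There is no point with \<open>x\<^sub>2 = 0\<close>, so all points have the form \<open>[x : 1]\<close>.
\<close>
lemma card_Z_points:
  fixes l :: "'a::finite_field"
  assumes "d \<ge> 2"
  shows "card (Z_points d l) = card {x :: 'a. x ^ d + 1 = of_nat d * l * x}"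
proof -
  let ?N = "{x :: 'a. x ^ d + 1 = of_nat d * l * x}"
  let ?P = "\<lambda>x :: 'a. proj_rel `` {(x, 1)}"
  obtain n where n: "d = Suc n" "n > 0" using assms by (cases d) auto
  have mem: "(a, b) \<in> ?P x \<longleftrightarrow> b \<noteq> 0 \<and> a = b * x" for a b x
    by (auto simp: proj_rel_def)
  have hom: "(c * x) ^ d + c ^ d = of_nat d * l * (c * x) * c ^ (d - 1) \<longleftrightarrow> x ^ d + 1 = of_nat d * l * x"
    if "c \<noteq> 0" for c x :: 'a
  proof -
    have 1: "(c * x) ^ d + c ^ d = c ^ d * (x ^ d + 1)"
      by (simp add: power_mult_distrib algebra_simps)
    have 2: "of_nat d * l * (c * x) * c ^ (d - 1) = c ^ d * (of_nat d * l * x)"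
      by (simp add: n(1) mult_ac)
    show ?thesis unfolding 1 2 using that by simp
  qed
  have "bij_betw ?P ?N (Z_points d l)"
    unfolding bij_betw_def
  proof (intro conjI equalityI subsetI inj_onI)
    fix x y :: 'a assume "?P x = ?P y"
    then have "(x, 1) \<in> ?P y" using mem[of x 1 x] by simp
    then show "x = y" using mem[of x 1 y] by simp
  next
    fix Q assume "Q \<in> ?P ` ?N"
    then obtain x where x: "x \<in> ?N" "Q = ?P x" by blast
    have "?P x \<in> proj_line"
      unfolding proj_line_def by (rule quotientI) simp
    moreover have "x1 ^ d + x2 ^ d = of_nat d * l * x1 * x2 ^ (d - 1)" if "(x1, x2) \<in> ?P x" for x1 x2
      using that hom[of x2 x] x(1) unfolding mem by simp
    ultimately show "Q \<in> Z_points d l"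
      unfolding Z_points_def x(2) by blast
  next
    fix Q assume Q: "Q \<in> Z_points d l"
    then have "Q \<in> proj_line" by (simp add: Z_points_def)
    then obtain a b :: 'a where ab: "(a, b) \<noteq> (0, 0)" "Q = proj_rel `` {(a, b)}"
      unfolding proj_line_def quotient_def by auto
    have "(a, b) \<in> Q" using ab(1) by (auto simp: ab(2) proj_rel_def intro!: exI[of _ 1])
    then have eq: "a ^ d + b ^ d = of_nat d * l * a * b ^ (d - 1)"
      using Q by (auto simp: Z_points_def)
    have b: "b \<noteq> 0"
    proof
      assume "b = 0"
      then have "a ^ d = 0" using eq n by (simp add: power_0_left)
      with \<open>b = 0\<close> ab(1) show False by simp
    qed
    have "a / b \<in> ?N" using eq hom[OF b, of "a / b"] b by simp
    moreover have "Q = ?P (a / b)"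
    proof -
      have "(u, v) \<in> proj_rel `` {(a, b)} \<longleftrightarrow> v \<noteq> 0 \<and> u = v * (a / b)" for u v
      proof
        assume "(u, v) \<in> proj_rel `` {(a, b)}"
        then show "v \<noteq> 0 \<and> u = v * (a / b)" using b by (auto simp: proj_rel_def)
      next
        assume "v \<noteq> 0 \<and> u = v * (a / b)"
        then show "(u, v) \<in> proj_rel `` {(a, b)}"
          using b by (auto simp: proj_rel_def intro!: exI[of _ "v / b"])
      qed
      then show ?thesis unfolding ab(2) using mem by auto
    qed
    ultimately show "Q \<in> ?P ` ?N" by blast
  qed
  then show ?thesis by (simp add: bij_betw_same_card)
qed

lemma sum_triple_product:
  "(\<Sum>(a, b, c)\<in>A \<times> B \<times> C. f a * (g b * h c)) =
    sum f A * (sum g B * sum h C :: 'b::comm_semiring_0)"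
proof -
  have "sum g B * sum h C = (\<Sum>p\<in>B \<times> C. g (fst p) * h (snd p))"
    by (simp only: sum_product sum.cartesian_product case_prod_unfold)
  then show ?thesis
    by (simp only: sum_product sum.cartesian_product case_prod_unfold)
qed

context add_char
begin

text \<open>
  Expand the three Gauss sums with variables \<open>a, b, c\<close>. The sum over \<open>\<eta>\<close> restricts to
  \<open>- (a^d) = k^d * b * c^(2 * m)\<close>, which for odd \<open>d\<close> is parametrised by \<open>a = - k * c * x\<close>, \<open>b = c * x^d\<close>. What is
  left is \<open>\<theta>(c * (x^d + 1 - k * x))\<close>, and the sum over \<open>c\<close> detects the equation.
\<close>
lemma gauss_sum_point_count:
  fixes k :: 'a
  assumes k: "k \<noteq> 0" and m: "m > 0"
  shows "(\<Sum>\<eta>\<in>mult_chars. \<eta> (- 1) * conj_char \<eta> (k ^ (2 * m + 1)) *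
      gauss_sum \<theta> (\<lambda>x. \<eta> x ^ (2 * m + 1)) * gauss_sum \<theta> (conj_char \<eta>) *
      gauss_sum \<theta> (\<lambda>x. conj_char \<eta> x ^ (2 * m))) =
    of_nat (CARD('a) - 1) * (of_nat CARD('a) * of_nat (card {x. x ^ (2 * m + 1) + 1 = k * x})
      - of_nat (CARD('a) - 1))"
proof -
  let ?U = "- {0} :: 'a set" and ?d = "2 * m + 1" and ?q = "of_nat CARD('a) :: complex"
  \<comment> \<open>The character \<open>\<eta>\<close> occurs only through its value at \<open>z a b c\<close>, so orthogonality imposes \<open>z a b c = 1\<close>.\<close>
  define z where "z a b c = - 1 * inverse (k ^ ?d) * a ^ ?d * inverse b * inverse c ^ (2 * m)" for a b c :: 'a
  let ?T = "?U \<times> ?U \<times> ?U"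
  have H: "\<eta> (- 1) * conj_char \<eta> (k ^ ?d) * gauss_sum \<theta> (\<lambda>x. \<eta> x ^ ?d) *
      gauss_sum \<theta> (conj_char \<eta>) * gauss_sum \<theta> (\<lambda>x. conj_char \<eta> x ^ (2 * m)) =
      (\<Sum>(a, b, c)\<in>?T. \<eta> (z a b c) * \<theta> (a + b + c))" if \<eta>: "\<eta> \<in> mult_chars" for \<eta>
  proof -
    have 1: "gauss_sum \<theta> (\<lambda>x. \<eta> x ^ ?d) = (\<Sum>a\<in>?U. \<eta> a ^ ?d * \<theta> a)"
      unfolding gauss_sum_def by (rule sum_conv_nonzero) (simp add: mult_char_0[OF \<eta>])
    have 2: "gauss_sum \<theta> (conj_char \<eta>) = (\<Sum>b\<in>?U. conj_char \<eta> b * \<theta> b)"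
      unfolding gauss_sum_def by (rule sum_conv_nonzero) (simp add: conj_char_def mult_char_0[OF \<eta>])
    have 3: "gauss_sum \<theta> (\<lambda>x. conj_char \<eta> x ^ (2 * m)) = (\<Sum>c\<in>?U. conj_char \<eta> c ^ (2 * m) * \<theta> c)"
      unfolding gauss_sum_def
      by (rule sum_conv_nonzero) (use m in \<open>simp add: conj_char_def mult_char_0[OF \<eta>] power_0_left\<close>)
    have "\<eta> (z a b c) * \<theta> (a + b + c) = \<eta> (- 1) * conj_char \<eta> (k ^ ?d) * (\<eta> a ^ ?d * \<theta> a *
        (conj_char \<eta> b * \<theta> b * (conj_char \<eta> c ^ (2 * m) * \<theta> c)))" for a b c
      unfolding z_def mult_char_mult[OF \<eta>] mult_char_power[OF \<eta>] mult_char_inverse[OF \<eta>]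
        conj_char_def theta_add by (simp add: mult_ac)
    then have rhs: "(\<Sum>(a, b, c)\<in>?T. \<eta> (z a b c) * \<theta> (a + b + c)) =
        \<eta> (- 1) * conj_char \<eta> (k ^ ?d) * (\<Sum>(a, b, c)\<in>?T. \<eta> a ^ ?d * \<theta> a *
          (conj_char \<eta> b * \<theta> b * (conj_char \<eta> c ^ (2 * m) * \<theta> c)))"
      by (simp only: sum_distrib_left case_prod_unfold)
    have triple: "(\<Sum>(a, b, c)\<in>?T. \<eta> a ^ ?d * \<theta> a *
          (conj_char \<eta> b * \<theta> b * (conj_char \<eta> c ^ (2 * m) * \<theta> c))) =
        (\<Sum>a\<in>?U. \<eta> a ^ ?d * \<theta> a) *
          ((\<Sum>b\<in>?U. conj_char \<eta> b * \<theta> b) * (\<Sum>c\<in>?U. conj_char \<eta> c ^ (2 * m) * \<theta> c))"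
      by (rule sum_triple_product)
    show ?thesis
      unfolding 1 2 3 rhs triple by (simp only: mult.assoc)
  qed
  have z1: "z a b c = 1 \<longleftrightarrow> b = c * (- (a / (k * c))) ^ ?d" if "a \<noteq> 0" "b \<noteq> 0" "c \<noteq> 0" for a b c
  proof -
    have "(- (a / (k * c))) ^ ?d = - (a ^ ?d * inverse (k ^ ?d) * inverse c ^ (2 * m) * inverse c)"
      using k that(3) by (simp add: power_minus_odd power_divide power_mult_distrib divide_simps)
    then have "c * (- (a / (k * c))) ^ ?d = z a b c * b"
      using that by (simp add: z_def)
    then show ?thesis using that(2) by auto
  qed
  have "(\<Sum>\<eta>\<in>mult_chars. \<eta> (- 1) * conj_char \<eta> (k ^ ?d) * gauss_sum \<theta> (\<lambda>x. \<eta> x ^ ?d) *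
      gauss_sum \<theta> (conj_char \<eta>) * gauss_sum \<theta> (\<lambda>x. conj_char \<eta> x ^ (2 * m))) =
      (\<Sum>\<eta>\<in>mult_chars. \<Sum>(a, b, c)\<in>?T. \<eta> (z a b c) * \<theta> (a + b + c))"
    by (rule sum.cong[OF refl H])
  also have "\<dots> = (\<Sum>t\<in>?T. \<Sum>\<eta>\<in>mult_chars. case t of (a, b, c) \<Rightarrow> \<eta> (z a b c) * \<theta> (a + b + c))"
    by (rule sum.swap)
  also have "\<dots> = (\<Sum>t\<in>?T. case t of (a, b, c) \<Rightarrow>
      if z a b c = 1 then of_nat (CARD('a) - 1) * \<theta> (a + b + c) else 0)"
    by (rule sum.cong[OF refl])
      (auto simp: sum_mult_chars split: if_splits simp flip: sum_distrib_right simp del: of_nat_diff)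
  also have "\<dots> = (\<Sum>t\<in>{(a, b, c)\<in>?T. z a b c = 1}. case t of (a, b, c) \<Rightarrow>
      of_nat (CARD('a) - 1) * \<theta> (a + b + c))"
    by (rule sum.mono_neutral_cong_right) (auto split: if_splits)
  also have "\<dots> = (\<Sum>(x, c)\<in>?U \<times> ?U. of_nat (CARD('a) - 1) * \<theta> (c * (x ^ ?d + 1 - k * x)))"
  proof (rule sum.reindex_bij_witness[of _ "\<lambda>(x, c). (- (k * c * x), c * x ^ ?d, c)"
        "\<lambda>(a, b, c). (- (a / (k * c)), c)"])
    fix t assume "t \<in> {(a, b, c)\<in>?T. z a b c = 1}"
    then obtain a b c where t: "t = (a, b, c)" "a \<noteq> 0" "b \<noteq> 0" "c \<noteq> 0"
        "b = c * (- (a / (k * c))) ^ ?d"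
      using z1 by auto
    define x where "x = - (a / (k * c))"
    have a: "a = - (k * c * x)" using t k by (simp add: x_def)
    have b: "b = c * x ^ ?d" using t(5) by (simp add: x_def)
    show "(case case t of (a, b, c) \<Rightarrow> (- (a / (k * c)), c) of (x, c) \<Rightarrow> (- (k * c * x), c * x ^ ?d, c)) = t"
      using a b k by (simp add: t(1) flip: x_def)
    show "(case t of (a, b, c) \<Rightarrow> (- (a / (k * c)), c)) \<in> ?U \<times> ?U"
      using t k by simp
    have "c * (x ^ ?d + 1 - k * x) = a + b + c"
      by (simp add: a b algebra_simps)
    then show "(case case t of (a, b, c) \<Rightarrow> (- (a / (k * c)), c) of (x, c) \<Rightarrow>
        of_nat (CARD('a) - 1) * \<theta> (c * (x ^ ?d + 1 - k * x))) =
        (case t of (a, b, c) \<Rightarrow> of_nat (CARD('a) - 1) * \<theta> (a + b + c))"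
      by (simp add: t(1) flip: x_def)
  next
    fix t assume "t \<in> ?U \<times> ?U"
    then obtain x c where t: "t = (x, c)" "x \<noteq> 0" "c \<noteq> 0" by auto
    have x: "- (- (k * c * x) / (k * c)) = x" using t k by simp
    have "z (- (k * c * x)) (c * x ^ ?d) c = 1"
      using t k by (subst z1) (simp_all only: x, auto)
    then show "(case t of (x, c) \<Rightarrow> (- (k * c * x), c * x ^ ?d, c)) \<in> {(a, b, c)\<in>?T. z a b c = 1}"
      using t k by simp
    show "(case case t of (x, c) \<Rightarrow> (- (k * c * x), c * x ^ ?d, c) of
        (a, b, c) \<Rightarrow> (- (a / (k * c)), c)) = t"
      using x by (simp add: t(1))
  qed
  also have "\<dots> = (\<Sum>x\<in>?U. \<Sum>c\<in>?U. of_nat (CARD('a) - 1) * \<theta> (c * (x ^ ?d + 1 - k * x)))"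
    by (simp only: sum.cartesian_product)
  also have "\<dots> = of_nat (CARD('a) - 1) *
      (\<Sum>x\<in>?U. (if x ^ ?d + 1 - k * x = 0 then ?q else 0) - 1)"
    by (simp only: sum_distrib_left[symmetric] sum_theta_mult_nonzero)
  also have "(\<Sum>x\<in>?U. (if x ^ ?d + 1 - k * x = 0 then ?q else 0) - 1) =
      (\<Sum>x\<in>?U. if x ^ ?d + 1 = k * x then ?q else 0) - of_nat (card ?U)"
    by (simp add: sum_subtractf)
  also have "(\<Sum>x\<in>?U. if x ^ ?d + 1 = k * x then ?q else 0) = (\<Sum>x | x ^ ?d + 1 = k * x. ?q)"
    by (rule sum.mono_neutral_cong_right) auto
  also have "\<dots> = ?q * of_nat (card {x. x ^ ?d + 1 = k * x})" by simp
  also have "card ?U = CARD('a) - 1" by (simp add: Compl_eq_Diff_UNIV card_units)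
  finally show ?thesis .
qed

end

section \<open>The columns of the hypergeometric series\<close>

text \<open>
  This pairing of \<open>j\<close> with \<open>2 * m + 1 - j\<close>, and the one of \<open>j\<close> with \<open>2 * m - j\<close> below, match a power of a character of
  order \<open>2 * m + 1\<close> or \<open>2 * m\<close> with its inverse.
\<close>
lemma prod_pair_even:
  fixes m :: nat
  shows "(\<Prod>i\<in>{1..2 * m}. f i) = (\<Prod>j\<in>{1..m}. f j * f (2 * m + 1 - j) :: 'b::comm_monoid_mult)"
proof -
  have "{1..2 * m} = {1..m} \<union> {m + 1..2 * m}" by auto
  then have "(\<Prod>i\<in>{1..2 * m}. f i) = (\<Prod>i\<in>{1..m}. f i) * (\<Prod>i\<in>{m + 1..2 * m}. f i)"
    by (simp add: prod.union_disjoint)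
  also have "(\<Prod>i\<in>{m + 1..2 * m}. f i) = (\<Prod>j\<in>{1..m}. f (2 * m + 1 - j))"
    by (rule prod.reindex_bij_witness[of _ "\<lambda>j. 2 * m + 1 - j" "\<lambda>i. 2 * m + 1 - i"]) auto
  finally show ?thesis by (simp add: prod.distrib)
qed

lemma prod_reverse_upper:
  fixes m :: nat
  shows "(\<Prod>i\<in>{m + 1..<2 * m}. f i) = (\<Prod>j\<in>{1..<m}. f (2 * m - j) :: 'b::comm_monoid_mult)"
  by (rule prod.reindex_bij_witness[of _ "\<lambda>j. 2 * m - j" "\<lambda>i. 2 * m - i"]) auto

lemma prod_pair_odd:
  fixes m :: nat
  assumes "m > 0"
  shows "(\<Prod>i\<in>{1..<2 * m}. f i) = f m * (\<Prod>j\<in>{1..<m}. f j * f (2 * m - j) :: 'b::comm_monoid_mult)"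
proof -
  have "{1..<2 * m} = insert m ({1..<m} \<union> {m + 1..<2 * m})" using assms by auto
  then have "(\<Prod>i\<in>{1..<2 * m}. f i) = f m * ((\<Prod>i\<in>{1..<m}. f i) * (\<Prod>i\<in>{m + 1..<2 * m}. f i))"
    by (simp add: prod.union_disjoint)
  then show ?thesis by (simp only: prod_reverse_upper prod.distrib)
qed

text \<open>
  The exponent \<open>i = 0\<close> gives the Gauss sum of \<open>\<eta>\<close> itself: the value at \<open>0\<close> is still \<open>0\<close>, thanks to the factor \<open>\<eta>\<close>.
\<close>
definition twisted_gauss_sum where
  "twisted_gauss_sum \<theta> \<chi> \<eta> i = gauss_sum \<theta> (\<lambda>x. \<chi> x ^ i * \<eta> x)"

lemma power_twist_in_mult_chars:
  "\<chi> \<in> mult_chars \<Longrightarrow> \<eta> \<in> mult_chars \<Longrightarrow> (\<lambda>x. \<chi> x ^ i * \<eta> x) \<in> mult_chars"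
  by (auto simp: mult_chars_def power_mult_distrib)

locale two_characters = add_char \<theta> for \<theta> :: "'a::finite_field \<Rightarrow> complex" +
  fixes \<chi> \<psi> \<eta> :: "'a \<Rightarrow> complex" and m :: nat
  assumes \<chi>: "\<chi> \<in> mult_chars" and \<psi>: "\<psi> \<in> mult_chars" and \<eta>: "\<eta> \<in> mult_chars"
    and ord_\<chi>: "group.ord char_group \<chi> = 2 * m + 1" and ord_\<psi>: "group.ord char_group \<psi> = 2 * m"
    and m: "m > 0"
begin

abbreviation g\<^sub>\<chi> :: "nat \<Rightarrow> complex" where "g\<^sub>\<chi> i \<equiv> twisted_gauss_sum \<theta> \<chi> \<eta> i"

abbreviation g\<^sub>\<psi> :: "nat \<Rightarrow> complex" where "g\<^sub>\<psi> i \<equiv> twisted_gauss_sum \<theta> \<psi> (conj_char \<eta>) i"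

abbreviation G :: "nat \<Rightarrow> nat \<Rightarrow> complex" where "G a c \<equiv> gauss_sum \<theta> (\<lambda>x. \<chi> x ^ a * \<psi> x ^ c)"

lemma conj_\<eta>: "conj_char \<eta> \<in> mult_chars"
  using \<eta> by (rule conj_char_in_mult_chars)

lemma \<psi>_power_order: "x \<noteq> 0 \<Longrightarrow> \<psi> x ^ (2 * m) = 1"
  using mult_char_power_ord[OF \<psi>] by (simp add: ord_\<psi>)

lemma \<chi>_minus_1: "\<chi> (- 1) = 1"
  by (rule mult_char_minus_1_odd_order[OF \<chi>]) (simp add: ord_\<chi>)

text \<open>
  The orders \<open>2 * m + 1\<close> and \<open>2 * m\<close> are coprime, so powers of \<open>\<chi>\<close> and \<open>\<psi>\<close> can only cancel if they are trivial.
  This excludes the degenerate binomial coefficients, where both parameters coincide.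
\<close>
lemma order_dvd_if_mult_eq_1:
  assumes "generates_units g" "\<chi> g ^ a * \<psi> g ^ c = 1"
  shows "2 * m + 1 dvd a"
proof -
  have "1 = (\<chi> g ^ a * \<psi> g ^ c) ^ (2 * m)" using assms(2) by simp
  also have "\<dots> = \<chi> g ^ (2 * m * a) * (\<psi> g ^ (2 * m)) ^ c"
    by (simp add: power_mult_distrib mult.commute flip: power_mult)
  also have "\<dots> = \<chi> g ^ (2 * m * a)"
    using assms(1) by (simp add: \<psi>_power_order generates_units_def)
  finally have "2 * m + 1 dvd 2 * m * a"
    using power_generator_eq_1_iff[OF \<chi> assms(1), of "2 * m * a"] by (simp add: ord_\<chi>)
  moreover have "coprime (2 * m + 1) (2 * m)"
    using coprime_Suc_left_nat[of "2 * m"] by (simp only: Suc_eq_plus1)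
  ultimately show ?thesis by (simp add: coprime_dvd_mult_right_iff)
qed

lemma mixed_char_in_mult_chars: "0 < a \<Longrightarrow> (\<lambda>x. \<chi> x ^ a * \<psi> x ^ c) \<in> mult_chars"
  using \<chi> \<psi> by (auto simp: mult_chars_def power_mult_distrib)

text \<open>
  The inverse of \<open>\<psi>^b\<close> is written as \<open>\<psi>^(2 * m - b)\<close> in order to have natural exponents throughout.
\<close>
lemma char_binom_column:
  assumes "0 < a" "a \<le> 2 * m" "b < 2 * m"
  shows "char_binom (\<lambda>x. \<chi> x ^ a * \<eta> x) (\<lambda>x. \<psi> x ^ b * \<eta> x) =
    \<psi> (- 1) ^ b * \<eta> (- 1) * g\<^sub>\<chi> a * g\<^sub>\<psi> (2 * m - b) / (of_nat CARD('a) * G a (2 * m - b))"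
proof -
  let ?A = "\<lambda>x. \<chi> x ^ a * \<eta> x" and ?B = "\<lambda>x. \<psi> x ^ b * \<eta> x"
  have AB: "?A \<in> mult_chars" "?B \<in> mult_chars"
    by (intro power_twist_in_mult_chars \<chi> \<psi> \<eta>)+
  have inv: "inverse (\<psi> x ^ b) = \<psi> x ^ (2 * m - b)" if "x \<noteq> 0" for x
    using \<psi>_power_order[OF that] assms(3) by (intro inverse_unique) (simp flip: power_add)
  have conj_B: "conj_char ?B = (\<lambda>x. \<psi> x ^ (2 * m - b) * conj_char \<eta> x)"
  proof
    fix x
    show "conj_char ?B x = \<psi> x ^ (2 * m - b) * conj_char \<eta> x"
      by (cases "x = 0") (simp_all add: conj_char_def mult_char_0[OF \<eta>] inv)
  qed
  have A_conj_B: "(\<lambda>x. ?A x * conj_char ?B x) = (\<lambda>x. \<chi> x ^ a * \<psi> x ^ (2 * m - b))"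
  proof
    fix x
    show "?A x * conj_char ?B x = \<chi> x ^ a * \<psi> x ^ (2 * m - b)"
      unfolding conj_B using mult_char_nonzero[OF \<eta>, of x] assms(1)
      by (cases "x = 0") (simp_all add: conj_char_def mult_char_0[OF \<chi>] power_0_left)
  qed
  have "?A \<noteq> ?B"
  proof
    assume eq: "?A = ?B"
    obtain g :: 'a where g: "generates_units g" using ex_generates_units by blast
    then have g0: "g \<noteq> 0" by (simp add: generates_units_def)
    have "\<chi> g ^ a = \<psi> g ^ b" using fun_cong[OF eq, of g] mult_char_nonzero[OF \<eta> g0] by simp
    then have "\<chi> g ^ a * \<psi> g ^ (2 * m - b) = \<psi> g ^ (2 * m)"
      using assms(3) by (simp flip: power_add)
    then have "2 * m + 1 dvd a"
      using order_dvd_if_mult_eq_1[OF g] \<psi>_power_order[OF g0] by simp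
    with assms(1,2) show False by (auto dest: dvd_imp_le)
  qed
  from char_binom_gauss[OF AB this] show ?thesis
    unfolding A_conj_B by (simp add: conj_B twisted_gauss_sum_def)
qed

text \<open>
  The two characters are inverse to each other, and \<open>\<chi>(-1) = 1\<close> because \<open>\<chi>\<close> has odd order.
\<close>
lemma G_pair:
  assumes "0 < j" "j < 2 * m"
  shows "G j (2 * m - j) * G (2 * m + 1 - j) j = \<psi> (- 1) ^ j * of_nat CARD('a)"
proof -
  let ?A = "\<lambda>x. \<chi> x ^ j * \<psi> x ^ (2 * m - j)"
  have A: "?A \<in> mult_chars" using assms by (intro mixed_char_in_mult_chars)
  have conj: "conj_char ?A = (\<lambda>x. \<chi> x ^ (2 * m + 1 - j) * \<psi> x ^ j)"
  proof
    fix x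
    show "conj_char ?A x = \<chi> x ^ (2 * m + 1 - j) * \<psi> x ^ j"
      using fun_cong[OF power_conj_char[OF \<chi> ord_\<chi>[symmetric], of j], of x]
        fun_cong[OF power_conj_char[OF \<psi> ord_\<psi>[symmetric], of "2 * m - j"], of x] assms
      by (simp add: conj_char_def)
  qed
  have "?A \<noteq> triv_char"
  proof
    assume triv: "?A = triv_char"
    obtain g :: 'a where g: "generates_units g" using ex_generates_units by blast
    then have "?A g = 1" using fun_cong[OF triv, of g] by (simp add: triv_char_def generates_units_def)
    then have "2 * m + 1 dvd j" by (rule order_dvd_if_mult_eq_1[OF g])
    with assms show False by (auto dest: dvd_imp_le)
  qed
  moreover have "\<psi> (- 1) ^ (2 * m - j) = \<psi> (- 1) ^ j"
  proof -
    have "\<psi> (- 1) ^ (2 * m - j) * \<psi> (- 1) ^ j = 1"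
      using \<psi>_power_order[of "- 1"] assms by (simp flip: power_add)
    also have "1 = \<psi> (- 1) ^ j * \<psi> (- 1) ^ j"
      using mult_char_minus_1_squared[OF \<psi>] by (simp flip: power_mult_distrib)
    finally show ?thesis using mult_char_nonzero[OF \<psi>, of "- 1"] by simp
  qed
  ultimately show ?thesis
    using gauss_sum_conj[OF A] by (simp add: conj \<chi>_minus_1)
qed

text \<open>
  The column \<open>\<chi>^j\<close> over \<open>\<psi>^j\<close> and its mirror image \<open>\<chi>^(2 * m + 1 - j)\<close> over \<open>\<psi>^(2 * m - j)\<close>: their denominators are
  conjugate Gauss sums.
\<close>
lemma column_pair:
  assumes "0 < j" "j < m"
  shows "char_binom (\<lambda>x. \<chi> x ^ j * \<eta> x) (\<lambda>x. \<psi> x ^ j * \<eta> x) *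
    char_binom (\<lambda>x. \<chi> x ^ (2 * m - j + 1) * \<eta> x) (\<lambda>x. \<psi> x ^ (2 * m - j) * \<eta> x) =
    \<psi> (- 1) ^ j * (g\<^sub>\<chi> j * g\<^sub>\<chi> (2 * m + 1 - j)) * (g\<^sub>\<psi> j * g\<^sub>\<psi> (2 * m - j)) / of_nat CARD('a) ^ 3"
proof -
  have e: "\<psi> (- 1) ^ j * \<psi> (- 1) ^ (2 * m - j) = 1"
    using \<psi>_power_order[of "- 1"] assms by (simp flip: power_add)
  have e2: "\<psi> (- 1) ^ j * \<psi> (- 1) ^ j = 1"
    using mult_char_minus_1_squared[OF \<psi>] by (simp flip: power_mult_distrib)
  have inv: "1 / \<psi> (- 1) ^ j = \<psi> (- 1) ^ j"
    using inverse_unique[OF e2] by (simp add: divide_inverse)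
  have idx: "2 * m - j + 1 = 2 * m + 1 - j" "2 * m - (2 * m - j) = j" using assms by simp_all
  have G: "G j (2 * m - j) * G (2 * m + 1 - j) j = \<psi> (- 1) ^ j * of_nat CARD('a)"
    using assms by (intro G_pair) simp_all
  have c1: "char_binom (\<lambda>x. \<chi> x ^ j * \<eta> x) (\<lambda>x. \<psi> x ^ j * \<eta> x) =
      \<psi> (- 1) ^ j * \<eta> (- 1) * g\<^sub>\<chi> j * g\<^sub>\<psi> (2 * m - j) / (of_nat CARD('a) * G j (2 * m - j))"
    using assms by (intro char_binom_column) simp_all
  have c2: "char_binom (\<lambda>x. \<chi> x ^ (2 * m - j + 1) * \<eta> x) (\<lambda>x. \<psi> x ^ (2 * m - j) * \<eta> x) =
      \<psi> (- 1) ^ (2 * m - j) * \<eta> (- 1) * g\<^sub>\<chi> (2 * m + 1 - j) * g\<^sub>\<psi> j / (of_nat CARD('a) * G (2 * m + 1 - j) j)"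
    unfolding idx(1) using assms by (subst char_binom_column) (simp_all add: idx)
  have "\<psi> (- 1) ^ j * \<eta> (- 1) * g\<^sub>\<chi> j * g\<^sub>\<psi> (2 * m - j) / (of_nat CARD('a) * G j (2 * m - j)) *
      (\<psi> (- 1) ^ (2 * m - j) * \<eta> (- 1) * g\<^sub>\<chi> (2 * m + 1 - j) * g\<^sub>\<psi> j / (of_nat CARD('a) * G (2 * m + 1 - j) j)) =
      (\<psi> (- 1) ^ j * \<psi> (- 1) ^ (2 * m - j)) * (\<eta> (- 1) * \<eta> (- 1)) *
      ((g\<^sub>\<chi> j * g\<^sub>\<chi> (2 * m + 1 - j)) * (g\<^sub>\<psi> j * g\<^sub>\<psi> (2 * m - j))) /
      (of_nat CARD('a) * of_nat CARD('a) * (G j (2 * m - j) * G (2 * m + 1 - j) j))"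
    by (simp add: mult_ac)
  also have "\<dots> = (1 / \<psi> (- 1) ^ j) * ((g\<^sub>\<chi> j * g\<^sub>\<chi> (2 * m + 1 - j)) * (g\<^sub>\<psi> j * g\<^sub>\<psi> (2 * m - j))) / of_nat CARD('a) ^ 3"
    unfolding e mult_char_minus_1_squared[OF \<eta>] G by (simp add: power3_eq_cube mult_ac)
  finally show ?thesis unfolding c1 c2 inv by (simp only: mult.assoc)
qed

text \<open>
  The two columns whose lower parameter is trivial are mirror images of each other, too. They supply
  the Gauss sum of \<open>\<eta>\<inverse>\<close> twice.
\<close>
lemma central_column_pair:
  "char_binom (\<lambda>x. \<chi> x ^ m * \<eta> x) \<eta> * char_binom (\<lambda>x. \<chi> x ^ (m + 1) * \<eta> x) \<eta> =
    (g\<^sub>\<chi> m * g\<^sub>\<chi> (m + 1)) * (g\<^sub>\<psi> 0 * g\<^sub>\<psi> 0) / of_nat CARD('a) ^ 3"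
proof -
  \<comment> \<open>For \<open>b = 0\<close> the exponent \<open>2 * m - b\<close> of \<open>char_binom_column\<close> is \<open>2 * m\<close> and acts like \<open>0\<close>.\<close>
  have period: "g\<^sub>\<psi> (2 * m) = g\<^sub>\<psi> 0"
  proof -
    have "\<psi> x ^ (2 * m) * conj_char \<eta> x = \<psi> x ^ 0 * conj_char \<eta> x" for x
      using \<psi>_power_order[of x] by (cases "x = 0") (simp_all add: mult_char_0[OF conj_\<eta>])
    then show ?thesis by (simp only: twisted_gauss_sum_def)
  qed
  have G: "G a (2 * m) = gauss_sum \<theta> (\<lambda>x. \<chi> x ^ a)" if "0 < a" for a
  proof -
    have "\<chi> x ^ a * \<psi> x ^ (2 * m) = \<chi> x ^ a" for x
      using \<psi>_power_order[of x] that by (cases "x = 0") (simp_all add: mult_char_0[OF \<chi>] power_0_left)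
    then show ?thesis by (simp only:)
  qed
  have c: "char_binom (\<lambda>x. \<chi> x ^ a * \<eta> x) \<eta> =
      \<eta> (- 1) * g\<^sub>\<chi> a * g\<^sub>\<psi> 0 / (of_nat CARD('a) * gauss_sum \<theta> (\<lambda>x. \<chi> x ^ a))" if "0 < a" "a \<le> 2 * m" for a
    using char_binom_column[OF that, of 0] m by (simp add: period G[OF that(1)])
  have "gauss_sum \<theta> (\<lambda>x. \<chi> x ^ m) * gauss_sum \<theta> (\<lambda>x. \<chi> x ^ (m + 1)) = of_nat CARD('a)"
    using gauss_sum_power_conj[OF \<chi> ord_\<chi>[symmetric], of m] m by (simp add: \<chi>_minus_1 mult_2)
  then have g: "of_nat CARD('a) * of_nat CARD('a) * (gauss_sum \<theta> (\<lambda>x. \<chi> x ^ m) * gauss_sum \<theta> (\<lambda>x. \<chi> x ^ (m + 1))) = of_nat CARD('a) ^ 3"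
    by (simp add: power3_eq_cube)
  have "char_binom (\<lambda>x. \<chi> x ^ m * \<eta> x) \<eta> * char_binom (\<lambda>x. \<chi> x ^ (m + 1) * \<eta> x) \<eta> =
      (\<eta> (- 1) * \<eta> (- 1)) * ((g\<^sub>\<chi> m * g\<^sub>\<chi> (m + 1)) * (g\<^sub>\<psi> 0 * g\<^sub>\<psi> 0)) /
      (of_nat CARD('a) * of_nat CARD('a) * (gauss_sum \<theta> (\<lambda>x. \<chi> x ^ m) * gauss_sum \<theta> (\<lambda>x. \<chi> x ^ (m + 1))))"
  proof -
    have "char_binom (\<lambda>x. \<chi> x ^ m * \<eta> x) \<eta> =
        \<eta> (- 1) * g\<^sub>\<chi> m * g\<^sub>\<psi> 0 / (of_nat CARD('a) * gauss_sum \<theta> (\<lambda>x. \<chi> x ^ m))"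
      using m by (intro c) simp_all
    moreover have "char_binom (\<lambda>x. \<chi> x ^ (m + 1) * \<eta> x) \<eta> =
        \<eta> (- 1) * g\<^sub>\<chi> (m + 1) * g\<^sub>\<psi> 0 / (of_nat CARD('a) * gauss_sum \<theta> (\<lambda>x. \<chi> x ^ (m + 1)))"
      using m by (intro c) simp_all
    ultimately show ?thesis by (simp only: times_divide_times_eq mult_ac)
  qed
  then show ?thesis unfolding g by (simp add: mult_char_minus_1_squared[OF \<eta>])
qed

text \<open>
  This sign is left over from the denominators of the columns, and again from the constant in the
  product formula for \<open>\<psi>\<close>; in the end it appears squared.
\<close>
definition sign :: complex where "sign = (\<Prod>j\<in>{1..<m}. \<psi> (- 1) ^ j)"

lemma column_sign_squared: "sign * sign = 1"
proof -
  have "\<psi> (- 1) ^ j * \<psi> (- 1) ^ j = 1" for j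
    using mult_char_minus_1_squared[OF \<psi>] by (simp flip: power_mult_distrib)
  then show ?thesis by (simp add: sign_def flip: prod.distrib)
qed

text \<open>
  Among the Gauss sums for \<open>\<psi>\<close> the index \<open>m\<close> is missing in the columns; the factor on the left completes the
  product. It is provided by the sum over \<open>t\<close>, see \<open>sum_quad_char_twist\<close>.
\<close>
lemma columns_product:
  "char_binom (\<lambda>x. \<chi> x ^ m * \<eta> x) \<eta> *
    ((\<Prod>i\<in>{1..<m}. char_binom (\<lambda>x. \<chi> x ^ i * \<eta> x) (\<lambda>x. \<psi> x ^ i * \<eta> x)) *
    (char_binom (\<lambda>x. \<chi> x ^ (m + 1) * \<eta> x) \<eta> *
    (\<Prod>i\<in>{m + 1..<2 * m}. char_binom (\<lambda>x. \<chi> x ^ (i + 1) * \<eta> x) (\<lambda>x. \<psi> x ^ i * \<eta> x)))) * g\<^sub>\<psi> m =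
    sign * (\<Prod>i\<in>{1..2 * m}. g\<^sub>\<chi> i) * (\<Prod>i\<in>{1..<2 * m}. g\<^sub>\<psi> i) * (g\<^sub>\<psi> 0 * g\<^sub>\<psi> 0) / of_nat CARD('a) ^ (3 * m)"
proof -
  let ?P = "\<lambda>i. char_binom (\<lambda>x. \<chi> x ^ i * \<eta> x) (\<lambda>x. \<psi> x ^ i * \<eta> x)"
  let ?R = "\<lambda>i. char_binom (\<lambda>x. \<chi> x ^ (i + 1) * \<eta> x) (\<lambda>x. \<psi> x ^ i * \<eta> x)"
  have m_split: "{1..m} = insert m {1..<m}" using m by auto
  have XX: "(\<Prod>i\<in>{1..2 * m}. g\<^sub>\<chi> i) = (g\<^sub>\<chi> m * g\<^sub>\<chi> (m + 1)) * (\<Prod>j\<in>{1..<m}. g\<^sub>\<chi> j * g\<^sub>\<chi> (2 * m + 1 - j))"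
    unfolding prod_pair_even m_split by (subst prod.insert) (simp_all add: mult_2)
  have YY: "(\<Prod>i\<in>{1..<2 * m}. g\<^sub>\<psi> i) = g\<^sub>\<psi> m * (\<Prod>j\<in>{1..<m}. g\<^sub>\<psi> j * g\<^sub>\<psi> (2 * m - j))"
    using m by (rule prod_pair_odd)
  have "(\<Prod>i\<in>{1..<m}. ?P i) * (\<Prod>i\<in>{m + 1..<2 * m}. ?R i) =
      (\<Prod>j\<in>{1..<m}. ?P j * ?R (2 * m - j))"
    by (simp only: prod_reverse_upper prod.distrib)
  also have "\<dots> = (\<Prod>j\<in>{1..<m}. \<psi> (- 1) ^ j * (g\<^sub>\<chi> j * g\<^sub>\<chi> (2 * m + 1 - j)) * (g\<^sub>\<psi> j * g\<^sub>\<psi> (2 * m - j)) / of_nat CARD('a) ^ 3)"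
    by (intro prod.cong refl column_pair) auto
  also have "\<dots> = sign * (\<Prod>j\<in>{1..<m}. g\<^sub>\<chi> j * g\<^sub>\<chi> (2 * m + 1 - j)) *
      (\<Prod>j\<in>{1..<m}. g\<^sub>\<psi> j * g\<^sub>\<psi> (2 * m - j)) / of_nat CARD('a) ^ (3 * (m - 1))"
    by (simp only: prod_dividef prod.distrib prod_constant sign_def card_atLeastLessThan power_mult)
  finally have pairs: "(\<Prod>i\<in>{1..<m}. ?P i) * (\<Prod>i\<in>{m + 1..<2 * m}. ?R i) =
      sign * (\<Prod>j\<in>{1..<m}. g\<^sub>\<chi> j * g\<^sub>\<chi> (2 * m + 1 - j)) *
      (\<Prod>j\<in>{1..<m}. g\<^sub>\<psi> j * g\<^sub>\<psi> (2 * m - j)) / of_nat CARD('a) ^ (3 * (m - 1))" .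
  have q3: "of_nat CARD('a) ^ (3 * m) = of_nat CARD('a) ^ 3 * of_nat CARD('a) ^ (3 * (m - 1))"
    using m by (cases m) (simp_all add: algebra_simps flip: power_add)
  have "char_binom (\<lambda>x. \<chi> x ^ m * \<eta> x) \<eta> * ((\<Prod>i\<in>{1..<m}. ?P i) *
      (char_binom (\<lambda>x. \<chi> x ^ (m + 1) * \<eta> x) \<eta> * (\<Prod>i\<in>{m + 1..<2 * m}. ?R i))) * g\<^sub>\<psi> m =
      (char_binom (\<lambda>x. \<chi> x ^ m * \<eta> x) \<eta> * char_binom (\<lambda>x. \<chi> x ^ (m + 1) * \<eta> x) \<eta>) *
      ((\<Prod>i\<in>{1..<m}. ?P i) * (\<Prod>i\<in>{m + 1..<2 * m}. ?R i)) * g\<^sub>\<psi> m"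
    by (simp only: mult_ac)
  also have "\<dots> = (g\<^sub>\<chi> m * g\<^sub>\<chi> (m + 1)) * (g\<^sub>\<psi> 0 * g\<^sub>\<psi> 0) / of_nat CARD('a) ^ 3 *
      (sign * (\<Prod>j\<in>{1..<m}. g\<^sub>\<chi> j * g\<^sub>\<chi> (2 * m + 1 - j)) *
      (\<Prod>j\<in>{1..<m}. g\<^sub>\<psi> j * g\<^sub>\<psi> (2 * m - j)) / of_nat CARD('a) ^ (3 * (m - 1))) * g\<^sub>\<psi> m"
    by (simp only: pairs central_column_pair)
  also have "\<dots> = sign * (\<Prod>i\<in>{1..2 * m}. g\<^sub>\<chi> i) * (\<Prod>i\<in>{1..<2 * m}. g\<^sub>\<psi> i) * (g\<^sub>\<psi> 0 * g\<^sub>\<psi> 0) / of_nat CARD('a) ^ (3 * m)"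
    unfolding XX YY q3 by (simp only: times_divide_eq_left times_divide_eq_right divide_divide_eq_left mult_ac)
  finally show ?thesis .
qed

lemma gauss_product_chi:
  "g\<^sub>\<chi> 0 * (\<Prod>i\<in>{1..2 * m}. g\<^sub>\<chi> i) =
    of_nat CARD('a) ^ m * \<eta> (inverse (of_nat (2 * m + 1))) ^ (2 * m + 1) * gauss_sum \<theta> (\<lambda>x. \<eta> x ^ (2 * m + 1))"
proof -
  have split: "{..<2 * m + 1} = insert 0 {1..2 * m}" by auto
  have range: "{1..<2 * m + 1} = {1..2 * m}" by auto
  have "(\<Prod>i\<in>{1..2 * m}. gauss_sum \<theta> (\<lambda>x. \<chi> x ^ i)) =
      (\<Prod>j\<in>{1..m}. gauss_sum \<theta> (\<lambda>x. \<chi> x ^ j) * gauss_sum \<theta> (\<lambda>x. \<chi> x ^ (2 * m + 1 - j)))"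
    by (rule prod_pair_even)
  also have "\<dots> = (\<Prod>j\<in>{1..m}. of_nat CARD('a))"
    using gauss_sum_power_conj[OF \<chi> ord_\<chi>[symmetric]] by (intro prod.cong refl) (simp add: \<chi>_minus_1)
  finally have const: "(\<Prod>i\<in>{1..2 * m}. gauss_sum \<theta> (\<lambda>x. \<chi> x ^ i)) = of_nat CARD('a) ^ m" by simp
  have "(\<Prod>i<2 * m + 1. g\<^sub>\<chi> i) = g\<^sub>\<chi> 0 * (\<Prod>i\<in>{1..2 * m}. g\<^sub>\<chi> i)"
    unfolding split by (subst prod.insert) auto
  moreover have "(\<Prod>i<2 * m + 1. g\<^sub>\<chi> i) =
      of_nat CARD('a) ^ m * \<eta> (inverse (of_nat (2 * m + 1))) ^ (2 * m + 1) * gauss_sum \<theta> (\<lambda>x. \<eta> x ^ (2 * m + 1))"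
    using hasse_davenport_product[OF \<chi> ord_\<chi>[symmetric] _ \<eta>]
    unfolding twisted_gauss_sum_def range const by simp
  ultimately show ?thesis by simp
qed

lemma gauss_product_psi:
  "g\<^sub>\<psi> 0 * (\<Prod>i\<in>{1..<2 * m}. g\<^sub>\<psi> i) =
    gauss_sum \<theta> (\<lambda>x. \<psi> x ^ m) * sign * of_nat CARD('a) ^ (m - 1) * \<eta> (of_nat (2 * m)) ^ (2 * m) *
      gauss_sum \<theta> (\<lambda>x. conj_char \<eta> x ^ (2 * m))"
proof -
  have split: "{..<2 * m} = insert 0 {1..<2 * m}" using m by auto
  have "(\<Prod>i\<in>{1..<2 * m}. gauss_sum \<theta> (\<lambda>x. \<psi> x ^ i)) =
      gauss_sum \<theta> (\<lambda>x. \<psi> x ^ m) *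
      (\<Prod>j\<in>{1..<m}. gauss_sum \<theta> (\<lambda>x. \<psi> x ^ j) * gauss_sum \<theta> (\<lambda>x. \<psi> x ^ (2 * m - j)))"
    using m by (rule prod_pair_odd)
  also have "(\<Prod>j\<in>{1..<m}. gauss_sum \<theta> (\<lambda>x. \<psi> x ^ j) * gauss_sum \<theta> (\<lambda>x. \<psi> x ^ (2 * m - j))) =
      (\<Prod>j\<in>{1..<m}. \<psi> (- 1) ^ j * of_nat CARD('a))"
    using gauss_sum_power_conj[OF \<psi> ord_\<psi>[symmetric]] by (intro prod.cong refl) simp
  also have "\<dots> = sign * of_nat CARD('a) ^ (m - 1)"
    by (simp add: prod.distrib sign_def)
  finally have const: "(\<Prod>i\<in>{1..<2 * m}. gauss_sum \<theta> (\<lambda>x. \<psi> x ^ i)) =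
      gauss_sum \<theta> (\<lambda>x. \<psi> x ^ m) * sign * of_nat CARD('a) ^ (m - 1)" by (simp only: mult.assoc)
  have "(\<Prod>i<2 * m. g\<^sub>\<psi> i) = g\<^sub>\<psi> 0 * (\<Prod>i\<in>{1..<2 * m}. g\<^sub>\<psi> i)"
    unfolding split by (subst prod.insert) auto
  moreover have "(\<Prod>i<2 * m. g\<^sub>\<psi> i) = gauss_sum \<theta> (\<lambda>x. \<psi> x ^ m) * sign * of_nat CARD('a) ^ (m - 1) *
      conj_char \<eta> (inverse (of_nat (2 * m))) ^ (2 * m) * gauss_sum \<theta> (\<lambda>x. conj_char \<eta> x ^ (2 * m))"
    using hasse_davenport_product[OF \<psi> ord_\<psi>[symmetric] _ conj_\<eta>] m
    unfolding twisted_gauss_sum_def const by simp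
  moreover have "conj_char \<eta> (inverse (of_nat (2 * m))) = \<eta> (of_nat (2 * m))"
    unfolding conj_char_def mult_char_inverse[OF \<eta>] by (rule inverse_inverse_eq)
  ultimately show ?thesis by (simp only:)
qed

end

section \<open>The hypergeometric side\<close>

text \<open>
  Both are \<open>(- 1)^k\<close> on the power \<open>g^k\<close> of a generator, since \<open>\<psi>(g)^m\<close> is a square root of \<open>1\<close> other than \<open>1\<close>.
\<close>
lemma quad_char_eq_power:
  fixes \<psi> :: "'a::finite_field \<Rightarrow> complex"
  assumes \<psi>: "\<psi> \<in> mult_chars" and ord: "group.ord char_group \<psi> = 2 * m" and m: "m > 0"
  shows "quad_char x = \<psi> x ^ m"
proof (cases "x = 0")
  case True
  then show ?thesis using m by (simp add: quad_char_def mult_char_0[OF \<psi>])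
next
  case False
  obtain g :: 'a where g: "generates_units g" using ex_generates_units by blast
  have pow: "\<psi> g ^ n = 1 \<longleftrightarrow> 2 * m dvd n" for n
    using power_generator_eq_1_iff[OF \<psi> g] by (simp add: ord)
  have "(\<psi> g ^ m)\<^sup>2 = 1" using pow[of "2 * m"] by (simp add: mult.commute flip: power_mult)
  moreover have "\<psi> g ^ m \<noteq> 1" using pow[of m] m by (auto dest: dvd_imp_le)
  ultimately have minus_1: "\<psi> g ^ m = - 1" by (simp add: power2_eq_1_iff)
  show ?thesis
  proof (cases "\<exists>y. x = y ^ 2")
    case True
    then obtain y where y: "x = y ^ 2" by blast
    with False have "y \<noteq> 0" by auto
    then have "\<psi> x ^ m = 1"
      using mult_char_power_ord[OF \<psi>, of y] by (simp add: y mult_char_power[OF \<psi>] ord flip: power_mult)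
    then show ?thesis using True False by (simp add: quad_char_def)
  next
    case nonsquare: False
    obtain k where k: "x = g ^ k" using g False by (auto simp: generates_units_def)
    have "odd k"
    proof
      assume "even k"
      then obtain j where "k = j * 2" by (auto elim: evenE simp: mult.commute)
      then have "x = (g ^ j) ^ 2" by (simp add: k power_mult)
      with nonsquare show False by blast
    qed
    have "\<psi> x ^ m = (\<psi> g ^ m) ^ k"
      by (simp add: k mult_char_power[OF \<psi>] mult.commute flip: power_mult)
    also have "\<dots> = - 1" using \<open>odd k\<close> by (simp add: minus_1)
    finally show ?thesis using nonsquare False by (simp add: quad_char_def)
  qed
qed

lemma char_group_pow_mult:
  assumes "A \<in> mult_chars" "B \<in> mult_chars"
  shows "(A [^]\<^bsub>char_group\<^esub> (i::nat)) \<otimes>\<^bsub>char_group\<^esub> B = (\<lambda>x. A x ^ i * B x)"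
proof
  fix x
  show "((A [^]\<^bsub>char_group\<^esub> i) \<otimes>\<^bsub>char_group\<^esub> B) x = A x ^ i * B x"
    using char_group_pow[OF assms(1), of i x] assms
    by (simp add: char_group_def mult_char_0)
qed

lemma triv_char_mult: "B \<in> mult_chars \<Longrightarrow> triv_char \<otimes>\<^bsub>char_group\<^esub> B = B"
  by (auto simp: char_group_def triv_char_def fun_eq_iff mult_char_0)

context two_characters
begin

text \<open>
  The coefficient of \<open>\<eta>\<close> in Greene's series, up to the common factor \<open>q / (q - 1)\<close>.
\<close>
definition columns :: complex where
  "columns = char_binom (\<lambda>x. \<chi> x ^ m * \<eta> x) \<eta> *
    ((\<Prod>i\<in>{1..<m}. char_binom (\<lambda>x. \<chi> x ^ i * \<eta> x) (\<lambda>x. \<psi> x ^ i * \<eta> x)) *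
    (char_binom (\<lambda>x. \<chi> x ^ (m + 1) * \<eta> x) \<eta> *
    (\<Prod>i\<in>{m + 1..<2 * m}. char_binom (\<lambda>x. \<chi> x ^ (i + 1) * \<eta> x) (\<lambda>x. \<psi> x ^ i * \<eta> x))))"

lemma greene_columns:
  "char_binom ((\<chi> [^]\<^bsub>char_group\<^esub> m) \<otimes>\<^bsub>char_group\<^esub> \<eta>) \<eta> *
    prod_list (map2 (\<lambda>A B. char_binom (A \<otimes>\<^bsub>char_group\<^esub> \<eta>) (B \<otimes>\<^bsub>char_group\<^esub> \<eta>))
      (map (\<lambda>i. \<chi> [^]\<^bsub>char_group\<^esub> i) [1..<m] @ [\<chi> [^]\<^bsub>char_group\<^esub> (m + 1)] @
        map (\<lambda>i. \<chi> [^]\<^bsub>char_group\<^esub> (i + 1)) [m + 1..<2 * m])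
      (map (\<lambda>i. \<psi> [^]\<^bsub>char_group\<^esub> i) [1..<m] @ [triv_char] @
        map (\<lambda>i. \<psi> [^]\<^bsub>char_group\<^esub> i) [m + 1..<2 * m])) = columns"
proof -
  let ?cb = "\<lambda>A B. char_binom (A \<otimes>\<^bsub>char_group\<^esub> \<eta>) (B \<otimes>\<^bsub>char_group\<^esub> \<eta>)"
  have map2: "prod_list (map2 ?cb (map f [a..<b]) (map h [a..<b])) = (\<Prod>i\<in>{a..<b}. ?cb (f i) (h i))"
    for f h :: "nat \<Rightarrow> 'a \<Rightarrow> complex" and a b
    by (simp add: zip_map_map zip_same_conv_map comp_def flip: prod.distinct_set_conv_list)
  show ?thesis
    unfolding columns_def
    by (simp only: zip_append length_map list.size map_append prod_list.append map2 zip_Cons_Cons zip_Nil list.map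
        prod_list.Cons prod_list.Nil mult_1_right prod.case char_group_pow_mult[OF \<chi> \<eta>]
        char_group_pow_mult[OF \<psi> \<eta>] triv_char_mult[OF \<eta>])
qed

text \<open>
  The sum over \<open>t\<close> is a Jacobi sum of \<open>\<eta>\<close> and the quadratic character. The reflected form holds for all \<open>\<eta>\<close>,
  including the quadratic character itself.
\<close>
lemma sum_quad_char_twist:
  assumes "\<alpha> \<noteq> 0"
  shows "(\<Sum>t\<in>UNIV. quad_char (1 - t) * \<eta> (t / \<alpha>)) =
    \<eta> (inverse \<alpha>) * (\<eta> (- 1) * g\<^sub>\<chi> 0 * g\<^sub>\<psi> m / gauss_sum \<theta> (\<lambda>x. \<psi> x ^ m))"
proof -
  let ?\<phi> = "\<lambda>x. \<psi> x ^ m"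
  have \<phi>: "?\<phi> \<in> mult_chars" using \<psi> m by (rule mult_chars_power)
  have nontriv: "?\<phi> \<noteq> triv_char" using m by (intro power_char_nontrivial \<psi>) (simp_all add: ord_\<psi>)
  have conj: "conj_char ?\<phi> = ?\<phi>"
    using power_conj_char[OF \<psi> ord_\<psi>[symmetric], of m] m by simp
  have twist: "gauss_sum \<theta> (\<lambda>x. conj_char \<eta> x * conj_char ?\<phi> x) = g\<^sub>\<psi> m"
    unfolding conj twisted_gauss_sum_def by (simp only: mult.commute)
  have "(\<Sum>t\<in>UNIV. quad_char (1 - t) * \<eta> (t / \<alpha>)) = \<eta> (inverse \<alpha>) * jacobi_sum \<eta> ?\<phi>"
    by (simp add: jacobi_sum_def quad_char_eq_power[OF \<psi> ord_\<psi> m] divide_inverse mult_char_mult[OF \<eta>]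
        sum_distrib_left mult_ac)
  also have "jacobi_sum \<eta> ?\<phi> = \<eta> (- 1) * g\<^sub>\<chi> 0 * g\<^sub>\<psi> m / gauss_sum \<theta> ?\<phi>"
    using jacobi_sum_gauss_reflected[OF \<eta> \<phi> nontriv] unfolding twist unfolding conj
    by (simp add: twisted_gauss_sum_def)
  finally show ?thesis .
qed

text \<open>
  The columns together with the sum over \<open>t\<close> contain the complete products of Gauss sums for \<open>\<chi>\<close> and for
  \<open>\<psi>\<close>, to which the Hasse-Davenport formula applies. The power of \<open>2 * m\<close> in \<open>\<alpha>\<close> cancels the one coming from
  the formula for \<open>\<psi>\<close>, whereas the power of \<open>2 * m + 1\<close> coming from \<open>\<chi>\<close> joins \<open>l\<close>.
\<close>
lemma hypergeometric_term:
  assumes l: "l \<noteq> 0" and \<alpha>: "\<alpha> = l ^ (2 * m + 1) * of_nat (2 * m) ^ (2 * m)"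
  shows "of_nat CARD('a) ^ (m + 1) * (columns * (\<Sum>t\<in>UNIV. quad_char (1 - t) * \<eta> (t / \<alpha>))) =
    \<eta> (- 1) * conj_char \<eta> ((of_nat (2 * m + 1) * l) ^ (2 * m + 1)) *
      gauss_sum \<theta> (\<lambda>x. \<eta> x ^ (2 * m + 1)) * gauss_sum \<theta> (conj_char \<eta>) *
      gauss_sum \<theta> (\<lambda>x. conj_char \<eta> x ^ (2 * m))"
proof -
  let ?q = "of_nat CARD('a) :: complex" and ?d = "2 * m + 1"
  let ?gd = "gauss_sum \<theta> (\<lambda>x. \<eta> x ^ ?d)" and ?gm = "gauss_sum \<theta> (\<lambda>x. conj_char \<eta> x ^ (2 * m))"
  let ?g\<phi> = "gauss_sum \<theta> (\<lambda>x. \<psi> x ^ m)"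
  have n2m: "of_nat (2 * m) \<noteq> (0 :: 'a)"
    using of_nat_ord_nonzero[OF \<psi>] unfolding ord_\<psi> .
  then have \<alpha>0: "\<alpha> \<noteq> 0" unfolding \<alpha> using l by (auto simp del: of_nat_mult)
  have g\<phi>: "?g\<phi> \<noteq> 0" by (intro gauss_sum_nonzero mult_chars_power \<psi> m)
  have q0: "?q \<noteq> 0" by simp
  have Y0: "g\<^sub>\<psi> 0 = gauss_sum \<theta> (conj_char \<eta>)" by (simp add: twisted_gauss_sum_def)
  \<comment> \<open>These powers of \<open>q\<close> come from the normalisation and from the constants for \<open>\<chi>\<close> and \<open>\<psi>\<close>.\<close>
  have qpow: "?q ^ (m + 1) * ?q ^ m * ?q ^ (m - 1) = ?q ^ (3 * m)"
    unfolding power_add[symmetric] using m by (intro arg_cong[where f = "\<lambda>n. ?q ^ n"]) simp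
  have args: "\<eta> (inverse (of_nat ?d)) ^ ?d * \<eta> (of_nat (2 * m)) ^ (2 * m) * \<eta> (inverse \<alpha>) =
      conj_char \<eta> ((of_nat ?d * l) ^ ?d)"
  proof -
    have cancel: "inverse a ^ i * u * inverse (b ^ i * u) = inverse ((a * b) ^ i)"
      if "u \<noteq> 0" for a b u :: complex and i
    proof -
      have "inverse a ^ i * u * inverse (b ^ i * u) = inverse (a ^ i) * inverse (b ^ i) * (u * inverse u)"
        by (simp only: inverse_mult_distrib power_inverse mult_ac)
      then show ?thesis using that by (simp add: power_mult_distrib)
    qed
    have "\<eta> (of_nat (2 * m)) ^ (2 * m) \<noteq> 0"
      using mult_char_nonzero[OF \<eta> n2m] by simp
    from cancel[OF this] show ?thesis
      unfolding conj_char_def \<alpha> mult_char_inverse[OF \<eta>] mult_char_mult[OF \<eta>]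
        mult_char_power[OF \<eta>] by (simp only:)
  qed
  have "?q ^ (m + 1) * (columns * (\<Sum>t\<in>UNIV. quad_char (1 - t) * \<eta> (t / \<alpha>))) =
      ?q ^ (m + 1) * (columns * g\<^sub>\<psi> m) * (\<eta> (inverse \<alpha>) * \<eta> (- 1) * g\<^sub>\<chi> 0) / ?g\<phi>"
    unfolding sum_quad_char_twist[OF \<alpha>0] by (simp add: mult_ac)
  also have "columns * g\<^sub>\<psi> m =
      sign * (\<Prod>i\<in>{1..2 * m}. g\<^sub>\<chi> i) * (\<Prod>i\<in>{1..<2 * m}. g\<^sub>\<psi> i) * (g\<^sub>\<psi> 0 * g\<^sub>\<psi> 0) / ?q ^ (3 * m)"
    unfolding columns_def by (rule columns_product)
  also have "?q ^ (m + 1) * \<dots> * (\<eta> (inverse \<alpha>) * \<eta> (- 1) * g\<^sub>\<chi> 0) / ?g\<phi> =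
      ?q ^ (m + 1) * sign * (g\<^sub>\<chi> 0 * (\<Prod>i\<in>{1..2 * m}. g\<^sub>\<chi> i)) * (g\<^sub>\<psi> 0 * (\<Prod>i\<in>{1..<2 * m}. g\<^sub>\<psi> i)) *
      g\<^sub>\<psi> 0 * \<eta> (inverse \<alpha>) * \<eta> (- 1) / (?q ^ (3 * m) * ?g\<phi>)"
    by (simp only: times_divide_eq_left times_divide_eq_right divide_divide_eq_left mult_ac)
  also have "\<dots> = (?q ^ (m + 1) * ?q ^ m * ?q ^ (m - 1)) * (sign * sign) *
      (\<eta> (inverse (of_nat ?d)) ^ ?d * \<eta> (of_nat (2 * m)) ^ (2 * m) * \<eta> (inverse \<alpha>)) *
      (\<eta> (- 1) * ?gd * g\<^sub>\<psi> 0 * ?gm) * ?g\<phi> / (?q ^ (3 * m) * ?g\<phi>)"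
    unfolding gauss_product_chi gauss_product_psi by (simp only: mult_ac)
  also have "\<dots> = conj_char \<eta> ((of_nat ?d * l) ^ ?d) * (\<eta> (- 1) * ?gd * g\<^sub>\<psi> 0 * ?gm)"
    unfolding qpow column_sign_squared args using g\<phi> q0 by simp
  finally show ?thesis unfolding Y0 by (simp only: mult_ac)
qed

end

theorem theorem1p10:
  fixes p e d m :: nat
    and l \<alpha> :: "'a::finite_field"
    and \<chi> \<psi> :: "'a \<Rightarrow> complex"
  assumes "prime p" and "odd p" and "e > 0" and "CARD('a) = p ^ e"
    and "d \<ge> 3" and "odd d" and "[CARD('a) = 1] (mod d * (d - 1))"
    and "l \<noteq> 0"
    and "\<chi> \<in> carrier char_group" and "group.ord char_group \<chi> = d"
    and "\<psi> \<in> carrier char_group" and "group.ord char_group \<psi> = d - 1"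
    and "\<alpha> = l ^ d * (of_nat (d - 1)) ^ (d - 1)"
    and "m = (d - 1) div 2"
  shows "of_nat CARD('a) * of_nat (card (Z_points d l)) =
    of_nat CARD('a) - 1 + of_nat CARD('a) ^ m *
      (\<Sum>t\<in>UNIV. quad_char (1 - t) *
        greene_F (\<chi> [^]\<^bsub>char_group\<^esub> m)
          (map (\<lambda>i. \<chi> [^]\<^bsub>char_group\<^esub> i) [1..<m] @ [\<chi> [^]\<^bsub>char_group\<^esub> (m + 1)] @
            map (\<lambda>i. \<chi> [^]\<^bsub>char_group\<^esub> (i + 1)) [m + 1..<d - 1])
          (map (\<lambda>i. \<psi> [^]\<^bsub>char_group\<^esub> i) [1..<m] @ [triv_char] @
            map (\<lambda>i. \<psi> [^]\<^bsub>char_group\<^esub> i) [m + 1..<d - 1])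
          (t / \<alpha>))"
proof -
  let ?q = "of_nat CARD('a) :: complex"
  let ?As = "map (\<lambda>i. \<chi> [^]\<^bsub>char_group\<^esub> i) [1..<m] @ [\<chi> [^]\<^bsub>char_group\<^esub> (m + 1)] @
    map (\<lambda>i. \<chi> [^]\<^bsub>char_group\<^esub> (i + 1)) [m + 1..<d - 1]"
  let ?Bs = "map (\<lambda>i. \<psi> [^]\<^bsub>char_group\<^esub> i) [1..<m] @ [triv_char] @
    map (\<lambda>i. \<psi> [^]\<^bsub>char_group\<^esub> i) [m + 1..<d - 1]"
  let ?T = "\<lambda>\<eta>. \<Sum>t\<in>UNIV. quad_char (1 - t) * \<eta> (t / \<alpha>)"
  have d: "d = 2 * m + 1" "d - 1 = 2 * m" and m: "m > 0"
    using assms(5,6,14) by (auto elim: oddE)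
  have chars: "\<chi> \<in> mult_chars" "\<psi> \<in> mult_chars"
    using assms(9,11) by (simp_all add: char_group_def)
  obtain \<theta> :: "'a \<Rightarrow> complex" where "\<And>x y. \<theta> (x + y) = \<theta> x * \<theta> y" "\<theta> 0 = 1" "\<exists>x. \<theta> x \<noteq> 1"
    using ex_additive_character[OF assms(1,4)] by blast
  then interpret add_char \<theta> by unfold_locales
  have two: "two_characters \<theta> \<chi> \<psi> \<eta> m" if "\<eta> \<in> mult_chars" for \<eta>
    using that chars assms(10,12) m by unfold_locales (simp_all only: d)
  let ?C = "\<lambda>\<eta>. two_characters.columns \<chi> \<psi> \<eta> m"
  have greene: "greene_F (\<chi> [^]\<^bsub>char_group\<^esub> m) ?As ?Bs x =
      ?q / (?q - 1) * (\<Sum>\<eta>\<in>mult_chars. ?C \<eta> * \<eta> x)" for x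
    unfolding greene_F_def d(2)
    by (intro arg_cong2[where f = "(*)"] sum.cong refl two_characters.greene_columns[OF two])
  have "?q ^ m * (\<Sum>t\<in>UNIV. quad_char (1 - t) * greene_F (\<chi> [^]\<^bsub>char_group\<^esub> m) ?As ?Bs (t / \<alpha>)) =
      ?q ^ m * (?q / (?q - 1) * (\<Sum>\<eta>\<in>mult_chars. ?C \<eta> * ?T \<eta>))"
  proof -
    have "(\<Sum>t\<in>UNIV. quad_char (1 - t) * (?q / (?q - 1) * (\<Sum>\<eta>\<in>mult_chars. ?C \<eta> * \<eta> (t / \<alpha>)))) =
        ?q / (?q - 1) * (\<Sum>t\<in>UNIV. \<Sum>\<eta>\<in>mult_chars. ?C \<eta> * (quad_char (1 - t) * \<eta> (t / \<alpha>)))"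
      by (simp only: sum_distrib_left mult_ac)
    also have "(\<Sum>t\<in>UNIV. \<Sum>\<eta>\<in>mult_chars. ?C \<eta> * (quad_char (1 - t) * \<eta> (t / \<alpha>))) =
        (\<Sum>\<eta>\<in>mult_chars. ?C \<eta> * ?T \<eta>)"
      by (subst sum.swap) (simp only: sum_distrib_left)
    finally show ?thesis unfolding greene by (rule arg_cong)
  qed
  also have "\<dots> = (\<Sum>\<eta>\<in>mult_chars. ?q ^ (m + 1) * (?C \<eta> * ?T \<eta>)) / (?q - 1)"
    unfolding sum_distrib_left[symmetric] by simp
  also have "(\<Sum>\<eta>\<in>mult_chars. ?q ^ (m + 1) * (?C \<eta> * ?T \<eta>)) =
      (\<Sum>\<eta>\<in>mult_chars. \<eta> (- 1) * conj_char \<eta> ((of_nat d * l) ^ (2 * m + 1)) *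
        gauss_sum \<theta> (\<lambda>x. \<eta> x ^ (2 * m + 1)) * gauss_sum \<theta> (conj_char \<eta>) *
        gauss_sum \<theta> (\<lambda>x. conj_char \<eta> x ^ (2 * m)))"
    unfolding d(1) using assms(8) assms(13)[unfolded d(2), unfolded d(1)]
    by (intro sum.cong refl two_characters.hypergeometric_term[OF two])
  also have "\<dots> = of_nat (CARD('a) - 1) *
      (?q * of_nat (card {x. x ^ (2 * m + 1) + 1 = of_nat d * l * x}) - of_nat (CARD('a) - 1))"
  proof (rule gauss_sum_point_count)
    show "of_nat d * l \<noteq> 0"
      using of_nat_ord_nonzero[OF chars(1)] assms(8,10) by simp
  qed (rule m)
  also have "of_nat (CARD('a) - 1) = ?q - 1"
    using card_field_ge_2[where ?'a = 'a] by (simp add: of_nat_diff)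
  also have "card {x. x ^ (2 * m + 1) + 1 = of_nat d * l * x} = card (Z_points d l)"
    using card_Z_points[of d l] assms(5) unfolding d(1) by simp
  finally have "?q ^ m * (\<Sum>t\<in>UNIV. quad_char (1 - t) *
      greene_F (\<chi> [^]\<^bsub>char_group\<^esub> m) ?As ?Bs (t / \<alpha>)) =
      (?q - 1) * (?q * of_nat (card (Z_points d l)) - (?q - 1)) / (?q - 1)" .
  moreover have "?q - 1 \<noteq> 0"
    using card_field_ge_2[where ?'a = 'a] by (metis of_nat_1 of_nat_eq_iff one_less_numeral_iff
        semiring_norm(76) not_le right_minus_eq)
  ultimately show ?thesis by simp
qed

end
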